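(* Let $\mu=\sum_{\lambda\in\Lambda}\mu(\lambda)\delta_\lambda$ and $\nu=\sum_{\gamma\in\Gamma}\nu(\gamma)\delta_\gamma$ be two sparse Fourier quasicrystals on $\mathbb{R}^d$, with $\Lambda=\operatorname{supp}\mu$ and $\Gamma=\operatorname{supp}\nu$. Suppose that there are numberings (enumerations without repetition) $\Lambda=\{\lambda_n\}_{n=1}^\infty$, $\Gamma=\{\gamma_n\}_{n=1}^\infty$ such that $$\lambda_n-\gamma_n\to 0\quad\text{and}\quad \mu(\lambda_n)-\nu(\gamma_n)\to 0\quad\text{as } n\to\infty .$$ Then the measures $\mu$ and $\nu$ coincide.
   Context: Here $B(x,r)=\{y\in\mathbb{R}^d:|y-x|<r\}$ and $\delta_\lambda$ is the unit mass at $\lambda\in\mathbb{R}^d$. $S(\mathbb{R}^d)$ is the Schwartz space and $S^*(\mathbb{R}^d)$ its dual, the space of temperate (tempered) distributions. The Fourier transform is $\hat f(\varphi)=f(\hat\varphi)$ for $\varphi\in S(\mathbb{R}^d)$, where $\hat\varphi(y)=\int_{\mathbb{R}^d}\varphi(x)e^{-2\pi i\langle x,y\rangle}dx$. A complex measure means a complex Radon (locally finite, not necessarily finite) measure on $\mathbb{R}^d$; $|\mu|$ is its total variation measure; a measure is said to belong to $S^*(\mathbb{R}^d)$ if the distribution it defines is (extends to) a temperate distribution. A measure $\mu$ is discrete if for each $\lambda\in\operatorname{supp}\mu$ there is $\varepsilon>0$ with $B(\lambda,\varepsilon)\cap\operatorname{supp}\mu=\{\lambda\}$. A measure $\mu$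 is atomic if $\mu=\sum_{\lambda\in\Lambda}a_\lambda\delta_\lambda$ with $a_\lambda\in\mathbb{C}$ and $\Lambda$ countable; then one writes $\mu(\lambda)=a_\lambda$. A complex measure $\mu$ is a sparse Fourier quasicrystal if $\mu$ is discrete, $\mu\in S^*(\mathbb{R}^d)$, $\hat\mu$ is an atomic measure, $|\hat\mu|\in S^*(\mathbb{R}^d)$, and the numbers $\#(\operatorname{supp}\mu\cap B(x,1))$ are uniformly bounded in $x\in\mathbb{R}^d$. *)

theory Defs
  imports "HOL-Analysis.Analysis"
begin

text \<open>The space is an arbitrary type of class \<open>euclidean_space\<close>, that is, \<open>\<real>\<^sup>d\<close> with
  \<open>d = DIM('a) \<ge> 1\<close>.\<close>


subsection \<open>Schwartz functions and temperate distributions\<close>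

definition partial_deriv :: "'a::euclidean_space \<Rightarrow> ('a \<Rightarrow> complex) \<Rightarrow> 'a \<Rightarrow> complex"
  where "partial_deriv b f x = frechet_derivative f (at x) b"

text \<open>A multi-index is a list of basis vectors, one entry for each differentiation.\<close>

definition partial_derivs :: "'a::euclidean_space list \<Rightarrow> ('a \<Rightarrow> complex) \<Rightarrow> 'a \<Rightarrow> complex"
  where "partial_derivs bs f = foldr partial_deriv bs f"

definition smooth_fun :: "('a::euclidean_space \<Rightarrow> complex) \<Rightarrow> bool"
  where "smooth_fun f \<longleftrightarrow>
    (\<forall>bs. set bs \<subseteq> Basis \<longrightarrow> (\<forall>x. partial_derivs bs f differentiable (at x)))"

definition schwartz :: "('a::euclidean_space \<Rightarrow> complex) set"
  where "schwartz = {f. smooth_fun f \<and>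
    (\<forall>k bs. set bs \<subseteq> Basis \<longrightarrow>
      bounded (range (\<lambda>x. norm x ^ k *\<^sub>R partial_derivs bs f x)))}"

definition schwartz_seminorm ::
    "nat \<Rightarrow> 'a::euclidean_space list \<Rightarrow> ('a \<Rightarrow> complex) \<Rightarrow> real"
  where "schwartz_seminorm k bs f = (SUP x. norm x ^ k * norm (partial_derivs bs f x))"

definition schwartz_topology :: "('a::euclidean_space \<Rightarrow> complex) topology"
  where "schwartz_topology = topology_generated_by
    {{g \<in> schwartz. schwartz_seminorm k bs (\<lambda>x. g x - f x) < r} | k bs f r.
      set bs \<subseteq> Basis \<and> f \<in> schwartz \<and> 0 < r}"

definition test_functions :: "('a::euclidean_space \<Rightarrow> complex) set"
  where "test_functions = {f. smooth_fun f \<and> compact (closure {x. f x \<noteq> 0})}"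

text \<open>Functionals are total functions; only their values on \<open>schwartz\<close> matter.\<close>

definition temperate_distribution :: "(('a::euclidean_space \<Rightarrow> complex) \<Rightarrow> complex) \<Rightarrow> bool"
  where "temperate_distribution T \<longleftrightarrow>
    (\<forall>f\<in>schwartz. \<forall>g\<in>schwartz. T (\<lambda>x. f x + g x) = T f + T g) \<and>
    (\<forall>c. \<forall>f\<in>schwartz. T (\<lambda>x. c * f x) = c * T f) \<and>
    continuous_map schwartz_topology euclidean T"

definition fourier_transform :: "('a::euclidean_space \<Rightarrow> complex) \<Rightarrow> 'a \<Rightarrow> complex"
  where "fourier_transform f y =
    (LINT x|lborel. f x * exp (- 2 * of_real pi * \<i> * of_real (x \<bullet> y)))"

definition fourier_distribution ::
    "(('a::euclidean_space \<Rightarrow> complex) \<Rightarrow> complex) \<Rightarrow> ('a \<Rightarrow> complex) \<Rightarrow> complex"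
  where "fourier_distribution T f = T (fourier_transform f)"


subsection \<open>Complex Radon measures\<close>

definition bounded_borel :: "'a::euclidean_space set set"
  where "bounded_borel = {A. A \<in> sets borel \<and> bounded A}"

text \<open>A locally finite complex measure need not have a value on unbounded sets, so it is a
  countably additive set function on the \<open>\<delta>\<close>-ring of bounded Borel sets.  The value \<open>0\<close>
  elsewhere is a convention that makes equality of measures the equality of the type.\<close>

typedef (overloaded) ('a::euclidean_space) complex_measure =
  "{m :: 'a set \<Rightarrow> complex.
     (\<forall>A. A \<notin> bounded_borel \<longrightarrow> m A = 0) \<and>
     (\<forall>A :: nat \<Rightarrow> 'a set. range A \<subseteq> bounded_borel \<longrightarrow> disjoint_family A \<longrightarrow>
        bounded (\<Union>i. A i) \<longrightarrow> (\<lambda>i. m (A i)) sums m (\<Union>i. A i))}"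
  morphisms mass Complex_Measure
  by (rule exI[of _ "\<lambda>_. 0"]) simp

text \<open>In the next two definitions the set function is countably additive on the Borel sets (for
  \<open>upper_variation\<close>, when \<open>r\<close> is countably additive on \<open>bounded_borel\<close>), so
  \<open>measure_of\<close> yields the measure with these values.\<close>

definition total_variation :: "'a::euclidean_space complex_measure \<Rightarrow> 'a measure"
  where "total_variation \<mu> = measure_of UNIV (sets borel)
    (\<lambda>E. SUP P \<in> {P. finite P \<and> disjoint P \<and> P \<subseteq> bounded_borel \<and> \<Union>P \<subseteq> E}.
       \<Sum>A\<in>P. ennreal (norm (mass \<mu> A)))"

definition upper_variation :: "('a::euclidean_space set \<Rightarrow> real) \<Rightarrow> 'a measure"
  where "upper_variation r = measure_of UNIV (sets borel)
    (\<lambda>E. SUP B \<in> {B \<in> bounded_borel. B \<subseteq> E}. ennreal (r B))"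

text \<open>The integral of \<open>f\<close> against \<open>\<mu>\<close>, by the Jordan decompositions of the real and
  imaginary parts of \<open>\<mu>\<close>.\<close>

definition complex_measure_integral ::
    "'a::euclidean_space complex_measure \<Rightarrow> ('a \<Rightarrow> complex) \<Rightarrow> complex"
  where "complex_measure_integral \<mu> f =
    ((LINT x|upper_variation (\<lambda>A. Re (mass \<mu> A)). f x) -
     (LINT x|upper_variation (\<lambda>A. - Re (mass \<mu> A)). f x)) +
    \<i> * ((LINT x|upper_variation (\<lambda>A. Im (mass \<mu> A)). f x) -
         (LINT x|upper_variation (\<lambda>A. - Im (mass \<mu> A)). f x))"

definition supp :: "'a::euclidean_space complex_measure \<Rightarrow> 'a set"
  where "supp \<mu> = - \<Union>{U. open U \<and> (\<forall>A\<in>bounded_borel. A \<subseteq> U \<longrightarrow> mass \<mu> A = 0)}"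

definition discrete_measure :: "'a::euclidean_space complex_measure \<Rightarrow> bool"
  where "discrete_measure \<mu> \<longleftrightarrow> (\<forall>l\<in>supp \<mu>. \<exists>e>0. ball l e \<inter> supp \<mu> = {l})"

definition atomic_measure :: "'a::euclidean_space complex_measure \<Rightarrow> bool"
  where "atomic_measure \<mu> \<longleftrightarrow>
    (\<exists>L a. countable L \<and> (\<forall>A\<in>bounded_borel. (a has_sum mass \<mu> A) (L \<inter> A)))"


subsection \<open>Sparse Fourier quasicrystals\<close>

text \<open>A measure defines a distribution by integration of test functions.  Test functions are dense
  in the Schwartz space, so at most one temperate distribution extends it.\<close>

definition extends_measure ::
    "(('a::euclidean_space \<Rightarrow> complex) \<Rightarrow> complex) \<Rightarrow> 'a complex_measure \<Rightarrow> bool"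
  where "extends_measure T \<mu> \<longleftrightarrow>
    temperate_distribution T \<and> (\<forall>f\<in>test_functions. T f = complex_measure_integral \<mu> f)"

definition temperate_positive_measure :: "'a::euclidean_space measure \<Rightarrow> bool"
  where "temperate_positive_measure M \<longleftrightarrow>
    (\<exists>T. temperate_distribution T \<and> (\<forall>f\<in>test_functions. T f = (LINT x|M. f x)))"

definition sparse_fourier_quasicrystal :: "'a::euclidean_space complex_measure \<Rightarrow> bool"
  where "sparse_fourier_quasicrystal \<mu> \<longleftrightarrow>
    discrete_measure \<mu> \<and>
    (\<exists>T. extends_measure T \<mu> \<and>
      (\<exists>\<sigma>. extends_measure (fourier_distribution T) \<sigma> \<and>
        atomic_measure \<sigma> \<and> temperate_positive_measure (total_variation \<sigma>))) \<and>
    (\<exists>N::nat. \<forall>x. finite (supp \<mu> \<inter> ball x 1) \<and> card (supp \<mu> \<inter> ball x 1) \<le> N)"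

end

theory Submission
  imports Defs "HOL-Probability.Probability"
begin

text \<open>Let \<open>\<phi>\<close> be a test function. By Fourier inversion, the value of \<open>\<mu>\<close> on the translate of \<open>\<phi>\<close> by \<open>t\<close>
  is \<open>\<Sum>\<^sub>y \<sigma>{y} \<psi>(y) exp (2 \<pi> i t \<bullet> y)\<close>, where \<open>\<psi>\<close> is the inverse Fourier transform of \<open>\<phi>\<close> and \<open>\<sigma>\<close> is the
  Fourier transform of \<open>\<mu>\<close>; the series converges absolutely because the variation of \<open>\<sigma>\<close> is temperate.
  So there are arbitrarily large \<open>t\<close> for which the values of \<open>\<mu>\<close> and of \<open>\<nu>\<close> on finitely many
  test functions hardly change under translation by \<open>t\<close>.

  Fix \<open>p\<close> and a ball around it that contains no other point of the two supports, and split this ball into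
  concentric shells, more of them than there can be points of the two supports in a ball of radius 1.
  After translation by \<open>t\<close>, one of the shells is free of points. A cutoff that decreases from 1 to 0
  within this shell takes the value \<open>\<mu>{p}\<close> before the translation; afterwards it sums the masses of
  boundedly many points \<open>\<lambda>\<^sub>n\<close>, and \<open>\<nu>\<close> gives the sum over the \<open>\<gamma>\<^sub>n\<close> with the same indices. For
  large \<open>t\<close> these indices are large, so the two sums are close and \<open>\<mu>{p} = \<nu>{p}\<close>. The masses themselves
  need not be bounded: points in the shell, where they would matter, do not occur.\<close>

subsection \<open>Schwartz functions and continuity of temperate distributions\<close>

text \<open>The free shell is known only after \<open>t\<close> is chosen, while \<open>t\<close>
  must be chosen for test functions fixed beforehand. So one cutoff per shell is prepared, and the
  coefficients of all cutoffs, for both measures, are added into one summable weight: a single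
  \<open>t\<close> then serves every cutoff. The free shell has a second use: its width exceeds the
  distance of \<open>l n\<close> and \<open>g n\<close> for late indices, so both points of a pair
  lie on the same side of it and the two sums run over one index set, whose size is bounded
  independently of \<open>t\<close>.

  The analytic obstacle is that the inverse transform of a test function is a Schwartz function that
  need not have compact support, whereas a measure determines its distribution through test
  functions only. Temperateness of the variation is therefore turned into polynomial growth of the
  mass of balls, and the formula for test functions is carried over by truncation. Every measure
  involved is a sum of point masses, so the suprema that define variations reduce to weighted
  counting measures.\<close>

lemma partial_derivs_Nil [simp]: "partial_derivs [] f = f"
  and partial_derivs_Cons [simp]: "partial_derivs (b # bs) f =
      partial_deriv b (partial_derivs bs f)"
  and partial_derivs_append: "partial_derivs (as @ bs) f = partial_derivs as (partial_derivs bs f)"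
  by (simp_all add: partial_derivs_def)

lemma partial_deriv_eq: "(f has_derivative f') (at x) \<Longrightarrow> partial_deriv b f x = f' b"
  unfolding partial_deriv_def using frechet_derivative_at by metis

lemma smooth_fun_differentiable:
  "smooth_fun f \<Longrightarrow> set bs \<subseteq> Basis \<Longrightarrow> partial_derivs bs f differentiable (at x)"
  by (simp add: smooth_fun_def)

lemma smooth_fun_differentiable0: "smooth_fun f \<Longrightarrow> f differentiable (at x)"
  using smooth_fun_differentiable[of f "[]"] by simp

lemma smooth_fun_partial_derivs:
  "smooth_fun f \<Longrightarrow> set bs \<subseteq> Basis \<Longrightarrow> smooth_fun (partial_derivs bs f)"
  unfolding smooth_fun_def partial_derivs_append[symmetric] by simp

lemma smooth_fun_continuous:
  assumes "smooth_fun f"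
  shows "continuous_on S f"
  using smooth_fun_differentiable0[OF assms] differentiable_imp_continuous_within
  by (metis continuous_at_imp_continuous_on)

lemma partial_derivs_closed:
  assumes "f \<in> C" "\<And>g b. g \<in> C \<Longrightarrow> b \<in> Basis \<Longrightarrow> partial_deriv b g \<in> C" "set bs \<subseteq> Basis"
  shows "partial_derivs bs f \<in> C"
  using assms(3) by (induction bs) (auto intro: assms)

text \<open>Induction over the list of differentiations stays inside \<open>C\<close>, so no formula
  for higher derivatives is required. This serves constants, the bump algebra, the waves and the
  inverse transforms.\<close>

lemma smooth_funI_closed:
  assumes "f \<in> C" "\<And>g x. g \<in> C \<Longrightarrow> g differentiable (at x)"
    "\<And>g b. g \<in> C \<Longrightarrow> b \<in> Basis \<Longrightarrow> partial_deriv b g \<in> C"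
  shows "smooth_fun f"
  unfolding smooth_fun_def using partial_derivs_closed[OF assms(1,3)] assms(2) by blast

lemma partial_derivs_add:
  assumes "smooth_fun f" "smooth_fun g" "set bs \<subseteq> Basis"
  shows "partial_derivs bs (\<lambda>x. f x + g x) = (\<lambda>x. partial_derivs bs f x + partial_derivs bs g x)"
  using assms(3)
proof (induction bs)
  case (Cons b bs)
  have "partial_deriv b (\<lambda>x. partial_derivs bs f x + partial_derivs bs g x) x
      = partial_deriv b (partial_derivs bs f) x + partial_deriv b (partial_derivs bs g) x" for x
    using frechet_derivative_works[THEN iffD1, OF smooth_fun_differentiable[OF assms(1)], of bs x]
      frechet_derivative_works[THEN iffD1, OF smooth_fun_differentiable[OF assms(2)], of bs x]
          Cons.prems
    by (subst partial_deriv_eq[OF has_derivative_add]) (auto simp: partial_deriv_def)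
  then show ?case using Cons by auto
qed simp

lemma partial_derivs_cmult:
  assumes "smooth_fun f" "set bs \<subseteq> Basis"
  shows "partial_derivs bs (\<lambda>x. c * f x) = (\<lambda>x. c * partial_derivs bs f x)"
  using assms(2)
proof (induction bs)
  case (Cons b bs)
  have "partial_deriv b (\<lambda>x. c * partial_derivs bs f x) x
      = c * partial_deriv b (partial_derivs bs f) x" for x
    using frechet_derivative_works[THEN iffD1, OF smooth_fun_differentiable[OF assms(1)], of bs x]
        Cons.prems
    by (subst partial_deriv_eq[OF has_derivative_mult_right]) (auto simp: partial_deriv_def)
  then show ?case using Cons by auto
qed simp

lemma partial_derivs_scale:
  assumes "smooth_fun f" "set bs \<subseteq> Basis"
  shows "partial_derivs bs (\<lambda>x. f (c *\<^sub>R x)) =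
      (\<lambda>x. of_real (c ^ length bs) * partial_derivs bs f (c *\<^sub>R x))"
  using assms(2)
proof (induction bs)
  case (Cons b bs)
  let ?g = "partial_derivs bs f" and ?k = "complex_of_real (c ^ length bs)"
  have "partial_deriv b (\<lambda>x. ?k * ?g (c *\<^sub>R x)) x = ?k * (c *\<^sub>R partial_deriv b ?g (c *\<^sub>R x))" for x
  proof -
    have g: "(?g has_derivative frechet_derivative ?g (at (c *\<^sub>R x))) (at (c *\<^sub>R x))"
      using frechet_derivative_works smooth_fun_differentiable[OF assms(1)] Cons.prems by auto
    have "((\<lambda>x. ?k * ?g (c *\<^sub>R x)) has_derivative
        (\<lambda>h. ?k * frechet_derivative ?g (at (c *\<^sub>R x)) (c *\<^sub>R h))) (at x)"
      by (intro has_derivative_mult_right has_derivative_compose[where f = "\<lambda>x. c *\<^sub>R x" and x =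
          x and g = ?g, OF _ g]) (auto intro!: derivative_eq_intros)
    then show ?thesis
      by (simp only: partial_deriv_eq partial_deriv_eq[OF g] linear_cmul[OF
          has_derivative_linear[OF g]])
  qed
  then show ?case using Cons by (auto simp: scaleR_conv_of_real)
qed simp

text \<open>The terms of the Leibniz rule: each differentiation goes to the first or to the second
  factor. Listing them with repetition avoids binomial coefficients.\<close>

fun splits :: "'b list \<Rightarrow> ('b list \<times> 'b list) list" where
  "splits [] = [([], [])]"
| "splits (b # bs) = map (\<lambda>(A, B). (b # A, B)) (splits bs) @ map (\<lambda>(A, B). (A, b # B)) (splits bs)"

lemma splits_subset: "(A, B) \<in> set (splits bs) \<Longrightarrow> set A \<subseteq> set bs \<and> set B \<subseteq> set bs"
  by (induction bs arbitrary: A B) fastforce+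

lemma has_derivative_sum_list:
  assumes "\<And>y. y \<in> set ys \<Longrightarrow> (F y has_derivative F' y) (at x)"
  shows "((\<lambda>x. \<Sum>y\<leftarrow>ys. F y x) has_derivative (\<lambda>h. \<Sum>y\<leftarrow>ys. F' y h)) (at x)"
  using assms by (induction ys) (auto intro!: has_derivative_add)

lemma partial_derivs_mult:
  assumes "smooth_fun f" "smooth_fun g" "set bs \<subseteq> Basis"
  shows "partial_derivs bs (\<lambda>x. f x * g x) =
    (\<lambda>x. \<Sum>(A, B)\<leftarrow>splits bs. partial_derivs A f x * partial_derivs B g x)"
  using assms(3)
proof (induction bs)
  case (Cons b bs)
  let ?d = "\<lambda>A f. partial_derivs A f"
  have *: "((\<lambda>x. \<Sum>y\<leftarrow>splits bs. ?d (fst y) f x * ?d (snd y) g x) has_derivative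
     (\<lambda>h. \<Sum>y\<leftarrow>splits bs. ?d (fst y) f x * frechet_derivative (?d (snd y) g) (at x) h
        + frechet_derivative (?d (fst y) f) (at x) h * ?d (snd y) g x)) (at x)" for x
  proof (intro has_derivative_sum_list has_derivative_mult)
    fix y assume "y \<in> set (splits bs)"
    then have "set (fst y) \<subseteq> Basis" "set (snd y) \<subseteq> Basis"
      using splits_subset[of "fst y" "snd y" bs] Cons.prems by auto
    then show "(partial_derivs (fst y) f has_derivative frechet_derivative (?d (fst y) f) (at x))
        (at x)"
      "(partial_derivs (snd y) g has_derivative frechet_derivative (?d (snd y) g) (at x)) (at x)"
      using frechet_derivative_works smooth_fun_differentiable assms by blast+
  qed
  show ?case using Cons.prems
    by (auto simp: Cons.IH case_prod_unfold partial_deriv_eq[OF *] sum_list_addf o_def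
        partial_deriv_def add.commute)
qed simp

lemma differentiable_sum_list:
  fixes F :: "'b \<Rightarrow> 'a::real_normed_vector \<Rightarrow> 'c::real_normed_vector"
  assumes "\<And>y. y \<in> set ys \<Longrightarrow> F y differentiable (at x)"
  shows "(\<lambda>x. \<Sum>y\<leftarrow>ys. F y x) differentiable (at x)"
  using assms by (induction ys) auto

lemma smooth_fun_add:
  assumes "smooth_fun f" "smooth_fun g" shows "smooth_fun (\<lambda>x. f x + g x)"
  using assms by (subst smooth_fun_def) (simp add: partial_derivs_add smooth_fun_differentiable)

lemma smooth_fun_cmult:
  assumes "smooth_fun f" shows "smooth_fun (\<lambda>x. c * f x)"
  using assms by (subst smooth_fun_def) (simp add: partial_derivs_cmult smooth_fun_differentiable)

lemma smooth_fun_mult: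
  assumes "smooth_fun f" "smooth_fun g" shows "smooth_fun (\<lambda>x. f x * g x)"
proof -
  have "partial_derivs bs (\<lambda>x. f x * g x) differentiable (at x)" if "set bs \<subseteq> Basis" for bs x
  proof -
    have "(\<lambda>x. partial_derivs (fst y) f x * partial_derivs (snd y) g x) differentiable (at x)"
      if "y \<in> set (splits bs)" for y
      using splits_subset[of "fst y" "snd y" bs] that \<open>set bs \<subseteq> Basis\<close>
      by (intro differentiable_mult smooth_fun_differentiable assms) auto
    then have "(\<lambda>x. \<Sum>y\<leftarrow>splits bs. partial_derivs (fst y) f x * partial_derivs (snd y) g x)
        differentiable (at x)"
      by (rule differentiable_sum_list)
    then show ?thesis
      by (simp only: partial_derivs_mult[OF assms that] case_prod_unfold)
  qed
  then show ?thesis by (simp add: smooth_fun_def)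
qed

lemma smooth_fun_scale:
  assumes "smooth_fun f" shows "smooth_fun (\<lambda>x. f (c *\<^sub>R x))"
proof -
  have "(\<lambda>x. of_real (c ^ length bs) * partial_derivs bs f (c *\<^sub>R x)) differentiable (at x)"
    if "set bs \<subseteq> Basis" for bs x
    by (intro differentiable_mult differentiable_compose[where f = "partial_derivs bs f" and g =
        "\<lambda>x. c *\<^sub>R x", OF smooth_fun_differentiable[OF assms that]])
      (auto intro!: derivative_intros)
  then show ?thesis
    using assms by (subst smooth_fun_def) (simp add: partial_derivs_scale)
qed

lemma smooth_fun_const: "smooth_fun (\<lambda>x. c)"
proof (rule smooth_funI_closed[where C = "{(\<lambda>x. c) | c. True}"])
  fix g :: "'a \<Rightarrow> complex" and b :: 'a
  assume "g \<in> {(\<lambda>x. c) | c. True}"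
  then obtain c where c: "g = (\<lambda>x. c)" by blast
  have "partial_deriv b g = (\<lambda>x. 0)"
    unfolding c by (rule ext, rule partial_deriv_eq) auto
  then show "partial_deriv b g \<in> {(\<lambda>x. c) | c. True}" by blast
qed auto


section \<open>Schwartz seminorms, and the bound of a temperate distribution by finitely many of
  them\<close>

lemma schwartz_iff:
  "f \<in> schwartz \<longleftrightarrow> smooth_fun f \<and>
    (\<forall>k bs. set bs \<subseteq> Basis \<longrightarrow> (\<exists>C. \<forall>x. norm x ^ k * norm (partial_derivs bs f x) \<le> C))"
  by (auto simp: schwartz_def bounded_iff abs_mult)

lemma schwartz_smooth: "f \<in> schwartz \<Longrightarrow> smooth_fun f"
  by (simp add: schwartz_def)

lemma schwartz_bdd_above:
  "f \<in> schwartz \<Longrightarrow> set bs \<subseteq> Basis \<Longrightarrow>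
    bdd_above (range (\<lambda>x. norm x ^ k * norm (partial_derivs bs f x)))"
  unfolding schwartz_iff bdd_above_def by blast

lemma schwartz_seminorm_upper:
  "f \<in> schwartz \<Longrightarrow> set bs \<subseteq> Basis \<Longrightarrow>
    norm x ^ k * norm (partial_derivs bs f x) \<le> schwartz_seminorm k bs f"
  unfolding schwartz_seminorm_def using schwartz_bdd_above[of f bs k]
  by (intro cSUP_upper) auto

lemma schwartz_seminorm_least:
  "(\<And>x. norm x ^ k * norm (partial_derivs bs f x) \<le> C) \<Longrightarrow> schwartz_seminorm k bs f \<le> C"
  unfolding schwartz_seminorm_def by (intro cSUP_least) auto

lemma schwartz_seminorm_nonneg:
  assumes "f \<in> schwartz" "set bs \<subseteq> Basis"
  shows "0 \<le> schwartz_seminorm k bs f"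
  using schwartz_seminorm_upper[OF assms, where x=0 and k=k]
  by (smt (verit) mult_nonneg_nonneg norm_ge_zero zero_le_power)

lemma schwartz_cmult:
  assumes "f \<in> schwartz" shows "(\<lambda>x. c * f x) \<in> schwartz"
  unfolding schwartz_iff
proof (intro conjI allI impI)
  fix k and bs :: "'a list" assume bs: "set bs \<subseteq> Basis"
  obtain C where C: "\<And>x. norm x ^ k * norm (partial_derivs bs f x) \<le> C"
    using assms bs unfolding schwartz_iff by meson
  have "norm x ^ k * norm (partial_derivs bs (\<lambda>x. c * f x) x) \<le> norm c * C" for x
    using mult_left_mono[OF C[of x], of "norm c"]
    by (simp add: partial_derivs_cmult[OF schwartz_smooth[OF assms] bs] norm_mult mult_ac)
  then show "\<exists>C. \<forall>x. norm x ^ k * norm (partial_derivs bs (\<lambda>x. c * f x) x) \<le> C" by blast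
qed (simp add: smooth_fun_cmult schwartz_smooth[OF assms])

lemma schwartz_add:
  assumes "f \<in> schwartz" "g \<in> schwartz" shows "(\<lambda>x. f x + g x) \<in> schwartz"
  unfolding schwartz_iff
proof (intro conjI allI impI)
  fix k and bs :: "'a list" assume bs: "set bs \<subseteq> Basis"
  obtain C D where C: "\<And>x. norm x ^ k * norm (partial_derivs bs f x) \<le> C"
    and D: "\<And>x. norm x ^ k * norm (partial_derivs bs g x) \<le> D"
    using assms bs unfolding schwartz_iff by meson
  have "norm x ^ k * norm (partial_derivs bs (\<lambda>x. f x + g x) x) \<le> C + D" for x
  proof -
    have "norm x ^ k * norm (partial_derivs bs (\<lambda>x. f x + g x) x) \<le>
      norm x ^ k * (norm (partial_derivs bs f x) + norm (partial_derivs bs g x))"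
      unfolding partial_derivs_add[OF schwartz_smooth schwartz_smooth bs, OF assms]
      by (intro mult_left_mono norm_triangle_ineq) auto
    then show ?thesis using C[of x] D[of x] by (simp add: distrib_left)
  qed
  then show "\<exists>C. \<forall>x. norm x ^ k * norm (partial_derivs bs (\<lambda>x. f x + g x) x) \<le> C" by blast
qed (simp add: smooth_fun_add schwartz_smooth assms)

lemma schwartz_diff:
  assumes "f \<in> schwartz" "g \<in> schwartz" shows "(\<lambda>x. f x - g x) \<in> schwartz"
  using schwartz_add[OF assms(1) schwartz_cmult[OF assms(2), of "-1"]] by simp

lemma schwartz_zero: "(\<lambda>x. 0) \<in> schwartz"
proof -
  have "partial_derivs bs (\<lambda>x::'a. 0::complex) = (\<lambda>x. 0)" if "set bs \<subseteq> Basis" for bs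
    using partial_derivs_cmult[OF smooth_fun_const that, of 0 0] by simp
  then show ?thesis unfolding schwartz_iff using smooth_fun_const by fastforce
qed

lemma schwartz_seminorm_cmult:
  assumes "f \<in> schwartz" "set bs \<subseteq> Basis"
  shows "schwartz_seminorm k bs (\<lambda>x. c * f x) \<le> norm c * schwartz_seminorm k bs f"
  using mult_left_mono[OF schwartz_seminorm_upper[OF assms], of "norm c"]
  by (intro schwartz_seminorm_least)
    (simp add: partial_derivs_cmult[OF schwartz_smooth[OF assms(1)] assms(2)] norm_mult mult_ac)

lemma schwartz_seminorm_add:
  assumes "f \<in> schwartz" "g \<in> schwartz" "set bs \<subseteq> Basis"
  shows "schwartz_seminorm k bs (\<lambda>x. f x + g x) \<le>
      schwartz_seminorm k bs f + schwartz_seminorm k bs g"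
proof (intro schwartz_seminorm_least)
  fix x :: 'a
  have "norm x ^ k * norm (partial_derivs bs (\<lambda>x. f x + g x) x) \<le>
    norm x ^ k * (norm (partial_derivs bs f x) + norm (partial_derivs bs g x))"
    unfolding partial_derivs_add[OF schwartz_smooth schwartz_smooth assms(3), OF assms(1,2)]
    by (intro mult_left_mono norm_triangle_ineq) auto
  then show "norm x ^ k * norm (partial_derivs bs (\<lambda>x. f x + g x) x) \<le>
      schwartz_seminorm k bs f + schwartz_seminorm k bs g"
    using schwartz_seminorm_upper[OF assms(1,3), of x k] schwartz_seminorm_upper[OF assms(2,3), of
        x k]
    by (simp add: distrib_left)
qed

text \<open>Induction over the generation of the topology. The subbasic sets are centred at
  arbitrary \<open>f\<close>, so only those containing 0 have to be recentred there; intersections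
  merge the index sets and take the smaller radius.\<close>

lemma schwartz_nbhd_zero:
  fixes U :: "('a::euclidean_space \<Rightarrow> complex) set"
  assumes "openin schwartz_topology U" "(\<lambda>x. 0) \<in> U"
  shows "\<exists>J e. finite J \<and> (\<forall>(k, bs)\<in>J. set bs \<subseteq> (Basis :: 'a set)) \<and> 0 < e \<and>
    (\<forall>f\<in>schwartz. (\<forall>(k, bs)\<in>J. schwartz_seminorm k bs f < e) \<longrightarrow> f \<in> U)"
proof -
  have "generate_topology_on
    {{g \<in> schwartz. schwartz_seminorm k bs (\<lambda>x. g x - f x) < r} | k bs f r.
      set bs \<subseteq> (Basis :: 'a set) \<and> f \<in> schwartz \<and> 0 < r} U"
    using assms(1) unfolding schwartz_topology_def openin_topology_generated_by_iff .
  then show ?thesis using assms(2)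
  proof (induction rule: generate_topology_on.induct)
    case (Int a b)
    obtain J e where J: "finite J" "\<forall>(k, bs)\<in>J. set bs \<subseteq> (Basis :: 'a set)" "0 < e"
      "\<And>f. f\<in>schwartz \<Longrightarrow> (\<forall>(k, bs)\<in>J. schwartz_seminorm k bs f < e) \<Longrightarrow> f \<in> a"
      using Int.IH(1)[OF IntD1[OF Int.prems]] by blast
    obtain J' e' where J': "finite J'" "\<forall>(k, bs)\<in>J'. set bs \<subseteq> (Basis :: 'a set)" "0 < e'"
      "\<And>f. f\<in>schwartz \<Longrightarrow> (\<forall>(k, bs)\<in>J'. schwartz_seminorm k bs f < e') \<Longrightarrow> f \<in> b"
      using Int.IH(2)[OF IntD2[OF Int.prems]] by blast
    have "f \<in> a \<inter> b" if "f \<in> schwartz" "\<forall>(k, bs)\<in>J \<union> J'. schwartz_seminorm k bs f < min e e'" for f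
      using that J(4)[OF that(1)] J'(4)[OF that(1)] by auto
    then show ?case using J(1-3) J'(1-3)
      by (intro exI[of _ "J \<union> J'"] exI[of _ "min e e'"]) auto
  next
    case (UN K)
    then obtain k where k: "k \<in> K" "(\<lambda>x. 0) \<in> k" by blast
    then obtain J e where J: "finite J" "\<forall>(k, bs)\<in>J. set bs \<subseteq> (Basis :: 'a set)" "0 < e"
      "\<And>f. f\<in>schwartz \<Longrightarrow> (\<forall>(k, bs)\<in>J. schwartz_seminorm k bs f < e) \<Longrightarrow> f \<in> k"
      using UN.IH[OF k] by blast
    then show ?case using k by (intro exI[of _ J] exI[of _ e]) auto
  next
    case (Basis s)
    then obtain k bs f r where s: "s = {g \<in> schwartz. schwartz_seminorm k bs (\<lambda>x. g x - f x) < r}"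
      and bs: "set bs \<subseteq> (Basis :: 'a set)" and f: "f \<in> schwartz" by blast
    have mf: "(\<lambda>x. - f x) \<in> schwartz" using schwartz_cmult[OF f, of "-1"] by simp
    have "schwartz_seminorm k bs (\<lambda>x. - f x) < r" using Basis(2) s by simp
    moreover have "schwartz_seminorm k bs (\<lambda>x. g x - f x) \<le>
      schwartz_seminorm k bs g + schwartz_seminorm k bs (\<lambda>x. - f x)" if "g \<in> schwartz" for g
      using schwartz_seminorm_add[OF that mf bs, of k] by simp
    \<comment> \<open>The new radius is what remains of \<open>r\<close> after the distance from
      \<open>f\<close> to 0; it is positive because 0 lies in the subbasic set.\<close>
    ultimately show ?case using bs unfolding s
      by (intro exI[of _ "{(k, bs)}"] exI[of _ "r - schwartz_seminorm k bs (\<lambda>x. - f x)"]) force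
  qed simp
qed

text \<open>Continuity at 0 gives \<open>norm (T f) < 1\<close> as soon as finitely many seminorms
  are below \<open>e\<close>; homogeneity turns this into a linear bound.\<close>

lemma temperate_distribution_bound:
  fixes T :: "('a::euclidean_space \<Rightarrow> complex) \<Rightarrow> complex"
  assumes T: "temperate_distribution T"
  obtains J C where "finite J" "\<forall>(k, bs)\<in>J. set bs \<subseteq> (Basis :: 'a set)" "0 < C"
    "\<And>f. f \<in> schwartz \<Longrightarrow> norm (T f) \<le> C * (\<Sum>(k, bs)\<in>J. schwartz_seminorm k bs f)"
proof -
  have cm: "T (\<lambda>x. c * f x) = c * T f" if "f \<in> schwartz" for c f
    using T that unfolding temperate_distribution_def by blast
  have top: "topspace schwartz_topology = (schwartz :: ('a \<Rightarrow> complex) set)" (is "?L = ?R")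
  proof
    show "?L \<subseteq> ?R"
      unfolding schwartz_topology_def topology_generated_by_topspace by blast
    show "?R \<subseteq> ?L"
    proof
      fix f :: "'a \<Rightarrow> complex" assume f: "f \<in> schwartz"
      have "schwartz_seminorm 0 [] (\<lambda>x. f x - f x) \<le> 0"
        using schwartz_seminorm_cmult[OF f, of "[]" 0 0] by simp
      then have "f \<in> {g \<in> schwartz. schwartz_seminorm 0 [] (\<lambda>x. g x - f x) < 1}" using f by auto
      then show "f \<in> ?L" using f
        unfolding schwartz_topology_def topology_generated_by_topspace
        by (intro UnionI[of "{g \<in> schwartz. schwartz_seminorm 0 [] (\<lambda>x. g x - f x) < 1}"])
          (simp_all, intro exI[of _ "0::nat"] exI[of _ "[]"] exI[of _ f] exI[of _ "1::real"], simp)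
    qed
  qed
  have z: "T (\<lambda>x. 0) = 0" using cm[OF schwartz_zero, of 0] by simp
  have op: "openin schwartz_topology {f \<in> schwartz. T f \<in> ball 0 1}"
    using T open_ball[of "0::complex" 1] unfolding temperate_distribution_def continuous_map_def top
    by (simp only: open_openin[symmetric] mem_Collect_eq)
  have mem: "(\<lambda>x. 0) \<in> {f \<in> schwartz. T f \<in> ball 0 1}" using z schwartz_zero by simp
  obtain J e where J: "finite J" "\<forall>(k, bs)\<in>J. set bs \<subseteq> (Basis :: 'a set)" "0 < e"
    and imp: "\<And>f. f\<in>schwartz \<Longrightarrow> (\<forall>(k, bs)\<in>J. schwartz_seminorm k bs f < e) \<Longrightarrow>
      f \<in> {f \<in> schwartz. T f \<in> ball 0 1}"
    using schwartz_nbhd_zero[OF op mem] by blast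
  have J4: "norm (T f) < 1"
    if "f\<in>schwartz" "\<And>k bs. (k, bs)\<in>J \<Longrightarrow> schwartz_seminorm k bs f < e" for f
    using imp[OF that(1)] that(2) by auto
  have "norm (T f) \<le> 2 / e * (\<Sum>(k, bs)\<in>J. schwartz_seminorm k bs f)" if f: "f \<in> schwartz" for f
  proof -
    define P where "P = (\<Sum>(k, bs)\<in>J. schwartz_seminorm k bs f)"
    have P: "schwartz_seminorm k bs f \<le> P" if "(k, bs) \<in> J" for k bs
    proof -
      have "(\<lambda>(k, bs). schwartz_seminorm k bs f) (k, bs) \<le> P" unfolding P_def
        using J(2) f by (intro member_le_sum that J) (auto intro: schwartz_seminorm_nonneg)
      then show ?thesis by simp
    qed
    have P0: "0 \<le> P" unfolding P_def using J(2) f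
      by (intro sum_nonneg) (auto intro: schwartz_seminorm_nonneg)
    have "norm (T f) \<le> 2 / e * P + d" if "d > 0" for d
    proof -
      \<comment> \<open>All seminorms of \<open>f\<close> may vanish, so \<open>f\<close> is not
        rescaled by \<open>P\<close> but by \<open>P\<close> plus a slack. The slack is chosen to
        cost exactly \<open>d\<close> in the final estimate, and \<open>d\<close> is
        arbitrary.\<close>
      define m where "m = P + d * e / 2"
      have m: "m > 0" using P0 that J(3) unfolding m_def by (simp add: add_nonneg_pos)
      have "schwartz_seminorm k bs (\<lambda>x. of_real (e / (2 * m)) * f x) < e" if "(k, bs) \<in> J" for k bs
      proof -
        have "schwartz_seminorm k bs (\<lambda>x. of_real (e / (2 * m)) * f x) \<le>
            e / (2 * m) * schwartz_seminorm k bs f"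
          using schwartz_seminorm_cmult[OF f, of bs k "of_real (e / (2 * m))"] J(2,3) that m
          by (auto simp del: of_real_divide of_real_mult)
        also have "\<dots> \<le> e / (2 * m) * m"
          using P[OF that] that J(3) m \<open>d > 0\<close> unfolding m_def
              by (intro mult_left_mono) (auto simp: add_increasing2)
        also have "\<dots> < e" using m J(3) by (simp add: field_simps)
        finally show ?thesis .
      qed
      then have "norm (T (\<lambda>x. of_real (e / (2 * m)) * f x)) < 1"
        by (intro J4 schwartz_cmult f)
      then have "e / (2 * m) * norm (T f) < 1"
        using J(3) m by (simp add: cm[OF f] norm_mult del: of_real_divide of_real_mult)
      then have "norm (T f) < 2 * m / e" using J(3) m by (simp add: field_simps)
      also have "\<dots> = 2 / e * P + d" using J(3) by (simp add: m_def field_simps)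
      finally show ?thesis by simp
    qed
    then show ?thesis unfolding P_def by (rule field_le_epsilon)
  qed
  then show ?thesis using J that[of J "2 / e"] by auto
qed

section \<open>Test functions: supports, bounds, inclusion in the Schwartz space\<close>

lemma test_support_partial_derivs:
  assumes "x \<notin> closure {x. f x \<noteq> 0}"
  shows "partial_derivs bs f x = 0"
proof -
  have "partial_derivs bs f y = 0" if "y \<in> - closure {x. f x \<noteq> 0}" for y
    using that
  proof (induction bs arbitrary: y)
    case Nil
    then show ?case using closure_subset[of "{x. f x \<noteq> 0}"] by auto
  next
    case (Cons b bs)
    \<comment> \<open>The complement of the closed support is open, and by the induction hypothesis
      the lower derivative is 0 on all of it; this is why the induction runs over every such
      \<open>y\<close>.\<close>
    have "((\<lambda>_. 0) has_derivative (\<lambda>_. 0)) (at y)" by simp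
    then have "(partial_derivs bs f has_derivative (\<lambda>_. 0)) (at y)"
      by (rule has_derivative_transform_within_open[OF _ open_Compl[OF closed_closure] Cons.prems])
        (use Cons in auto)
    then show ?case by (simp add: partial_deriv_eq)
  qed
  then show ?thesis using assms by simp
qed

lemma test_functionsD:
  assumes "f \<in> test_functions"
  shows "smooth_fun f" "compact (closure {x. f x \<noteq> 0})"
  using assms by (auto simp: test_functions_def)

lemma test_functionsI:
  assumes "smooth_fun f" "bounded {x. f x \<noteq> 0}"
  shows "f \<in> test_functions"
  using assms by (simp add: test_functions_def)

lemma test_functions_partial_derivs:
  assumes "f \<in> test_functions" "set bs \<subseteq> Basis"
  shows "partial_derivs bs f \<in> test_functions"
proof (rule test_functionsI)
  have "{x. partial_derivs bs f x \<noteq> 0} \<subseteq> closure {x. f x \<noteq> 0}"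
    using test_support_partial_derivs by blast
  then show "bounded {x. partial_derivs bs f x \<noteq> 0}"
    using test_functionsD(2)[OF assms(1)] bounded_subset compact_imp_bounded by blast
qed (simp add: smooth_fun_partial_derivs assms test_functionsD)

lemma test_functions_mult:
  assumes "f \<in> test_functions" "smooth_fun g"
  shows "(\<lambda>x. f x * g x) \<in> test_functions"
proof (rule test_functionsI)
  show "bounded {x. f x * g x \<noteq> 0}"
    by (rule bounded_subset[OF compact_imp_bounded[OF test_functionsD(2)[OF assms(1)]]])
      (use closure_subset[of "{x. f x \<noteq> 0}"] in auto)
qed (simp add: smooth_fun_mult assms test_functionsD)

lemma compact_support_bounded:
  fixes f :: "'a::euclidean_space \<Rightarrow> 'b::real_normed_vector"
  assumes "compact (closure {x. f x \<noteq> 0})" "continuous_on UNIV f"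
  obtains C where "\<And>x. norm (f x) \<le> C"
proof -
  have "bounded (f ` closure {x. f x \<noteq> 0})"
    using assms by (intro compact_imp_bounded compact_continuous_image) (auto intro:
        continuous_on_subset)
  then obtain C where C: "\<And>x. x \<in> closure {x. f x \<noteq> 0} \<Longrightarrow> norm (f x) \<le> C"
    unfolding bounded_iff by blast
  have "norm (f x) \<le> max C 0" for x
    using C[of x] closure_subset[of "{x. f x \<noteq> 0}"] by (cases "f x = 0") auto
  then show ?thesis using that by blast
qed

lemma test_functions_bounded:
  assumes "f \<in> test_functions"
  obtains C where "\<And>x. norm (f x) \<le> C"
  using compact_support_bounded[OF test_functionsD(2)[OF assms] smooth_fun_continuous[OF
      test_functionsD(1)[OF assms]]]
  by blast

lemma test_functions_vanish:
  assumes "f \<in> test_functions"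
  obtains R where "R > 0" "\<And>x. norm x \<ge> R \<Longrightarrow> f x = 0"
proof -
  obtain R where R: "R > 0" "\<forall>x \<in> closure {x. f x \<noteq> 0}. norm x < R"
    using test_functionsD(2)[OF assms] compact_imp_bounded bounded_pos_less by metis
  then have "f x = 0" if "norm x \<ge> R" for x
    using that closure_subset[of "{x. f x \<noteq> 0}"] by force
  then show ?thesis using R that by blast
qed

lemma test_functions_schwartz:
  assumes "f \<in> test_functions"
  shows "f \<in> schwartz"
  unfolding schwartz_iff
proof (intro conjI allI impI)
  fix k and bs :: "'a list" assume "set bs \<subseteq> Basis"
  then have g: "partial_derivs bs f \<in> test_functions"
      by (rule test_functions_partial_derivs[OF assms])
  obtain C where C: "\<And>x. norm (partial_derivs bs f x) \<le> C" using test_functions_bounded[OF g]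
      by blast
  obtain R where R: "R > 0" "\<And>x. norm x \<ge> R \<Longrightarrow> partial_derivs bs f x = 0"
    using test_functions_vanish[OF g] by blast
  have C0: "C \<ge> 0" using C[of 0] norm_ge_zero by (meson order_trans)
  have "norm x ^ k * norm (partial_derivs bs f x) \<le> R ^ k * C" for x
  proof (cases "norm x \<ge> R")
    case True
    then show ?thesis using R C0 by simp
  next
    case False
    then show ?thesis using C R(1) by (intro mult_mono power_mono) auto
  qed
  then show "\<exists>C. \<forall>x. norm x ^ k * norm (partial_derivs bs f x) \<le> C" by blast
qed (simp add: test_functionsD assms)


subsection \<open>Smooth cutoffs\<close>

text \<open>The power of \<open>t\<close> makes the family closed under differentiation up to linear combinations.\<close>

definition exp_pole :: "nat \<Rightarrow> real \<Rightarrow> real"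
  where "exp_pole n t = (if 0 < t then exp (- (1 / t)) / t ^ n else 0)"

lemma exp_pole_0_pos_iff: "0 < exp_pole 0 t \<longleftrightarrow> 0 < t"
  and exp_pole_nonneg: "0 \<le> exp_pole n t"
  and exp_pole_nonpos: "t \<le> 0 \<Longrightarrow> exp_pole n t = 0"
  by (auto simp: exp_pole_def)

lemma exp_pole_tendsto_0: "(exp_pole n \<longlongrightarrow> 0) (at 0)"
proof (rule filterlim_split_at)
  have "(exp_pole n \<longlongrightarrow> 0) (at_left 0) \<longleftrightarrow> ((\<lambda>_. 0) \<longlongrightarrow> (0::real)) (at_left (0::real))"
    by (intro tendsto_cong eventually_at_leftI[of "-1"]) (auto simp: exp_pole_def)
  then show "(exp_pole n \<longlongrightarrow> 0) (at_left 0)" by simp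
  have "((\<lambda>t. inverse t ^ n / exp (inverse t)) \<longlongrightarrow> (0::real)) (at_right 0)"
    by (rule filterlim_compose[OF tendsto_power_div_exp_0 filterlim_inverse_at_top_right])
  moreover have "(exp_pole n \<longlongrightarrow> 0) (at_right 0) \<longleftrightarrow>
      ((\<lambda>t. inverse t ^ n / exp (inverse t)) \<longlongrightarrow> (0::real)) (at_right 0)"
    by (intro tendsto_cong eventually_at_rightI[of _ 1])
      (auto simp: exp_pole_def exp_minus field_simps)
  ultimately show "(exp_pole n \<longlongrightarrow> 0) (at_right 0)" by simp
qed

lemma exp_pole_has_derivative:
  "(exp_pole n has_real_derivative exp_pole (n + 2) t - real n * exp_pole (n + 1) t) (at t)"
proof (cases t "0::real" rule: linorder_cases)
  case less
  have "((\<lambda>_. 0) has_real_derivative 0) (at t)" by simp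
  then have "(exp_pole n has_real_derivative 0) (at t)"
    by (rule has_field_derivative_transform_within_open[where S = "{..<0}"])
      (use less in \<open>auto simp: exp_pole_def\<close>)
  then show ?thesis using less by (simp add: exp_pole_def)
next
  case equal
  \<comment> \<open>The difference quotient at 0 is the next member of the family, whose limit is
    already known.\<close>
  have "((\<lambda>h. exp_pole n h / h) \<longlongrightarrow> 0) (at 0)"
  proof -
    have "exp_pole n h / h = exp_pole (Suc n) h" for h by (simp add: exp_pole_def)
    then show ?thesis using exp_pole_tendsto_0[of "Suc n"] by simp
  qed
  then show ?thesis
    unfolding equal DERIV_def by (simp add: exp_pole_nonpos)
next
  case greater
  have "((\<lambda>t. exp (- (1 / t)) / t ^ n) has_real_derivative
      exp_pole (n + 2) t - real n * exp_pole (n + 1) t) (at t)"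
  proof -
    \<comment> \<open>For \<open>n = 0\<close> the exponent \<open>n - 1\<close> is truncated, but
      the factor \<open>real n\<close> makes both sides 0.\<close>
    have "real n * t ^ (n - 1) * t = real n * t ^ n" by (cases n) auto
    then have "real n * t ^ (n - Suc 0) = real n * t ^ n / t" using greater
        by (simp add: field_simps)
    then show ?thesis
      using greater
      by (auto intro!: derivative_eq_intros simp: exp_pole_def power2_eq_square)
        (simp add: field_simps power2_eq_square)
  qed
  then show ?thesis
    by (rule has_field_derivative_transform_within_open[where S = "{0<..}"])
      (use greater in \<open>auto simp: exp_pole_def\<close>)
qed

text \<open>An algebra stable under all directional derivatives and large enough to contain the
  cutoffs: \<open>s = -1\<close>, \<open>c = b^2\<close> gives the numerator, and adding the case
  \<open>s = 1\<close>, \<open>c = -a^2\<close> gives the denominator. The argument is quadratic in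
  \<open>x - p\<close> and not a function of the norm itself, so nothing breaks at
  \<open>p\<close>.\<close>

inductive_set bump_algebra :: "'a::euclidean_space \<Rightarrow> ('a \<Rightarrow> complex) set" for p where
  const: "(\<lambda>x. c) \<in> bump_algebra p"
| coord: "(\<lambda>x. of_real ((x - p) \<bullet> b)) \<in> bump_algebra p"
| pole: "(\<lambda>x. of_real (exp_pole n (c + s * ((x - p) \<bullet> (x - p))))) \<in> bump_algebra p"
| add: "f \<in> bump_algebra p \<Longrightarrow> g \<in> bump_algebra p \<Longrightarrow> (\<lambda>x. f x + g x) \<in> bump_algebra p"
| mult: "f \<in> bump_algebra p \<Longrightarrow> g \<in> bump_algebra p \<Longrightarrow> (\<lambda>x. f x * g x) \<in> bump_algebra p"
| inv: "f \<in> bump_algebra p \<Longrightarrow> (\<And>x. f x \<noteq> 0) \<Longrightarrow> (\<lambda>x. inverse (f x)) \<in> bump_algebra p"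

lemma bump_algebra_derivative:
  assumes "f \<in> bump_algebra p"
  obtains f' where "\<And>x. (f has_derivative f' x) (at x)" "\<And>b. (\<lambda>x. f' x b) \<in> bump_algebra p"
  using assms
proof (induction arbitrary: thesis)
  case (const c)
  show ?case by (rule const[of "\<lambda>_ _. 0"]) (auto intro: bump_algebra.const)
next
  case (coord b)
  show ?case
    by (rule coord[of "\<lambda>x h. of_real (h \<bullet> b)"])
      (auto intro!: derivative_eq_intros bump_algebra.const)
next
  case (pole n c s)
  let ?q = "\<lambda>x. c + s * ((x - p) \<bullet> (x - p))"
  let ?e = "\<lambda>n x. complex_of_real (exp_pole n (?q x))"
  let ?f' = "\<lambda>x h. (?e (n + 2) x + of_real (- real n) * ?e (n + 1) x) * (of_real (2 * s) *
      of_real ((x - p) \<bullet> h))"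
  show ?case
  proof (rule pole)
    fix x
    have q: "(?q has_derivative (\<lambda>h. s * (2 * ((x - p) \<bullet> h)))) (at x)"
      by (auto intro!: derivative_eq_intros simp: inner_commute)
    have "((\<lambda>x. exp_pole n (?q x)) has_derivative
        (\<lambda>h. (exp_pole (n + 2) (?q x) - real n * exp_pole (n + 1) (?q x)) * (s * (2 * ((x -
            p) \<bullet> h))))) (at x)"
      by (rule has_derivative_compose[OF q exp_pole_has_derivative[unfolded
          has_field_derivative_def]])
    then have "(?e n has_derivative (\<lambda>h. of_real ((exp_pole (n + 2) (?q x) - real n *
        exp_pole (n + 1) (?q x)) * (s * (2 * ((x - p) \<bullet> h)))))) (at x)"
      by (rule has_derivative_of_real)
    then show "(?e n has_derivative ?f' x) (at x)" by (simp add: mult_ac)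
  next
    fix b
    show "(\<lambda>x. ?f' x b) \<in> bump_algebra p"
      by (intro bump_algebra.intros)
  qed
next
  case (add f g)
  obtain f' g' where *: "\<And>x. (f has_derivative f' x) (at x)" "\<And>b. (\<lambda>x. f' x b) \<in> bump_algebra p"
    "\<And>x. (g has_derivative g' x) (at x)" "\<And>b. (\<lambda>x. g' x b) \<in> bump_algebra p"
    using add.IH by metis
  show ?case
    by (rule add.prems[of "\<lambda>x h. f' x h + g' x h"]) (auto intro!: has_derivative_add *
        bump_algebra.add)
next
  case (mult f g)
  obtain f' g' where *: "\<And>x. (f has_derivative f' x) (at x)" "\<And>b. (\<lambda>x. f' x b) \<in> bump_algebra p"
    "\<And>x. (g has_derivative g' x) (at x)" "\<And>b. (\<lambda>x. g' x b) \<in> bump_algebra p"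
    using mult.IH by metis
  show ?case
    by (rule mult.prems[of "\<lambda>x h. f x * g' x h + f' x h * g x"])
      (auto intro!: has_derivative_mult * bump_algebra.add bump_algebra.mult mult.hyps)
next
  case (inv f)
  obtain f' where *: "\<And>x. (f has_derivative f' x) (at x)" "\<And>b. (\<lambda>x. f' x b) \<in> bump_algebra p"
    using inv.IH by metis
  show ?case
  proof (rule inv.prems)
    show "((\<lambda>x. inverse (f x)) has_derivative (\<lambda>h. - 1 * (inverse (f x) * f' x h *
        inverse (f x)))) (at x)" for x
      using Deriv.has_derivative_inverse[OF inv.hyps(2) *(1)] by simp
    show "(\<lambda>x. - 1 * (inverse (f x) * f' x b * inverse (f x))) \<in> bump_algebra p" for b
      by (intro bump_algebra.intros(1,4-6) * inv.hyps)
  qed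
qed

lemma bump_algebra_smooth:
  assumes "f \<in> bump_algebra p" shows "smooth_fun f"
proof (rule smooth_funI_closed[OF assms])
  fix g :: "'a \<Rightarrow> complex" and b x :: 'a assume "g \<in> bump_algebra p"
  then obtain g' where *: "\<And>x. (g has_derivative g' x) (at x)" "\<And>b. (\<lambda>x. g' x b) \<in> bump_algebra p"
    using bump_algebra_derivative by blast
  show "g differentiable (at x)" using * differentiable_def by blast
  have "partial_deriv b g = (\<lambda>x. g' x b)" using partial_deriv_eq[OF *(1)] by blast
  then show "partial_deriv b g \<in> bump_algebra p" using * by simp
qed

text \<open>The usual quotient of flat functions: for \<open>0 \<le> a < b\<close> it is 1 up to
  radius \<open>a\<close> and 0 from radius \<open>b\<close> on. Squared norms keep it smooth at the
  centre.\<close>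

definition cutoff :: "'a::euclidean_space \<Rightarrow> real \<Rightarrow> real \<Rightarrow> 'a \<Rightarrow> real"
  where "cutoff p a b x = exp_pole 0 (b\<^sup>2 - (norm (x - p))\<^sup>2) /
    (exp_pole 0 (b\<^sup>2 - (norm (x - p))\<^sup>2) + exp_pole 0 ((norm (x - p))\<^sup>2 - a\<^sup>2))"

lemma cutoff_nonneg: "0 \<le> cutoff p a b x"
  unfolding cutoff_def by (intro divide_nonneg_nonneg add_nonneg_nonneg exp_pole_nonneg)

lemma cutoff_le_1: "cutoff p a b x \<le> 1"
  unfolding cutoff_def
  using exp_pole_nonneg[of 0 "b\<^sup>2 - (norm (x - p))\<^sup>2"] exp_pole_nonneg[of 0
      "(norm (x - p))\<^sup>2 - a\<^sup>2"]
  by (auto simp: divide_le_eq_1)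

lemma cutoff_eq_1:
  assumes "a < b" "norm (x - p) \<le> a"
  shows "cutoff p a b x = 1"
proof -
  have "(norm (x - p))\<^sup>2 \<le> a\<^sup>2" using assms by (simp add: power_mono)
  moreover have "a\<^sup>2 < b\<^sup>2" using assms norm_ge_zero[of "x - p"]
    by (intro power_strict_mono) linarith+
  ultimately show ?thesis
    using exp_pole_0_pos_iff[of "b\<^sup>2 - (norm (x - p))\<^sup>2"] unfolding cutoff_def
        by (simp add: exp_pole_nonpos)
qed

lemma cutoff_eq_0:
  assumes "0 \<le> b" "b \<le> norm (x - p)"
  shows "cutoff p a b x = 0"
proof -
  have "b\<^sup>2 \<le> (norm (x - p))\<^sup>2" using assms by (simp add: power_mono)
  then show ?thesis unfolding cutoff_def by (simp add: exp_pole_nonpos)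
qed

lemma cutoff_translate: "cutoff p a b (x - t) = cutoff (p + t) a b x"
  by (simp add: cutoff_def algebra_simps)

lemma cutoff_test:
  assumes "0 \<le> a" "a < b"
  shows "(\<lambda>x. complex_of_real (cutoff p a b x)) \<in> test_functions"
proof (rule test_functionsI)
  let ?e = "\<lambda>c s x. complex_of_real (exp_pole 0 (c + s * ((x - p) \<bullet> (x - p))))"
  have ab: "a\<^sup>2 < b\<^sup>2" using assms by (intro power_strict_mono) auto
  have "?e (b\<^sup>2) (-1) x + ?e (- (a\<^sup>2)) 1 x \<noteq> 0" for x
  proof -
    \<comment> \<open>The two arguments add up to b^2 - a^2 > 0, so at least one of them is
      positive.\<close>
    have "0 < exp_pole 0 (b\<^sup>2 + (-1) * ((x - p) \<bullet> (x - p))) \<or> 0 < exp_pole 0 (- (a\<^sup>2) + 1 * ((x -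
        p) \<bullet> (x - p)))"
      unfolding exp_pole_0_pos_iff using ab by linarith
    then have "exp_pole 0 (b\<^sup>2 + (-1) * ((x - p) \<bullet> (x - p))) + exp_pole 0 (- (a\<^sup>2) + 1 * ((x -
        p) \<bullet> (x - p))) > 0"
      by (meson add_nonneg_pos add_pos_nonneg exp_pole_nonneg)
    then show ?thesis by (metis of_real_add of_real_eq_0_iff less_irrefl)
  qed
  then have "(\<lambda>x. ?e (b\<^sup>2) (-1) x * inverse (?e (b\<^sup>2) (-1) x + ?e (- (a\<^sup>2)) 1 x)) \<in> bump_algebra p"
    by (intro bump_algebra.intros)
  moreover have "(\<lambda>x. ?e (b\<^sup>2) (-1) x * inverse (?e (b\<^sup>2) (-1) x + ?e (- (a\<^sup>2)) 1 x))
      = (\<lambda>x. complex_of_real (cutoff p a b x))"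
    by (simp add: cutoff_def power2_norm_eq_inner divide_inverse algebra_simps)
  ultimately show "smooth_fun (\<lambda>x. complex_of_real (cutoff p a b x))"
    using bump_algebra_smooth by metis
  show "bounded {x. complex_of_real (cutoff p a b x) \<noteq> 0}"
  proof (rule bounded_subset[OF bounded_ball[of p b]], rule subsetI)
    fix x assume "x \<in> {x. complex_of_real (cutoff p a b x) \<noteq> 0}"
    then have "\<not> b \<le> norm (x - p)" using cutoff_eq_0[of b x p a] assms by auto
    then show "x \<in> ball p b" by (simp add: dist_norm norm_minus_commute)
  qed
qed


subsection \<open>The inverse Fourier transform of a test function\<close>

definition wave :: "'a::euclidean_space \<Rightarrow> 'a \<Rightarrow> complex"
  where "wave x y = cis (2 * pi * (x \<bullet> y))"

lemma norm_wave [simp]: "norm (wave x y) = 1"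
  and wave_add: "wave (x + x') y = wave x y * wave x' y"
  and wave_add_right: "wave x (y + y') = wave x y * wave x y'"
  and wave_0 [simp]: "wave 0 y = 1" "wave x 0 = 1"
  and wave_scaleR: "wave (c *\<^sub>R x) y = wave x (c *\<^sub>R y)"
  by (simp_all add: wave_def inner_commute inner_add_left inner_add_right distrib_left cis_mult)

lemma continuous_on_wave [continuous_intros]:
  assumes "continuous_on S f" "continuous_on S g"
  shows "continuous_on S (\<lambda>x. wave (f x) (g x))"
  unfolding wave_def by (intro continuous_intros assms)

lemma borel_measurable_wave [measurable]:
  assumes [measurable]: "f \<in> borel_measurable M" "g \<in> borel_measurable M"
  shows "(\<lambda>x. wave (f x) (g x)) \<in> borel_measurable M"
  unfolding wave_def cis_conv_exp by measurable

lemma fourier_transform_wave: "fourier_transform f y = (LINT x|lborel. f x * wave x (- y))"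
  by (simp add: fourier_transform_def wave_def cis_conv_exp mult_ac)

definition inverse_fourier :: "('a::euclidean_space \<Rightarrow> complex) \<Rightarrow> 'a \<Rightarrow> complex"
  where "inverse_fourier f y = (LINT x|lborel. f x * wave x y)"

lemma has_derivative_wave:
  "((\<lambda>x. wave x y) has_derivative (\<lambda>h. 2 * of_real pi * \<i> * of_real (h \<bullet> y) * wave x y)) (at x)"
proof -
  have "((\<lambda>x. \<i> * of_real (2 * pi * (x \<bullet> y))) has_derivative (\<lambda>h. \<i> * of_real (2 * pi *
      (h \<bullet> y)))) (at x)"
    by (auto intro!: derivative_eq_intros)
  from has_derivative_compose[OF this DERIV_exp[unfolded has_field_derivative_def]]
  show ?thesis by (simp add: wave_def cis_conv_exp mult_ac)
qed

lemma smooth_fun_wave: "smooth_fun (\<lambda>x. wave x y)"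
proof (rule smooth_funI_closed[where C = "{(\<lambda>x. c * wave x y) | c. True}"])
  show "(\<lambda>x. wave x y) \<in> {(\<lambda>x. c * wave x y) | c. True}" by (auto intro!: exI[of _ 1])
next
  fix g :: "'a \<Rightarrow> complex" and x b :: 'a
  assume "g \<in> {(\<lambda>x. c * wave x y) | c. True}"
  then obtain c where g: "g = (\<lambda>x. c * wave x y)" by blast
  have *: "(g has_derivative (\<lambda>h. c * (2 * of_real pi * \<i> * of_real (h \<bullet> y) * wave x y))) (at x)"
      for x
    unfolding g by (intro has_derivative_mult_right has_derivative_wave)
  show "g differentiable (at x)" using * differentiable_def by blast
  have "partial_deriv b g = (\<lambda>x. (c * (2 * of_real pi * \<i> * of_real (b \<bullet> y))) * wave x y)"
    using partial_deriv_eq[OF *] by (auto simp: mult_ac)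
  then show "partial_deriv b g \<in> {(\<lambda>x. c * wave x y) | c. True}" by blast
qed

lemma integrable_compact_support:
  fixes f :: "'a::euclidean_space \<Rightarrow> 'b::{banach, second_countable_topology}"
  assumes "continuous_on UNIV f" "\<And>x. R \<le> norm x \<Longrightarrow> f x = 0"
  shows "integrable lborel f"
proof -
  have "integrable lborel (\<lambda>x. indicator (cball 0 R) x *\<^sub>R f x)"
    by (intro borel_integrable_compact continuous_on_subset[OF assms(1)]) auto
  also have "(\<lambda>x. indicator (cball 0 R) x *\<^sub>R f x) = f"
  proof
    fix x show "indicator (cball 0 R) x *\<^sub>R f x = f x"
      by (cases "norm x \<le> R") (use assms(2)[of x] in auto)
  qed
  finally show ?thesis .
qed

lemma test_functions_continuous: "f \<in> test_functions \<Longrightarrow> continuous_on S f"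
  using test_functionsD(1) smooth_fun_continuous by blast

lemma test_functions_integrable_mult:
  assumes "f \<in> test_functions" "continuous_on UNIV g"
  shows "integrable lborel (\<lambda>x. f x * g x)"
proof -
  obtain R where "\<And>x. norm x \<ge> R \<Longrightarrow> f x = 0" using test_functions_vanish[OF assms(1)] by blast
  then show ?thesis
    by (intro integrable_compact_support[of _ R] continuous_intros test_functions_continuous
        assms) auto
qed

lemma test_functions_integrable: "f \<in> test_functions \<Longrightarrow> integrable lborel f"
  using test_functions_integrable_mult[of f "\<lambda>_. 1"] by simp

lemma lborel_integral_plus:
  fixes f :: "'a::euclidean_space \<Rightarrow> 'b::{banach, second_countable_topology}"
  assumes "f \<in> borel_measurable borel"
  shows "(LINT x|lborel. f (c + x)) = (LINT x|lborel. f x)"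
  using integral_distr[of "(+) c" "lborel :: 'a measure" borel f] assms
      by (simp add: lborel_distr_plus)

text \<open>Difference quotients have integral 0 by translation invariance, and they converge to the
  derivative dominatedly. The steps \<open>s n\<close> are at most 1, so all quotients live in the
  ball of radius \<open>R + 1\<close>, where the mean value inequality bounds them by
  \<open>C\<close>.\<close>

lemma integral_partial_deriv_test:
  assumes f: "f \<in> test_functions" and b: "b \<in> Basis"
  shows "(LINT x|lborel. partial_deriv b f x) = 0"
proof -
  note sm = test_functionsD(1)[OF f]
  have df: "partial_deriv b f \<in> test_functions"
    using test_functions_partial_derivs[OF f, of "[b]"] b by simp
  obtain C where C: "\<And>x. norm (partial_deriv b f x) \<le> C" using test_functions_bounded[OF df]
      by blast
  obtain R where R: "R > 0" "\<And>x. norm x \<ge> R \<Longrightarrow> f x = 0" using test_functions_vanish[OF f] by blast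
  have [measurable]: "f \<in> borel_measurable borel" "partial_deriv b f \<in> borel_measurable borel"
    using test_functions_continuous f df by (auto intro!: borel_measurable_continuous_onI)
  define s where "s n = 1 / real (Suc n)" for n
  have s: "0 < s n" "s n \<le> 1" for n by (auto simp: s_def)
  have deriv: "((\<lambda>t. f (x + t *\<^sub>R b)) has_derivative (\<lambda>h. h *\<^sub>R partial_deriv b f (x +
      t *\<^sub>R b))) (at t)" for x t
  proof -
    have g: "(f has_derivative frechet_derivative f (at (x + t *\<^sub>R b))) (at (x + t *\<^sub>R b))"
      using smooth_fun_differentiable0[OF sm] frechet_derivative_works by blast
    have "((\<lambda>t. f (x + t *\<^sub>R b)) has_derivative (\<lambda>h. frechet_derivative f (at (x +
        t *\<^sub>R b)) (h *\<^sub>R b))) (at t)"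
      by (rule has_derivative_compose[where f = "\<lambda>t. x + t *\<^sub>R b" and g = f, OF _ g])
        (auto intro!: derivative_eq_intros)
    then show ?thesis
      by (simp add: linear_cmul[OF has_derivative_linear[OF g]] partial_deriv_def)
  qed
  define F where "F n x = (f (s n *\<^sub>R b + x) - f x) /\<^sub>R s n" for n x
  have "(\<lambda>n. LINT x|lborel. F n x) \<longlonglongrightarrow> (LINT x|lborel. partial_deriv b f x)"
  proof (rule integral_dominated_convergence)
    show "integrable lborel (\<lambda>x. indicator (cball 0 (R + 1)) x *\<^sub>R C :: real)"
      by (intro borel_integrable_compact) auto
    show "AE x in lborel. (\<lambda>n. F n x) \<longlonglongrightarrow> partial_deriv b f x"
    proof (rule AE_I2)
      fix x
      have "((\<lambda>h. (f (x + h *\<^sub>R b) - f x - h *\<^sub>R partial_deriv b f x) /\<^sub>R norm h) \<longlongrightarrow> 0) (at 0)"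
        using deriv[of x 0] unfolding has_derivative_at_within by simp
      moreover have "filterlim s (at 0) sequentially"
        using LIMSEQ_inverse_real_of_nat unfolding filterlim_at s_def
            by (auto simp: inverse_eq_divide)
      ultimately have "(\<lambda>n. (f (x + s n *\<^sub>R b) - f x - s n *\<^sub>R partial_deriv b f x) /\<^sub>R norm (s
          n)) \<longlonglongrightarrow> 0"
        by (rule filterlim_compose)
      moreover have "(f (x + s n *\<^sub>R b) - f x - s n *\<^sub>R partial_deriv b f x) /\<^sub>R norm (s n) =
          F n x - partial_deriv b f x" for n
        using s(1)[of n] by (simp add: F_def scaleR_diff_right add.commute)
      ultimately have "(\<lambda>n. F n x - partial_deriv b f x) \<longlonglongrightarrow> 0" by simp
      then show "(\<lambda>n. F n x) \<longlonglongrightarrow> partial_deriv b f x" by (simp add: LIM_zero_iff)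
    qed
    show "AE x in lborel. norm (F n x) \<le> indicator (cball 0 (R + 1)) x *\<^sub>R C" for n
    proof (rule AE_I2)
      fix x
      show "norm (F n x) \<le> indicator (cball 0 (R + 1)) x *\<^sub>R C"
      proof (cases "norm x \<le> R + 1")
        case True
        have "continuous_on {0..s n} (\<lambda>t. f (x + t *\<^sub>R b))"
          by (rule continuous_on_compose2[OF test_functions_continuous[OF f, of UNIV]]) (auto
              intro!: continuous_intros)
        from mvt_general[OF s(1)[of n] this deriv]
        obtain t where "norm (f (x + s n *\<^sub>R b) - f (x + 0 *\<^sub>R b)) \<le>
            norm ((s n - 0) *\<^sub>R partial_deriv b f (x + t *\<^sub>R b))"
          by blast
        also have "\<dots> \<le> s n * C" using s(1)[of n] C by (auto intro!: mult_left_mono)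
        finally have "norm (f (x + s n *\<^sub>R b) - f x) / s n \<le> C"
          using s(1)[of n] by (simp add: pos_divide_le_eq mult.commute)
        then show ?thesis using True s(1)[of n]
            by (simp add: F_def add.commute divide_inverse mult.commute)
      next
        case False
        have "norm (s n *\<^sub>R b) \<le> 1" using s[of n] b by simp
        then have "norm (s n *\<^sub>R b + x) \<ge> R"
          using False norm_triangle_ineq2[of x "- (s n *\<^sub>R b)"] by (simp add: add.commute)
        then show ?thesis using False R by (simp add: F_def)
      qed
    qed
  qed (simp_all add: F_def)
  moreover have "(LINT x|lborel. F n x) = 0" for n
  proof -
    have i: "integrable lborel f" by (rule test_functions_integrable[OF f])
    have i': "integrable lborel (\<lambda>x. f (s n *\<^sub>R b + x))"
      using integrable_distr[of "(+) (s n *\<^sub>R b)" "lborel :: 'a measure" borel f] i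
          by (simp add: lborel_distr_plus)
    show ?thesis unfolding F_def using i i' by (simp add: lborel_integral_plus)
  qed
  ultimately show ?thesis using LIMSEQ_unique[OF _ tendsto_const] by auto
qed

text \<open>Integration by parts: the product of \<open>f\<close> with a wave is again a test
  function, so its derivative has integral 0.\<close>

lemma inverse_fourier_partial_deriv:
  assumes f: "f \<in> test_functions" and b: "b \<in> Basis"
  shows "inverse_fourier (partial_deriv b f) y =
      - (2 * of_real pi * \<i> * of_real (b \<bullet> y)) * inverse_fourier f y"
proof -
  let ?c = "2 * of_real pi * \<i> * of_real (b \<bullet> y) :: complex"
  have df: "partial_deriv b f \<in> test_functions"
    using test_functions_partial_derivs[OF f, of "[b]"] b by simp
  have t: "(\<lambda>x. f x * wave x y) \<in> test_functions" by (intro test_functions_mult f smooth_fun_wave)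
  have "partial_deriv b (\<lambda>x. f x * wave x y) x =
      partial_deriv b f x * wave x y + ?c * (f x * wave x y)" for x
  proof -
    have "(f has_derivative frechet_derivative f (at x)) (at x)"
      using smooth_fun_differentiable0[OF test_functionsD(1)[OF f]] frechet_derivative_works
          by blast
    from partial_deriv_eq[OF has_derivative_mult[OF this has_derivative_wave[of y x]], of b]
    show ?thesis by (simp add: partial_deriv_def mult_ac)
  qed
  then have "0 = (LINT x|lborel. partial_deriv b f x * wave x y + ?c * (f x * wave x y))"
    using integral_partial_deriv_test[OF t b] by simp
  also have "\<dots> = inverse_fourier (partial_deriv b f) y + ?c * inverse_fourier f y"
  proof -
    have i: "integrable lborel (\<lambda>x. partial_deriv b f x * wave x y)"
        "integrable lborel (\<lambda>x. f x * wave x y)"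
      by (intro test_functions_integrable_mult df f continuous_intros)+
    show ?thesis
      unfolding inverse_fourier_def
      by (simp only: Bochner_Integration.integral_add[OF i(1) integrable_mult_right[OF i(2)]]
          integral_mult_right_zero)
  qed
  finally have "inverse_fourier (partial_deriv b f) y + ?c * inverse_fourier f y = 0" by (rule sym)
  then show ?thesis by (simp only: eq_neg_iff_add_eq_0 mult_minus_left)
qed

lemma smooth_fun_coordinate: "smooth_fun (\<lambda>x. complex_of_real (x \<bullet> b))"
  using bump_algebra_smooth[OF bump_algebra.coord[of 0 b]] by simp

text \<open>Differentiation under the integral with an explicit remainder: |exp(is) - 1 - is| is at
  most s^2/2, so the error is at most \<open>B * (norm (z - y))^2\<close>. The second moment
  \<open>B\<close> is finite because \<open>f\<close> has compact support.\<close>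

lemma inverse_fourier_has_derivative:
  assumes f: "f \<in> test_functions"
  shows "(inverse_fourier f has_derivative
    (\<lambda>h. inverse_fourier (\<lambda>x. 2 * of_real pi * \<i> * of_real (x \<bullet> h) * f x) y)) (at y)"
proof (rule has_derivativeI_sandwich[of 1])
  let ?D = "\<lambda>h. inverse_fourier (\<lambda>x. 2 * of_real pi * \<i> * of_real (x \<bullet> h) * f x) y"
  have int: "integrable lborel (\<lambda>x. f x * g x)" if "continuous_on UNIV g" for g
    using test_functions_integrable_mult[OF f that] .
  have intD: "integrable lborel (\<lambda>x. 2 * of_real pi * \<i> * of_real (x \<bullet> h) * f x * wave x y)" for h
    using int[of "\<lambda>x. 2 * of_real pi * \<i> * of_real (x \<bullet> h) * wave x y"]
    by (simp add: mult_ac continuous_intros)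
  have "linear ?D"
  proof (rule linearI)
    fix h k
    show "?D (h + k) = ?D h + ?D k"
      unfolding inverse_fourier_def
      by (subst Bochner_Integration.integral_add[symmetric, OF intD intD])
        (simp add: inner_add_right algebra_simps)
    fix r
    show "?D (r *\<^sub>R h) = r *\<^sub>R ?D h"
      unfolding inverse_fourier_def
      by (subst integral_scaleR_right[symmetric]) (simp add: scaleR_conv_of_real mult_ac)
  qed
  then show "bounded_linear ?D" by (simp add: linear_conv_bounded_linear)
  define B where "B = (LINT x|lborel. norm (f x) * (2 * pi * norm x)\<^sup>2 / 2)"
  have intB: "integrable lborel (\<lambda>x. norm (f x) * (2 * pi * norm x)\<^sup>2 / 2)"
  proof -
    have "integrable lborel (\<lambda>x. norm (f x * of_real ((2 * pi * norm x)\<^sup>2 / 2)))"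
      by (intro integrable_norm int continuous_intros) auto
    moreover have "norm (f x * of_real ((2 * pi * norm x)\<^sup>2 / 2)) =
        norm (f x) * (2 * pi * norm x)\<^sup>2 / 2" for x
      by (simp only: norm_mult norm_of_real abs_of_nonneg zero_le_power2 divide_nonneg_pos
          zero_less_numeral times_divide_eq_right)
    ultimately show ?thesis by simp
  qed
  have est: "norm (inverse_fourier f z - inverse_fourier f y - ?D (z - y)) \<le> B * (norm (z - y))\<^sup>2"
      for z
  proof -
    define h where "h = z - y"
    have z: "z = y + h" by (simp add: h_def)
    let ?r = "\<lambda>x. f x * wave x z - f x * wave x y - 2 * of_real pi * \<i> * of_real (x \<bullet> h) * f x *
        wave x y"
    have i1: "integrable lborel (\<lambda>x. f x * wave x z)" "integrable lborel (\<lambda>x. f x * wave x y)"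
      by (intro int continuous_intros)+
    have "inverse_fourier f z - inverse_fourier f y - ?D h = (LINT x|lborel. ?r x)"
      unfolding inverse_fourier_def
      by (simp only: Bochner_Integration.integral_diff[OF Bochner_Integration.integrable_diff[OF
          i1] intD]
          Bochner_Integration.integral_diff[OF i1])
    also have "norm \<dots> \<le> (LINT x|lborel. norm (f x) * (2 * pi * norm x)\<^sup>2 / 2 * (norm h)\<^sup>2)"
    proof (rule Bochner_Integration.integral_norm_bound_integral)
      show "integrable lborel ?r" by (intro Bochner_Integration.integrable_diff i1 intD)
      show "integrable lborel (\<lambda>x. norm (f x) * (2 * pi * norm x)\<^sup>2 / 2 * (norm h)\<^sup>2)"
        by (intro integrable_mult_left intB)
      fix x
      let ?t = "2 * pi * (x \<bullet> h)"
      have "?r x = f x * wave x y * (cis ?t - 1 - \<i> * ?t)"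
        by (simp add: z wave_add_right wave_def[of x h] algebra_simps)
      moreover have "norm (cis ?t - 1 - \<i> * ?t) \<le> ?t\<^sup>2 / 2"
        using iexp_approx1[of ?t 1] by (simp add: cis_conv_exp power2_eq_square diff_diff_eq)
      moreover have "?t\<^sup>2 \<le> (2 * pi * norm x)\<^sup>2 * (norm h)\<^sup>2"
      proof -
        have "\<bar>x \<bullet> h\<bar> \<le> norm x * norm h" by (rule Cauchy_Schwarz_ineq2)
        then have "(x \<bullet> h)\<^sup>2 \<le> (norm x * norm h)\<^sup>2" by (metis abs_ge_zero power2_abs power_mono)
        then show ?thesis by (simp add: power_mult_distrib mult_left_mono)
      qed
      ultimately show "norm (?r x) \<le> norm (f x) * (2 * pi * norm x)\<^sup>2 / 2 * (norm h)\<^sup>2"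
        using mult_left_mono[of "norm (cis ?t - 1 - \<i> * ?t)"
            "(2 * pi * norm x)\<^sup>2 * (norm h)\<^sup>2 / 2" "norm (f x)"]
        by (simp add: norm_mult mult_ac)
    qed
    also have "\<dots> = B * (norm h)\<^sup>2" by (simp add: B_def)
    finally show ?thesis by (simp add: h_def)
  qed
  show "norm (inverse_fourier f z - inverse_fourier f y - ?D (z - y)) / norm (z - y) \<le>
      B * norm (z - y)"
    if "z \<noteq> y" for z
    using est[of z] that by (simp add: field_simps power2_eq_square)
  have "((\<lambda>z. B * norm (z - y)) \<longlongrightarrow> B * norm (y - y)) (at y)" by (intro tendsto_intros)
  then show "((\<lambda>z. B * norm (z - y)) \<longlongrightarrow> 0) (at y)" by simp
qed simp

text \<open>Differentiating the transform multiplies \<open>f\<close> by a coordinate, which leaves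
  a test function. Hence decay proved for all transforms of test functions also covers all their
  derivatives.\<close>

lemma inverse_fourier_partial_derivs:
  assumes "f \<in> test_functions" "set bs \<subseteq> Basis"
  shows "partial_derivs bs (inverse_fourier f) \<in> inverse_fourier ` test_functions"
    "smooth_fun (inverse_fourier f)"
proof -
  have d: "partial_deriv b g \<in> inverse_fourier ` test_functions"
    if "g \<in> inverse_fourier ` test_functions" for g and b :: 'a
  proof -
    obtain f where f: "f \<in> test_functions" and g: "g = inverse_fourier f" using \<open>g \<in> _\<close> by blast
    have "partial_deriv b g = inverse_fourier (\<lambda>x. 2 * of_real pi * \<i> * of_real (x \<bullet> b) * f x)"
      unfolding g using partial_deriv_eq[OF inverse_fourier_has_derivative[OF f]] by blast
    moreover have "(\<lambda>x. f x * (2 * of_real pi * \<i> * of_real (x \<bullet> b))) \<in> test_functions"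
      by (intro test_functions_mult f smooth_fun_cmult smooth_fun_coordinate)
    ultimately show ?thesis by (simp add: mult.commute)
  qed
  show "partial_derivs bs (inverse_fourier f) \<in> inverse_fourier ` test_functions"
    by (rule partial_derivs_closed) (use assms d in auto)
  show "smooth_fun (inverse_fourier f)"
  proof (rule smooth_funI_closed[OF imageI[OF assms(1)] _ d])
    fix g :: "'a \<Rightarrow> complex" and x assume "g \<in> inverse_fourier ` test_functions"
    then show "g differentiable (at x)"
      using inverse_fourier_has_derivative unfolding differentiable_def by blast
  qed
qed

text \<open>One power of \<open>norm y\<close> is bounded by the sum of the coordinates \<bar>y
  \<bullet> b\<bar>, and each of these is absorbed by differentiating \<open>f\<close>; the
  induction must therefore range over all test functions. The factor 2 pi is dropped since it is at
  least 1.\<close>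

lemma inverse_fourier_decay:
  assumes "f \<in> test_functions"
  shows "\<exists>C. \<forall>y. norm y ^ k * norm (inverse_fourier f y) \<le> C"
  using assms
proof (induction k arbitrary: f)
  case 0
  have "norm (inverse_fourier f y) \<le> (LINT x|lborel. norm (f x))" for y
    using integral_norm_bound[of lborel "\<lambda>x. f x * wave x y"]
        by (simp add: inverse_fourier_def norm_mult)
  then show ?case by auto
next
  case (Suc k)
  have "\<exists>C. \<forall>y. norm y ^ k * norm (inverse_fourier (partial_deriv b f) y) \<le> C" if "b \<in> Basis" for b
    using Suc.IH test_functions_partial_derivs[OF Suc.prems, of "[b]"] that by simp
  then obtain C where C: "\<And>b y. b \<in> Basis \<Longrightarrow> norm y ^ k * norm (inverse_fourier (partial_deriv b f)
      y) \<le> C b"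
    by metis
  have "norm y ^ Suc k * norm (inverse_fourier f y) \<le> (\<Sum>b\<in>Basis. C b)" for y
  proof -
    have "norm y ^ Suc k * norm (inverse_fourier f y) \<le>
        (\<Sum>b\<in>Basis. \<bar>y \<bullet> b\<bar>) * (norm y ^ k * norm (inverse_fourier f y))"
      using mult_right_mono[OF norm_le_l1[of y], of "norm y ^ k * norm (inverse_fourier f y)"]
          by (simp add: mult_ac)
    also have "\<dots> = (\<Sum>b\<in>Basis. norm y ^ k * (\<bar>y \<bullet> b\<bar> * norm (inverse_fourier f y)))"
      by (simp add: sum_distrib_left sum_distrib_right mult_ac)
    also have "\<dots> \<le> (\<Sum>b\<in>Basis. C b)"
    proof (rule sum_mono)
      fix b :: 'a assume b: "b \<in> Basis"
      have "norm (inverse_fourier (partial_deriv b f) y) =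
          2 * pi * (\<bar>y \<bullet> b\<bar> * norm (inverse_fourier f y))"
        by (simp add: inverse_fourier_partial_deriv[OF Suc.prems b] norm_mult inner_commute)
      moreover have "1 \<le> 2 * pi" using pi_ge_two by simp
      ultimately have "\<bar>y \<bullet> b\<bar> * norm (inverse_fourier f y) \<le>
          norm (inverse_fourier (partial_deriv b f) y)"
        using mult_right_mono[of 1 "2 * pi" "\<bar>y \<bullet> b\<bar> * norm (inverse_fourier f y)"] by simp
      then show "norm y ^ k * (\<bar>y \<bullet> b\<bar> * norm (inverse_fourier f y)) \<le> C b"
        using C[OF b, of y] by (meson mult_left_mono norm_ge_zero order_trans zero_le_power)
    qed
    finally show ?thesis .
  qed
  then show ?case by blast
qed

lemma inverse_fourier_schwartz:
  assumes "f \<in> test_functions"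
  shows "inverse_fourier f \<in> schwartz"
  unfolding schwartz_iff
proof (intro conjI allI impI)
  show "smooth_fun (inverse_fourier f)" using inverse_fourier_partial_derivs(2)[OF assms, of "[]"]
      by simp
  fix k and bs :: "'a list" assume "set bs \<subseteq> Basis"
  then obtain g where "g \<in> test_functions" "partial_derivs bs (inverse_fourier f) =
      inverse_fourier g"
    using inverse_fourier_partial_derivs(1)[OF assms] by blast
  then show "\<exists>C. \<forall>x. norm x ^ k * norm (partial_derivs bs (inverse_fourier f) x) \<le> C"
    using inverse_fourier_decay by metis
qed


subsection \<open>Fourier inversion\<close>

text \<open>Tensor products factor through Lebesgue measure as a product measure. Applied to the
  integrable weight below and to the Gaussian.\<close>

lemma
  fixes f :: "'a::euclidean_space \<Rightarrow> real \<Rightarrow> 'b::{real_normed_field, banach,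
      second_countable_topology}"
  assumes f: "\<And>b. b \<in> Basis \<Longrightarrow> integrable lborel (f b)"
  shows lborel_integrable_prod: "integrable lborel (\<lambda>x. \<Prod>b\<in>Basis. f b (x \<bullet> b))"
    and lborel_integral_prod:
      "(LINT x|lborel. (\<Prod>b\<in>Basis. f b (x \<bullet> b))) = (\<Prod>b\<in>Basis. LINT t|lborel. f b t)"
proof -
  interpret product_sigma_finite "\<lambda>_::'a. lborel :: real measure" ..
  have [measurable]: "f b \<in> borel_measurable borel" if "b \<in> Basis" for b
    using borel_measurable_integrable[OF f[OF that]] by simp
  have eq: "(\<Prod>b\<in>Basis. f b ((\<Sum>c\<in>Basis. x c *\<^sub>R c) \<bullet> b)) = (\<Prod>b\<in>Basis. f b (x b))" for x
    by (intro prod.cong) auto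
  show "integrable lborel (\<lambda>x. \<Prod>b\<in>Basis. f b (x \<bullet> b))"
    by (subst lborel_eq, subst integrable_distr_eq)
      (auto simp only: eq intro!: product_integrable_prod f, measurable)
  show "(LINT x|lborel. (\<Prod>b\<in>Basis. f b (x \<bullet> b))) = (\<Prod>b\<in>Basis. LINT t|lborel. f b t)"
    by (subst lborel_eq, subst integral_distr)
      (auto simp only: eq intro!: product_integral_prod f, measurable)
qed

lemma lborel_integral_affine:
  fixes f :: "'a::euclidean_space \<Rightarrow> 'b::{banach, second_countable_topology}"
  assumes c: "c \<noteq> 0" and [measurable]: "f \<in> borel_measurable borel"
  shows "(LINT x|lborel. f x) = \<bar>c\<bar> ^ DIM('a) *\<^sub>R (LINT x|lborel. f (t + c *\<^sub>R x))"
  by (subst lborel_affine[OF c, of t]) (simp add: integral_density integral_distr)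

lemma integrable_inverse_1_plus_square: "integrable lborel (\<lambda>t::real. inverse (1 + t\<^sup>2))"
  using Sinc_Integral.integrable_inverse_1_plus_square by (simp add: set_integrable_def)

text \<open>The dominating function is the tensor product of 1/(1 + t^2). Its reciprocal is at most
  (1 + |x|^2)^d, hence at most 2^d (1 + |x|^(2d)), so the seminorms with powers 0 and 2d
  suffice.\<close>

lemma schwartz_integrable:
  fixes f :: "'a::euclidean_space \<Rightarrow> complex"
  assumes "f \<in> schwartz"
  shows "integrable lborel f"
proof -
  let ?d = "DIM('a)"
  have "\<exists>C. \<forall>x. norm x ^ k * norm (f x) \<le> C" for k
  proof -
    have "set ([] :: 'a list) \<subseteq> Basis" by simp
    then show ?thesis using assms unfolding schwartz_iff by (metis partial_derivs_Nil)
  qed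
  then obtain C D where C: "\<And>x. norm x ^ 0 * norm (f x) \<le> C" and D:
      "\<And>x. norm x ^ (2 * ?d) * norm (f x) \<le> D"
    by meson
  have [measurable]: "f \<in> borel_measurable borel"
    by (intro borel_measurable_continuous_onI smooth_fun_continuous schwartz_smooth assms)
  let ?w = "\<lambda>x::'a. \<Prod>b\<in>Basis. inverse (1 + (x \<bullet> b)\<^sup>2)"
  have "norm (f x) \<le> (2 ^ ?d * (C + D)) * ?w x" for x
  proof -
    have "(\<Prod>b\<in>Basis. 1 + (x \<bullet> b)\<^sup>2) \<le> (\<Prod>b::'a\<in>Basis. 1 + (norm x)\<^sup>2)"
      by (intro prod_mono conjI add_left_mono) (auto simp: Basis_le_norm
          abs_le_square_iff[symmetric])
    also have "\<dots> = (1 + (norm x)\<^sup>2) ^ ?d" by simp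
    also have "\<dots> \<le> (2 * max 1 ((norm x)\<^sup>2)) ^ ?d" by (intro power_mono) auto
    also have "\<dots> \<le> 2 ^ ?d * (1 + norm x ^ (2 * ?d))"
      by (auto simp: power_mult_distrib max_def power_mult)
    finally have "(\<Prod>b\<in>Basis. 1 + (x \<bullet> b)\<^sup>2) * norm (f x) \<le>
        2 ^ ?d * (1 + norm x ^ (2 * ?d)) * norm (f x)"
      by (rule mult_right_mono) simp
    also have "\<dots> \<le> 2 ^ ?d * (C + D)"
    proof -
      have "(1 + norm x ^ (2 * ?d)) * norm (f x) \<le> C + D" using C[of x] D[of x]
          by (simp add: distrib_right)
      then show ?thesis by (simp add: mult.assoc mult_left_mono)
    qed
    finally have le: "(\<Prod>b\<in>Basis. 1 + (x \<bullet> b)\<^sup>2) * norm (f x) \<le> 2 ^ ?d * (C + D)" .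
    have pos: "0 < (\<Prod>b\<in>Basis. 1 + (x \<bullet> b)\<^sup>2)" by (intro prod_pos) (auto intro: add_pos_nonneg)
    have "?w x = inverse (\<Prod>b\<in>Basis. 1 + (x \<bullet> b)\<^sup>2)" by (simp add: prod_inversef[symmetric] o_def)
    then show ?thesis using le pos by (simp add: field_simps)
  qed
  moreover have "0 \<le> 2 ^ ?d * (C + D) * ?w x" for x
    using calculation[of x] norm_ge_zero order_trans by blast
  ultimately show ?thesis
    by (intro Bochner_Integration.integrable_bound[OF integrable_mult_right[OF
        lborel_integrable_prod[of "\<lambda>_ t. inverse (1 + t\<^sup>2)", OF integrable_inverse_1_plus_square],
            of "2 ^ ?d * (C + D)"]])
      auto
qed

text \<open>The constant pi gives integral 1 and makes the function its own transform for the kernel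
  \<open>wave\<close>.\<close>

definition gaussian :: "'a::euclidean_space \<Rightarrow> real"
  where "gaussian x = exp (- pi * (norm x)\<^sup>2)"

lemma gaussian_prod: "gaussian x = (\<Prod>b\<in>Basis. exp (- pi * (x \<bullet> b)\<^sup>2))"
proof -
  have "(norm x)\<^sup>2 = (\<Sum>b\<in>Basis. (x \<bullet> b)\<^sup>2)"
    unfolding power2_norm_eq_inner by (subst euclidean_inner) (simp add: power2_eq_square)
  then show ?thesis by (simp add: gaussian_def exp_sum[symmetric] sum_distrib_left sum_negf)
qed

text \<open>This is the normal density of variance 1/(2 pi). After rescaling by sqrt(2 pi) the third
  claim is the known characteristic function of the standard normal distribution.\<close>

lemma gaussian_real:
  "integrable lborel (\<lambda>t::real. exp (- pi * t\<^sup>2))"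
  "(LINT t|lborel. exp (- pi * t\<^sup>2)) = 1"
  "(LINT t|lborel. complex_of_real (exp (- pi * t\<^sup>2)) * cis (2 * pi * t * s)) =
      of_real (exp (- pi * s\<^sup>2))"
proof -
  have n: "(\<lambda>t. exp (- pi * t\<^sup>2)) = normal_density 0 (1 / sqrt (2 * pi))"
    by (rule ext) (simp add: normal_density_def power_divide field_simps)
  show "integrable lborel (\<lambda>t::real. exp (- pi * t\<^sup>2))" "(LINT t|lborel. exp (- pi * t\<^sup>2)) = 1"
    unfolding n by simp_all
  let ?r = "sqrt (2 * pi)"
  have r: "?r > 0" "?r * ?r = 2 * pi" by auto
  have "(LINT t|lborel. complex_of_real (exp (- pi * t\<^sup>2)) * cis (2 * pi * t * s)) =
      \<bar>1 / ?r\<bar> *\<^sub>R (LINT t|lborel. complex_of_real (exp (- pi * (0 + 1 / ?r * t)\<^sup>2)) * cis (2 *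
          pi * (0 + 1 / ?r * t) * s))"
    by (rule lborel_integral_real_affine) (use r in auto)
  also have "\<dots> = (LINT t|lborel. std_normal_density t *\<^sub>R cis (?r * s * t))"
  proof -
    have "\<bar>1 / ?r\<bar> *\<^sub>R (complex_of_real (exp (- pi * (0 + 1 / ?r * t)\<^sup>2)) * cis (2 * pi * (0 +
        1 / ?r * t) * s)) =
       std_normal_density t *\<^sub>R cis (?r * s * t)" for t
    proof -
      have "2 * pi * (0 + 1 / ?r * t) * s = ?r * s * t"
        using r by (simp add: field_simps)
      moreover have "- pi * (0 + 1 / ?r * t)\<^sup>2 = - t\<^sup>2 / 2"
        by (simp add: power_mult_distrib power_divide field_simps)
      ultimately show ?thesis
        using r(1) by (simp only:) (simp add: std_normal_density_def scaleR_conv_of_real)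
    qed
    then show ?thesis by (simp only: integral_scaleR_right[symmetric])
  qed
  also have "\<dots> = char std_normal_distribution (?r * s)"
    unfolding char_def by (subst integral_density) (auto simp: cis_conv_exp mult_ac)
  also have "\<dots> = of_real (exp (- pi * s\<^sup>2))"
    by (simp add: char_std_normal_distribution power_mult_distrib)
  finally show "(LINT t|lborel. complex_of_real (exp (- pi * t\<^sup>2)) * cis (2 * pi * t * s)) =
      of_real (exp (- pi * s\<^sup>2))" .
qed

lemma gaussian_integrable: "integrable lborel gaussian"
  unfolding gaussian_prod[abs_def] by (rule lborel_integrable_prod[OF gaussian_real(1)])

lemma gaussian_integral: "(LINT x|lborel. gaussian x) = 1"
  unfolding gaussian_prod[abs_def] lborel_integral_prod[OF gaussian_real(1)]
  by (simp only: gaussian_real prod.neutral_const)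

lemma gaussian_fourier: "(LINT y|lborel. of_real (gaussian y) * wave s y) = of_real (gaussian s)"
proof -
  have eq: "of_real (gaussian y) * wave s y =
    (\<Prod>b\<in>Basis. of_real (exp (- pi * (y \<bullet> b)\<^sup>2)) * cis (2 * pi * (y \<bullet> b) * (s \<bullet> b)))" for y
  proof -
    have "wave s y = (\<Prod>b\<in>Basis. cis (2 * pi * (y \<bullet> b) * (s \<bullet> b)))"
      unfolding wave_def cis_conv_exp
      by (subst exp_sum[symmetric], simp, subst euclidean_inner)
        (simp add: sum_distrib_left mult_ac)
    then show ?thesis by (simp add: gaussian_prod prod.distrib)
  qed
  have i: "integrable lborel (\<lambda>t. complex_of_real (exp (- pi * t\<^sup>2)) * cis (2 * pi * t *
      (s \<bullet> b)))" for b
    by (rule Bochner_Integration.integrable_bound[OF gaussian_real(1)])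
      (auto simp: norm_mult cis_conv_exp)
  show ?thesis
    unfolding eq lborel_integral_prod[OF i] gaussian_real(3)
        by (simp only: gaussian_prod of_real_prod)
qed

lemma gaussian_le_1: "gaussian x \<le> 1" and gaussian_nonneg: "0 \<le> gaussian x"
  by (simp_all add: gaussian_def)

lemma borel_measurable_gaussian [measurable]: "gaussian \<in> borel_measurable borel"
  unfolding gaussian_def[abs_def] by measurable

lemma inverse_fourier_measurable:
  assumes "f \<in> test_functions"
  shows "inverse_fourier f \<in> borel_measurable borel"
  by (intro borel_measurable_continuous_onI smooth_fun_continuous schwartz_smooth
      inverse_fourier_schwartz assms)

text \<open>The damping makes Fubini's theorem applicable; the right-hand side tends to \<open>f x\<close> as
  \<open>e\<close> tends to 0, because the Gaussian has integral 1.\<close>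

lemma fourier_inversion_damped:
  fixes f :: "'a::euclidean_space \<Rightarrow> complex"
  assumes f: "f \<in> test_functions" and e: "0 < e"
  shows "(LINT y|lborel. inverse_fourier f y * of_real (gaussian (e *\<^sub>R y)) * wave (- x) y) =
    (LINT s|lborel. f (x + e *\<^sub>R s) * of_real (gaussian s))"
proof -
  have [measurable]: "f \<in> borel_measurable borel"
    by (intro borel_measurable_continuous_onI test_functions_continuous f)
  have G: "integrable lborel (\<lambda>y::'a. gaussian (e *\<^sub>R y))"
  proof -
    have "integrable (density (distr lborel borel (\<lambda>x. 0 + e *\<^sub>R x)) (\<lambda>_. ennreal (\<bar>e\<bar> ^
        DIM('a)))) (gaussian :: 'a \<Rightarrow> real)"
      using gaussian_integrable lborel_affine[of e "0::'a"] e by simp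
    then show ?thesis using e
      by (subst (asm) integrable_density) (auto simp: integrable_distr_eq)
  qed
  let ?h = "\<lambda>t y. f t * (of_real (gaussian (e *\<^sub>R y)) * wave (t - x) y)"
  have int: "integrable (lborel \<Otimes>\<^sub>M lborel) (\<lambda>(t, y). ?h t y)"
  proof (rule lborel_pair.Fubini_integrable)
    show "(\<lambda>(t, y). ?h t y) \<in> borel_measurable (lborel \<Otimes>\<^sub>M lborel)" by measurable
    have n: "norm (?h t y) = norm (f t) * gaussian (e *\<^sub>R y)" for t y
      by (simp add: norm_mult gaussian_nonneg)
    show "integrable lborel (\<lambda>t. LINT y|lborel. norm (case (t, y) of (t, y) \<Rightarrow> ?h t y))"
      unfolding prod.case n using test_functions_integrable[OF f] by simp
    show "AE t in lborel. integrable lborel (\<lambda>y. case (t, y) of (t, y) \<Rightarrow> ?h t y)"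
    proof (rule AE_I2)
      fix t :: 'a
      have "integrable lborel (\<lambda>y. of_real (gaussian (e *\<^sub>R y)) * wave (t - x) y)"
        by (rule Bochner_Integration.integrable_bound[OF G]) (auto simp: norm_mult gaussian_nonneg)
      then show "integrable lborel (\<lambda>y. case (t, y) of (t, y) \<Rightarrow> ?h t y)" by simp
    qed
  qed
  have "(LINT y|lborel. inverse_fourier f y * of_real (gaussian (e *\<^sub>R y)) * wave (- x) y) =
      (LINT y|lborel. LINT t|lborel. ?h t y)"
  proof (intro Bochner_Integration.integral_cong refl)
    fix y :: 'a
    have "inverse_fourier f y * of_real (gaussian (e *\<^sub>R y)) * wave (- x) y =
      (LINT t|lborel. f t * wave t y * (of_real (gaussian (e *\<^sub>R y)) * wave (- x) y))"
      unfolding inverse_fourier_def integral_mult_left_zero by (simp only: mult.assoc)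
    also have "\<dots> = (LINT t|lborel. ?h t y)"
      using wave_add[of _ "- x" y] by (simp add: mult_ac)
    finally show "inverse_fourier f y * of_real (gaussian (e *\<^sub>R y)) * wave (- x) y =
        (LINT t|lborel. ?h t y)" .
  qed
  also have "\<dots> = (LINT t|lborel. LINT y|lborel. ?h t y)"
    by (rule lborel_pair.Fubini_integral[OF int])
  \<comment> \<open>For fixed \<open>t\<close> the inner integral is the transform of a dilated
    Gaussian: a kernel of width \<open>e\<close> and total mass 1 centred at \<open>x\<close>. The
    substitution t = x + e s then removes the dilation.\<close>
  also have "\<dots> = (LINT t|lborel. f t * of_real (gaussian ((t - x) /\<^sub>R e) / e ^ DIM('a)))"
  proof (intro Bochner_Integration.integral_cong refl)
    fix t :: 'a
    have w: "wave (t - x) y = wave ((t - x) /\<^sub>R e) (e *\<^sub>R y)" for y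
      using e by (simp add: wave_scaleR)
    have "complex_of_real (gaussian ((t - x) /\<^sub>R e)) =
        (LINT y|lborel. of_real (gaussian y) * wave ((t - x) /\<^sub>R e) y)"
      by (rule gaussian_fourier[symmetric])
    also have "\<dots> = \<bar>e\<bar> ^ DIM('a) *\<^sub>R (LINT y|lborel. of_real (gaussian (0 + e *\<^sub>R y)) * wave ((t -
        x) /\<^sub>R e) (0 + e *\<^sub>R y))"
      using e by (intro lborel_integral_affine) auto
    finally have "complex_of_real (gaussian ((t - x) /\<^sub>R e)) =
        of_real (e ^ DIM('a)) * (LINT y|lborel. of_real (gaussian (e *\<^sub>R y)) * wave (t - x) y)"
      using e by (simp add: scaleR_conv_of_real w)
    then show "(LINT y|lborel. ?h t y) = f t * of_real (gaussian ((t - x) /\<^sub>R e) / e ^ DIM('a))"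
      using e by (simp add: field_simps)
  qed
  also have "\<dots> = \<bar>e\<bar> ^ DIM('a) *\<^sub>R (LINT s|lborel. f (x + e *\<^sub>R s) * of_real (gaussian ((x +
      e *\<^sub>R s - x) /\<^sub>R e) / e ^ DIM('a)))"
    using e by (intro lborel_integral_affine) auto
  also have "\<dots> = (LINT s|lborel. f (x + e *\<^sub>R s) * of_real (gaussian s))"
    using e by (simp add: scaleR_conv_of_real)
  finally show ?thesis .
qed

text \<open>Both sides of the damped identity are passed to the limit by dominated convergence: the
  left one under the integrable transform itself, the right one under a multiple of the
  Gaussian.\<close>

lemma fourier_inversion:
  fixes f :: "'a::euclidean_space \<Rightarrow> complex"
  assumes f: "f \<in> test_functions"
  shows "fourier_transform (inverse_fourier f) = f"
proof
  fix x :: 'a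
  define e where "e n = 1 / real (Suc n)" for n
  have e: "0 < e n" for n by (simp add: e_def)
  have e0: "e \<longlonglongrightarrow> 0"
    using LIMSEQ_inverse_real_of_nat unfolding e_def by (simp add: inverse_eq_divide)
  have [measurable]: "f \<in> borel_measurable borel" "inverse_fourier f \<in> borel_measurable borel"
    by (intro borel_measurable_continuous_onI test_functions_continuous inverse_fourier_measurable
        f)+
  obtain C where C: "\<And>x. norm (f x) \<le> C" using test_functions_bounded[OF f] by blast
  have "(\<lambda>n. LINT y::'a|lborel. inverse_fourier f y * of_real (gaussian (e n *\<^sub>R y)) * wave (-
      x) y) \<longlonglongrightarrow>
      (LINT y::'a|lborel. inverse_fourier f y * wave (- x) y)"
  proof (rule integral_dominated_convergence)
    show "integrable lborel (\<lambda>y. norm (inverse_fourier f y))"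
      by (intro integrable_norm schwartz_integrable inverse_fourier_schwartz f)
    show "AE y in lborel. norm (inverse_fourier f y * of_real (gaussian (e n *\<^sub>R y)) * wave (-
        x) y) \<le> norm (inverse_fourier f y)" for n
      by (auto simp: norm_mult gaussian_nonneg intro!: mult_left_le gaussian_le_1)
    show "AE y in lborel. (\<lambda>n. inverse_fourier f y * of_real (gaussian (e n *\<^sub>R y)) * wave (-
        x) y) \<longlonglongrightarrow> inverse_fourier f y * wave (- x) y"
    proof (rule AE_I2)
      fix y
      have "(\<lambda>n. inverse_fourier f y * of_real (gaussian (e n *\<^sub>R y)) * wave (- x) y) \<longlonglongrightarrow>
          inverse_fourier f y * of_real (exp (- pi * (norm (0 *\<^sub>R y))\<^sup>2)) * wave (- x) y"
        unfolding gaussian_def by (intro tendsto_intros e0)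
      then show "(\<lambda>n. inverse_fourier f y * of_real (gaussian (e n *\<^sub>R y)) * wave (- x) y) \<longlonglongrightarrow>
          inverse_fourier f y * wave (- x) y"
        by simp
    qed
  qed measurable
  moreover have "(\<lambda>n. LINT s::'a|lborel. f (x + e n *\<^sub>R s) * of_real (gaussian s)) \<longlonglongrightarrow>
      (LINT s::'a|lborel. f x * of_real (gaussian s))"
  proof (rule integral_dominated_convergence)
    show "integrable lborel (\<lambda>s::'a. C * gaussian s)"
        by (intro integrable_mult_right gaussian_integrable)
    show "AE s::'a in lborel. norm (f (x + e n *\<^sub>R s) * of_real (gaussian s)) \<le> C * gaussian s"
        for n
      by (auto simp: norm_mult gaussian_nonneg intro!: mult_right_mono C)
    show "AE s::'a in lborel. (\<lambda>n. f (x + e n *\<^sub>R s) * of_real (gaussian s)) \<longlonglongrightarrow>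
        f x * of_real (gaussian s)"
    proof (rule AE_I2, intro tendsto_mult tendsto_const)
      fix s
      have "(\<lambda>n. x + e n *\<^sub>R s) \<longlonglongrightarrow> x + 0 *\<^sub>R s" by (intro tendsto_intros e0)
      moreover have "isCont f x"
        using test_functions_continuous[OF f, of UNIV] by (simp add: continuous_on_eq_continuous_at)
      ultimately show "(\<lambda>n. f (x + e n *\<^sub>R s)) \<longlonglongrightarrow> f x" using isCont_tendsto_compose by force
    qed
  qed measurable
  ultimately have "(LINT y::'a|lborel. inverse_fourier f y * wave (- x) y) =
      (LINT s::'a|lborel. f x * of_real (gaussian s))"
    unfolding fourier_inversion_damped[OF f e] by (rule LIMSEQ_unique)
  also have "\<dots> = f x"
    using gaussian_integral[where 'a = 'a] integral_complex_of_real[of lborel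
        "gaussian :: 'a \<Rightarrow> real"] by simp
  finally show "fourier_transform (inverse_fourier f) x = f x"
    by (simp add: fourier_transform_wave wave_def inner_commute)
qed

lemma inverse_fourier_translate:
  assumes "f \<in> borel_measurable borel"
  shows "inverse_fourier (\<lambda>x. f (x - t)) y = wave t y * inverse_fourier f y"
proof -
  note [measurable] = assms
  have "inverse_fourier (\<lambda>x. f (x - t)) y = (LINT x|lborel. f (t + x - t) * wave (t + x) y)"
    unfolding inverse_fourier_def by (rule lborel_integral_plus[symmetric]) measurable
  also have "\<dots> = (LINT x|lborel. wave t y * (f x * wave x y))"
    by (simp add: wave_add mult_ac)
  also have "\<dots> = wave t y * inverse_fourier f y"
    by (simp only: inverse_fourier_def integral_mult_right_zero)
  finally show ?thesis .
qed


subsection \<open>Pure point measures\<close>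

lemma mass_outside: "A \<notin> bounded_borel \<Longrightarrow> mass m A = 0"
  using mass[of m] by blast

lemma mass_sums:
  fixes A :: "nat \<Rightarrow> 'a::euclidean_space set"
  assumes "range A \<subseteq> bounded_borel" "disjoint_family A" "bounded (\<Union>i. A i)"
  shows "(\<lambda>i. mass m (A i)) sums mass m (\<Union>i. A i)"
  using mass[of m] assms by blast

lemma bounded_borel_finite: "finite A \<Longrightarrow> A \<in> bounded_borel"
  by (simp add: bounded_borel_def finite_imp_bounded finite_imp_closed borel_closed)

lemma bounded_borel_Int: "A \<in> bounded_borel \<Longrightarrow> B \<in> sets borel \<Longrightarrow> A \<inter> B \<in> bounded_borel"
  unfolding bounded_borel_def by (auto intro: bounded_subset)

lemma bounded_borel_Diff: "A \<in> bounded_borel \<Longrightarrow> B \<in> sets borel \<Longrightarrow> A - B \<in> bounded_borel"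
  unfolding bounded_borel_def by (auto intro: bounded_subset)

lemma mass_empty [simp]: "mass m {} = 0"
proof -
  have "(\<lambda>i::nat. mass m {}) sums mass m {}"
    using mass_sums[of "\<lambda>_. {}" m] bounded_borel_finite[of "{}"]
        by (simp add: disjoint_family_on_def)
  then show ?thesis using sums_summable summable_const_iff by blast
qed

lemma mass_Un:
  assumes "A \<in> bounded_borel" "B \<in> bounded_borel" "A \<inter> B = {}"
  shows "mass m (A \<union> B) = mass m A + mass m B"
proof -
  let ?A = "\<lambda>i::nat. if i = 0 then A else if i = 1 then B else {}"
  have U: "(\<Union>i. ?A i) = A \<union> B" by (auto split: if_splits)
  have "(\<lambda>i. mass m (?A i)) sums mass m (A \<union> B)"
    unfolding U[symmetric]
  proof (rule mass_sums)
    show "range ?A \<subseteq> bounded_borel" using assms bounded_borel_finite[of "{}"] by auto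
    show "disjoint_family ?A" using assms(3) by (auto simp: disjoint_family_on_def)
    show "bounded (\<Union>i. ?A i)" using assms unfolding U bounded_borel_def by simp
  qed
  moreover have "(\<lambda>i. mass m (?A i)) sums (\<Sum>i\<in>{0,1}. mass m (?A i))"
    by (rule sums_finite) auto
  ultimately show ?thesis using sums_unique2 by fastforce
qed

lemma mass_finite: "finite F \<Longrightarrow> mass m F = (\<Sum>x\<in>F. mass m {x})"
proof (induction F rule: finite_induct)
  case (insert x F)
  have "mass m ({x} \<union> F) = mass m {x} + mass m F"
    using insert by (intro mass_Un bounded_borel_finite) auto
  then show ?case using insert by simp
qed simp

text \<open>The coefficients are the point masses themselves, so no set of atoms has to be carried
  along. This one notion covers the quasicrystals, through their locally finite support, and their
  atomic transforms.\<close>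

definition pure_point :: "'a::euclidean_space complex_measure \<Rightarrow> bool"
  where "pure_point m \<longleftrightarrow> (\<forall>A\<in>bounded_borel. ((\<lambda>x. mass m {x}) has_sum mass m A) A)"

lemma pure_point_eqI:
  assumes "pure_point m" "pure_point n" "\<And>x. mass m {x} = mass n {x}"
  shows "m = n"
proof (rule mass_inject[THEN iffD1], rule ext)
  fix A
  show "mass m A = mass n A"
    using assms has_sum_unique mass_outside[of A] unfolding pure_point_def
        by (metis (no_types, lifting) ext)
qed

lemma atomic_measure_pure_point:
  assumes "atomic_measure m"
  shows "pure_point m"
  unfolding pure_point_def
proof
  fix A :: "'a set" assume A: "A \<in> bounded_borel"
  obtain L a where La: "\<And>A. A \<in> bounded_borel \<Longrightarrow> (a has_sum mass m A) (L \<inter> A)"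
    using assms unfolding atomic_measure_def by blast
  have "mass m {x} = a x" if "x \<in> L" for x
    using La[of "{x}"] that bounded_borel_finite[of "{x}"] by (simp add: has_sum_finite_iff)
  moreover have "mass m {x} = 0" if "x \<notin> L" for x
    using La[of "{x}"] that bounded_borel_finite[of "{x}"] by (simp add: has_sum_finite_iff)
  ultimately show "((\<lambda>x. mass m {x}) has_sum mass m A) A"
    using La[OF A] by (subst has_sum_cong_neutral[where S = A and T = "L \<inter> A" and g = a]) auto
qed

text \<open>There may be uncountably many open null sets. By Lindelof a countable subfamily has the
  same union, and its disjointed members cut \<open>A\<close> into countably many null
  pieces.\<close>

lemma mass_eq_0_off_supp:
  assumes "A \<inter> supp m = {}"
  shows "mass m A = 0"
proof (cases "A \<in> bounded_borel")
  case A: True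
  define F where "F = {U. open U \<and> (\<forall>A\<in>bounded_borel. A \<subseteq> U \<longrightarrow> mass m A = 0)}"
  obtain F' where F': "F' \<subseteq> F" "countable F'" "\<Union>F' = \<Union>F"
    using Lindelof[of F] unfolding F_def by blast
  have sub: "A \<subseteq> \<Union>F'" using assms unfolding F'(3) supp_def F_def by blast
  show ?thesis
  proof (cases "F' = {}")
    case True
    then show ?thesis using sub by simp
  next
    case False
    let ?U = "from_nat_into F'"
    have U: "?U i \<in> F" for i using F'(1) from_nat_into[OF False] by blast
    have oU: "?U i \<in> sets borel" for i using U[of i] unfolding F_def by auto
    have "(\<lambda>i. mass m (A \<inter> disjointed ?U i)) sums mass m (\<Union>i. A \<inter> disjointed ?U i)"
    proof (rule mass_sums)
      show "range (\<lambda>i. A \<inter> disjointed ?U i) \<subseteq> bounded_borel"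
        using oU by (auto intro!: bounded_borel_Int A simp: disjointed_def)
      show "disjoint_family (\<lambda>i. A \<inter> disjointed ?U i)"
        using disjoint_family_disjointed[of ?U] by (auto simp: disjoint_family_on_def)
      show "bounded (\<Union>i. A \<inter> disjointed ?U i)"
        using A unfolding bounded_borel_def by (auto intro: bounded_subset)
    qed
    moreover have "mass m (A \<inter> disjointed ?U i) = 0" for i
    proof -
      have "disjointed ?U i \<in> sets borel" using oU unfolding disjointed_def
          by (intro sets.Diff sets.finite_UN) auto
      then have "A \<inter> disjointed ?U i \<in> bounded_borel" by (rule bounded_borel_Int[OF A])
      moreover have "A \<inter> disjointed ?U i \<subseteq> ?U i" by (rule le_infI2[OF disjointed_subset])
      ultimately show ?thesis using U[of i] unfolding F_def by blast
    qed
    moreover have "(\<Union>i. A \<inter> disjointed ?U i) = A"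
      using sub range_from_nat_into[OF False F'(2)] UN_disjointed_eq[of ?U] by auto
    ultimately have "(\<lambda>_. 0) sums mass m A" by (simp only:)
    then show ?thesis using sums_zero by (rule sums_unique2)
  qed
qed (rule mass_outside)

lemma locally_finite_bounded:
  fixes S :: "'a::euclidean_space set"
  assumes "\<And>x. finite (S \<inter> ball x 1)" "bounded A"
  shows "finite (S \<inter> A)"
proof -
  have "compact (closure A)" using assms(2) by (simp add: compact_closure)
  then obtain K where K: "finite K" "closure A \<subseteq> (\<Union>x\<in>K. ball x 1)"
    unfolding compact_eq_totally_bounded by (metis zero_less_one)
  have "S \<inter> A \<subseteq> (\<Union>x\<in>K. S \<inter> ball x 1)" using K(2) closure_subset by blast
  then show ?thesis using K(1) assms(1) finite_subset by blast
qed

text \<open>A bounded set meets the support in finitely many points and the rest of it is null, so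
  the sum is finite.\<close>

lemma locally_finite_pure_point:
  assumes "\<And>x. finite (supp m \<inter> ball x 1)"
  shows "pure_point m"
  unfolding pure_point_def
proof
  fix A :: "'a set" assume A: "A \<in> bounded_borel"
  have fin: "finite (A \<inter> supp m)"
    using locally_finite_bounded[OF assms, of A] A by (simp add: bounded_borel_def Int_commute)
  have "mass m ((A - (A \<inter> supp m)) \<union> (A \<inter> supp m)) =
      mass m (A - (A \<inter> supp m)) + mass m (A \<inter> supp m)"
    using fin by (intro mass_Un bounded_borel_Diff[OF A] bounded_borel_finite[OF fin]) (auto simp:
        borel_closed finite_imp_closed)
  moreover have "mass m (A - (A \<inter> supp m)) = 0" by (rule mass_eq_0_off_supp) auto
  moreover have "(A - (A \<inter> supp m)) \<union> (A \<inter> supp m) = A" by auto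
  ultimately have "mass m A = (\<Sum>x\<in>A \<inter> supp m. mass m {x})" using mass_finite[OF fin, of m] by simp
  then show "((\<lambda>x. mass m {x}) has_sum mass m A) A"
    using fin by (intro has_sum_finite_neutralI[of "A \<inter> supp m"]) (auto intro: mass_eq_0_off_supp)
qed

section \<open>Variations of pure point measures as weighted counting measures\<close>

lemma nn_integral_count_space_SUP:
  fixes f :: "'a \<Rightarrow> real"
  assumes "\<And>x. 0 \<le> f x"
  shows "(\<integral>\<^sup>+x. ennreal (f x) * indicator E x \<partial>count_space UNIV) =
    (SUP F\<in>{F. finite F \<and> F \<subseteq> E}. ennreal (sum f F))" (is "?I = ?S")
proof -
  have I: "?I = (\<integral>\<^sup>+x. ennreal (f x) \<partial>count_space E)"
    by (simp add: nn_integral_count_space_indicator)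
  show ?thesis
  proof (cases "f summable_on E")
    case True
    then have "(\<lambda>x. norm (f x)) summable_on E" using assms by simp
    then have a: "integrable (count_space E) f" using abs_summable_equivalent[of f E]
        by (simp add: abs_summable_on_def)
    then have "?I = ennreal (LINT x|count_space E. f x)"
      unfolding I by (intro nn_integral_eq_integral) (auto simp: assms)
    also have "\<dots> = ennreal (infsum f E)"
      using infsetsum_infsum[of f E] a by (simp add: abs_summable_on_def infsetsum_def)
    finally show ?thesis using infsum_nonneg_is_SUPREMUM_ennreal[OF True assms] by simp
  next
    case False
    \<comment> \<open>Bounded finite sums of nonnegative terms would force summability; so here both
      sides are infinite.\<close>
    have S: "?S = \<infinity>"
    proof (rule ccontr)
      assume "?S \<noteq> \<infinity>"
      then obtain C where C: "0 \<le> C" "?S = ennreal C" by (cases ?S) auto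
      have "sum f F \<le> C" if "finite F" "F \<subseteq> E" for F
      proof -
        have "ennreal (sum f F) \<le> ?S" using that by (intro SUP_upper) auto
        then show ?thesis using C by (simp add: ennreal_le_iff)
      qed
      then have "f summable_on E"
        by (intro nonneg_bdd_above_summable_on) (auto simp: assms bdd_above_def)
      then show False using False by simp
    qed
    have "?S \<le> ?I"
    proof (rule SUP_least)
      fix F assume F: "F \<in> {F. finite F \<and> F \<subseteq> E}"
      then have "ennreal (sum f F) = (\<integral>\<^sup>+x. ennreal (f x) \<partial>count_space F)"
        by (simp add: nn_integral_count_space_finite sum_ennreal assms)
      also have "\<dots> = (\<integral>\<^sup>+x. ennreal (f x) * indicator F x \<partial>count_space UNIV)"
        by (simp add: nn_integral_count_space_indicator)
      also have "\<dots> \<le> ?I" using F by (intro nn_integral_mono) (auto split: split_indicator)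
      finally show "ennreal (sum f F) \<le> ?I" .
    qed
    then have "?I = \<infinity>" unfolding S infinity_ennreal_def by (simp only: top.extremum_unique)
    then show ?thesis using S by (rule trans[OF _ sym])
  qed
qed

text \<open>The identity map in \<open>distr\<close> only shrinks the sigma-algebra from all sets to
  the Borel sets, on which the variation measures are defined.\<close>

definition point_masses :: "('a::euclidean_space \<Rightarrow> real) \<Rightarrow> 'a measure"
  where "point_masses w = distr (density (count_space UNIV) (\<lambda>x. ennreal (w x))) borel (\<lambda>x. x)"

text \<open>Matching the set function with the values of an existing measure supplies the countable
  additivity that \<open>measure_of\<close> demands.\<close>

lemma measure_of_point_masses:
  assumes "\<And>x. 0 \<le> w x"
    "\<And>E. E \<in> sets borel \<Longrightarrow> F E = (SUP F\<in>{F. finite F \<and> F \<subseteq> E}. ennreal (sum w F))"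
  shows "measure_of UNIV (sets borel) F = point_masses w"
proof -
  have "measure_of UNIV (sets borel) F = measure_of UNIV (sets borel) (emeasure (point_masses w))"
  proof (rule measure_of_eq)
    fix E :: "'a set" assume "E \<in> sigma_sets UNIV (sets borel)"
    then have E: "E \<in> sets borel" using sets.sigma_sets_eq[of "borel :: 'a measure"] by simp
    then have "emeasure (point_masses w) E = (\<integral>\<^sup>+x. ennreal (w x) * indicator E x \<partial>count_space
        UNIV)"
      unfolding point_masses_def by (subst emeasure_distr) (auto simp: emeasure_density)
    then show "F E = emeasure (point_masses w) E"
      using assms(2)[OF E] nn_integral_count_space_SUP[of w E, OF assms(1)] by simp
  qed simp
  also have "\<dots> = point_masses w"
    using measure_of_of_measure[of "point_masses w"] by (simp add: point_masses_def)
  finally show ?thesis .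
qed

lemma integral_point_masses:
  fixes f :: "'a::euclidean_space \<Rightarrow> complex"
  assumes "\<And>x. 0 \<le> w x" "f \<in> borel_measurable borel"
  shows "(LINT x|point_masses w. f x) = (LINT x|count_space UNIV. w x *\<^sub>R f x)"
proof -
  have "(\<lambda>x. x) \<in> density (count_space UNIV) (\<lambda>x. ennreal (w x)) \<rightarrow>\<^sub>M borel" by simp
  then show ?thesis
    unfolding point_masses_def using assms by (subst integral_distr) (auto simp: integral_density)
qed

text \<open>Above, the sum over \<open>B\<close> is a limit of finite sums, each bounded by its
  positive part. Below, the finite set of points of positive mass is itself an admissible
  \<open>B\<close>. A general \<open>r\<close> treats the real and imaginary parts and their
  negatives at once.\<close>

lemma upper_variation_pure_point:
  assumes m: "pure_point m" and r: "bounded_linear r"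
  shows "upper_variation (\<lambda>A. r (mass m A)) = point_masses (\<lambda>x. max 0 (r (mass m {x})))"
  unfolding upper_variation_def
proof (rule measure_of_point_masses)
  fix E :: "'a set" assume "E \<in> sets borel"
  let ?f = "\<lambda>x. max 0 (r (mass m {x}))"
  let ?S = "SUP F\<in>{F. finite F \<and> F \<subseteq> E}. ennreal (sum ?f F)"
  show "(SUP B\<in>{B \<in> bounded_borel. B \<subseteq> E}. ennreal (r (mass m B))) = ?S"
  proof (rule antisym; rule SUP_least)
    fix B assume B: "B \<in> {B \<in> bounded_borel. B \<subseteq> E}"
    then have "((\<lambda>x. r (mass m {x})) has_sum r (mass m B)) B"
      using m r by (auto simp: pure_point_def intro: has_sum_bounded_linear)
    then have "(sum (\<lambda>x. r (mass m {x})) \<longlongrightarrow> r (mass m B)) (finite_subsets_at_top B)"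
      by (simp add: has_sum_def)
    then have "((\<lambda>F. ennreal (sum (\<lambda>x. r (mass m {x})) F)) \<longlongrightarrow>
        ennreal (r (mass m B))) (finite_subsets_at_top B)"
      by (rule tendsto_ennrealI)
    then show "ennreal (r (mass m B)) \<le> ?S"
    proof (rule tendsto_upperbound)
      show "\<forall>\<^sub>F F in finite_subsets_at_top B. ennreal (sum (\<lambda>x. r (mass m {x})) F) \<le> ?S"
      proof (rule eventually_finite_subsets_at_top_weakI)
        fix F assume F: "finite F" "F \<subseteq> B"
        have "ennreal (sum (\<lambda>x. r (mass m {x})) F) \<le> ennreal (sum ?f F)"
          by (intro ennreal_leI sum_mono) auto
        also have "\<dots> \<le> ?S" using F B by (intro SUP_upper) auto
        finally show "ennreal (sum (\<lambda>x. r (mass m {x})) F) \<le> ?S" .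
      qed
    qed simp
  next
    fix F assume F: "F \<in> {F. finite F \<and> F \<subseteq> E}"
    let ?B = "{x \<in> F. 0 < r (mass m {x})}"
    have "r (mass m ?B) = (\<Sum>x\<in>?B. r (mass m {x}))"
      using F mass_finite[of ?B m] linear_sum[OF bounded_linear.linear[OF r]] by simp
    also have "\<dots> = sum ?f F" using F by (intro sum.mono_neutral_cong_left) auto
    finally have "ennreal (sum ?f F) = ennreal (r (mass m ?B))" by simp
    also have "\<dots> \<le> (SUP B\<in>{B \<in> bounded_borel. B \<subseteq> E}. ennreal (r (mass m B)))"
      using F by (intro SUP_upper) (auto intro: bounded_borel_finite)
    finally show "ennreal (sum ?f F) \<le> (SUP B\<in>{B \<in> bounded_borel. B \<subseteq> E}. ennreal (r (mass m B)))" .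
  qed
qed simp

text \<open>A partition never beats its points, by the triangle inequality and disjointness; a
  finite set cut into singletons attains its sum.\<close>

lemma total_variation_pure_point:
  assumes m: "pure_point m"
  shows "total_variation m = point_masses (\<lambda>x. norm (mass m {x}))"
  unfolding total_variation_def
proof (rule measure_of_point_masses)
  fix E :: "'a set" assume "E \<in> sets borel"
  let ?f = "\<lambda>x. norm (mass m {x})"
  let ?S = "\<lambda>E. SUP F\<in>{F. finite F \<and> F \<subseteq> E}. ennreal (sum ?f F)"
  let ?I = "\<lambda>E. \<integral>\<^sup>+x. ennreal (?f x) * indicator E x \<partial>count_space UNIV"
  let ?Ps = "{P. finite P \<and> disjoint P \<and> P \<subseteq> bounded_borel \<and> \<Union>P \<subseteq> E}"
  show "(SUP P\<in>?Ps. \<Sum>A\<in>P. ennreal (norm (mass m A))) = ?S E"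
  proof (rule antisym; rule SUP_least)
    fix P assume P: "P \<in> ?Ps"
    have "ennreal (norm (mass m A)) \<le> ?I A" if "A \<in> P" for A
    proof -
      have "((\<lambda>x. mass m {x}) has_sum mass m A) A" using m P that by (auto simp: pure_point_def)
      then have "(sum (\<lambda>x. mass m {x}) \<longlongrightarrow> mass m A) (finite_subsets_at_top A)"
        by (simp add: has_sum_def)
      then have "((\<lambda>F. ennreal (norm (sum (\<lambda>x. mass m {x}) F))) \<longlongrightarrow>
          ennreal (norm (mass m A))) (finite_subsets_at_top A)"
        by (intro tendsto_ennrealI tendsto_norm)
      then have "ennreal (norm (mass m A)) \<le> ?S A"
      proof (rule tendsto_upperbound)
        show "\<forall>\<^sub>F F in finite_subsets_at_top A. ennreal (norm (sum (\<lambda>x. mass m {x}) F)) \<le> ?S A"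
        proof (rule eventually_finite_subsets_at_top_weakI)
          fix F assume F: "finite F" "F \<subseteq> A"
          have "ennreal (norm (sum (\<lambda>x. mass m {x}) F)) \<le> ennreal (sum ?f F)"
            by (intro ennreal_leI norm_sum)
          also have "\<dots> \<le> ?S A" using F by (intro SUP_upper) auto
          finally show "ennreal (norm (sum (\<lambda>x. mass m {x}) F)) \<le> ?S A" .
        qed
      qed simp
      then show ?thesis by (simp add: nn_integral_count_space_SUP)
    qed
    then have "(\<Sum>A\<in>P. ennreal (norm (mass m A))) \<le> (\<Sum>A\<in>P. ?I A)" by (rule sum_mono)
    also have "\<dots> = (\<integral>\<^sup>+x. (\<Sum>A\<in>P. ennreal (?f x) * indicator A x) \<partial>count_space UNIV)"
      by (rule nn_integral_sum[symmetric]) simp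
    also have "\<dots> \<le> ?I E"
    proof (rule nn_integral_mono)
      fix x
      have "indicator (\<Union>A\<in>P. A) x = (\<Sum>A\<in>P. indicator A x :: ennreal)"
        using P by (intro indicator_UN_disjoint) (auto simp: disjoint_def disjoint_family_on_def)
      then have "(\<Sum>A\<in>P. ennreal (?f x) * indicator A x) = ennreal (?f x) * indicator (\<Union>P) x"
        by (simp add: sum_distrib_left[symmetric])
      also have "\<dots> \<le> ennreal (?f x) * indicator E x"
        using P by (intro mult_left_mono) (auto split: split_indicator)
      finally show "(\<Sum>A\<in>P. ennreal (?f x) * indicator A x) \<le> ennreal (?f x) * indicator E x" .
    qed
    finally show "(\<Sum>A\<in>P. ennreal (norm (mass m A))) \<le> ?S E"
        by (simp add: nn_integral_count_space_SUP)
  next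
    fix F assume F: "F \<in> {F. finite F \<and> F \<subseteq> E}"
    let ?P = "(\<lambda>x. {x}) ` F"
    have "ennreal (sum ?f F) = (\<Sum>A\<in>?P. ennreal (norm (mass m A)))"
      by (simp add: sum.reindex sum_ennreal)
    also have "\<dots> \<le> (SUP P\<in>?Ps. \<Sum>A\<in>P. ennreal (norm (mass m A)))"
      using F by (intro SUP_upper) (auto simp: disjoint_def intro: bounded_borel_finite)
    finally show "ennreal (sum ?f F) \<le> (SUP P\<in>?Ps. \<Sum>A\<in>P. ennreal (norm (mass m A)))" .
  qed
qed simp

text \<open>The four upper variations carry the positive parts of plus and minus the real and
  imaginary masses, and \<open>max 0 s - max 0 (- s) = s\<close> reassembles them. The assumed
  integrability dominates all four integrals, so they may be combined.\<close>

lemma complex_measure_integral_pure_point: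
  assumes m: "pure_point m" and f: "f \<in> borel_measurable borel"
    and int: "integrable (count_space UNIV) (\<lambda>x. mass m {x} * f x)"
  shows "complex_measure_integral m f = (LINT x|count_space UNIV. mass m {x} * f x)"
proof -
  let ?a = "\<lambda>x. mass m {x}"
  let ?p = "\<lambda>r x. max 0 (r (?a x)) *\<^sub>R f x"
  have i: "integrable (count_space UNIV) (?p r)" if "\<And>z. \<bar>r z\<bar> \<le> norm z" for r
  proof (rule Bochner_Integration.integrable_bound[OF int])
    have "norm (?p r x) \<le> norm (?a x * f x)" for x
    proof -
      have "\<bar>max 0 (r (?a x))\<bar> \<le> norm (?a x)" using that[of "?a x"] by auto
      then show ?thesis by (simp add: norm_mult mult_right_mono)
    qed
    then show "AE x in count_space UNIV. norm (?p r x) \<le> norm (?a x * f x)" by simp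
  qed simp
  have pm: "(LINT x|upper_variation (\<lambda>A. r (mass m A)). f x) = (LINT x|count_space UNIV. ?p r x)"
    if "bounded_linear r" for r
    unfolding upper_variation_pure_point[OF m that] by (rule integral_point_masses) (auto simp: f)
  have iRe: "integrable (count_space UNIV) (?p Re)"
      "integrable (count_space UNIV) (?p (\<lambda>z. - Re z))"
    "integrable (count_space UNIV) (?p Im)" "integrable (count_space UNIV) (?p (\<lambda>z. - Im z))"
    by (auto intro!: i simp: abs_Re_le_cmod abs_Im_le_cmod)
  have "complex_measure_integral m f =
    ((LINT x|count_space UNIV. ?p Re x) - (LINT x|count_space UNIV. ?p (\<lambda>z. - Re z) x)) +
    \<i> * ((LINT x|count_space UNIV. ?p Im x) - (LINT x|count_space UNIV. ?p (\<lambda>z. - Im z) x))"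
    unfolding complex_measure_integral_def
    by (simp only: pm[OF bounded_linear_Re] pm[OF bounded_linear_minus[OF bounded_linear_Re]]
        pm[OF bounded_linear_Im] pm[OF bounded_linear_minus[OF bounded_linear_Im]])
  also have "\<dots> = (LINT x|count_space UNIV. (?p Re x - ?p (\<lambda>z. - Re z) x) + \<i> * (?p Im x -
      ?p (\<lambda>z. - Im z) x))"
    by (simp only: Bochner_Integration.integral_add Bochner_Integration.integral_diff
        Bochner_Integration.integrable_diff integrable_mult_right integral_mult_right_zero iRe)
  also have "\<dots> = (LINT x|count_space UNIV. ?a x * f x)"
  proof (intro Bochner_Integration.integral_cong refl)
    fix x
    have "max 0 t - max 0 (- t) = t" for t :: real by auto
    then have "(?p Re x - ?p (\<lambda>z. - Re z) x) + \<i> * (?p Im x - ?p (\<lambda>z. - Im z) x) =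
        Re (?a x) *\<^sub>R f x + \<i> * (Im (?a x) *\<^sub>R f x)"
      by (simp only: scaleR_diff_left[symmetric])
    also have "\<dots> = (of_real (Re (?a x)) + \<i> * of_real (Im (?a x))) * f x"
      by (simp add: scaleR_conv_of_real algebra_simps)
    finally show "(?p Re x - ?p (\<lambda>z. - Re z) x) + \<i> * (?p Im x - ?p (\<lambda>z. - Im z) x) = ?a x * f x"
      by (simp only: complex_eq[symmetric])
  qed
  finally show ?thesis .
qed


subsection \<open>Spectral measures and Schwartz functions\<close>

text \<open>Dilations of one fixed cutoff, so that the dependence of seminorms on \<open>n\<close>
  is explicit; \<open>Suc n\<close> keeps the scale positive.\<close>

definition plateau :: "nat \<Rightarrow> 'a::euclidean_space \<Rightarrow> complex"
  where "plateau n x = of_real (cutoff 0 1 2 (x /\<^sub>R real (Suc n)))"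

lemma plateau_test: "(plateau n :: 'a::euclidean_space \<Rightarrow> complex) \<in> test_functions"
proof (rule test_functionsI)
  have t: "(\<lambda>x::'a. complex_of_real (cutoff 0 1 2 x)) \<in> test_functions" by (rule cutoff_test) auto
  show "smooth_fun (plateau n :: 'a \<Rightarrow> complex)"
    unfolding plateau_def[abs_def] by (rule smooth_fun_scale[OF test_functionsD(1)[OF t]])
  have "x \<in> cball 0 (2 * real (Suc n))" if "plateau n x \<noteq> 0" for x :: 'a
  proof (rule ccontr)
    assume "x \<notin> cball 0 (2 * real (Suc n))"
    then have "2 \<le> norm (x /\<^sub>R real (Suc n) - 0)" by (simp add: field_simps)
    then show False using cutoff_eq_0[of 2 "x /\<^sub>R real (Suc n)" 0 1] that by (simp add: plateau_def)
  qed
  then show "bounded {x::'a. plateau n x \<noteq> 0}"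
    by (intro bounded_subset[OF bounded_cball[of "0::'a" "2 * real (Suc n)"]]) auto
qed

lemma plateau_eq_1: "norm x \<le> real (Suc n) \<Longrightarrow> plateau n x = 1"
  unfolding plateau_def by (subst cutoff_eq_1) (auto simp: field_simps)

lemma norm_plateau_le_1: "norm (plateau n x) \<le> 1"
  by (simp add: plateau_def abs_of_nonneg cutoff_nonneg cutoff_le_1)

text \<open>Dilation by N multiplies derivatives by powers of 1/N, which are at most 1, while the
  weight \<open>norm x ^ k\<close> costs N^k.\<close>

lemma plateau_seminorm:
  fixes bs :: "'a::euclidean_space list"
  assumes bs: "set bs \<subseteq> Basis"
  shows "schwartz_seminorm k bs (plateau n) \<le> real (Suc n) ^ k * schwartz_seminorm k bs (plateau 0)"
proof (rule schwartz_seminorm_least)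
  fix x :: 'a
  let ?N = "real (Suc n)" and ?f = "plateau 0 :: 'a \<Rightarrow> complex"
  have s: "?f \<in> schwartz" by (rule test_functions_schwartz[OF plateau_test])
  have eq: "plateau n = (\<lambda>x::'a. ?f (inverse ?N *\<^sub>R x))" by (simp add: plateau_def fun_eq_iff)
  have "norm (complex_of_real (inverse ?N ^ length bs)) \<le> 1"
    unfolding norm_of_real by (simp add: power_le_one inverse_le_1_iff del: of_nat_Suc)
  then have "norm x ^ k * norm (partial_derivs bs (plateau n) x) \<le>
      norm x ^ k * norm (partial_derivs bs ?f (inverse ?N *\<^sub>R x))"
    unfolding eq partial_derivs_scale[OF schwartz_smooth[OF s] bs] norm_mult
    by (intro mult_left_mono mult_left_le_one_le) auto
  also have "norm x ^ k * norm (partial_derivs bs ?f (inverse ?N *\<^sub>R x)) =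
      ?N ^ k * (norm (inverse ?N *\<^sub>R x) ^ k * norm (partial_derivs bs ?f (inverse ?N *\<^sub>R x)))"
  proof -
    have "norm x = ?N * norm (inverse ?N *\<^sub>R x)" by simp
    then have "norm x ^ k = ?N ^ k * norm (inverse ?N *\<^sub>R x) ^ k" by (simp only: power_mult_distrib)
    then show ?thesis by (simp only: mult.assoc)
  qed
  also have "\<dots> \<le> ?N ^ k * schwartz_seminorm k bs ?f"
    by (intro mult_left_mono schwartz_seminorm_upper s bs) auto
  finally show "norm x ^ k * norm (partial_derivs bs (plateau n) x) \<le>
      ?N ^ k * schwartz_seminorm k bs ?f" .
qed

text \<open>Unordered convergence of complex numbers is absolute convergence, so local summability
  is already contained in \<open>pure_point\<close>.\<close>

lemma pure_point_locally_summable: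
  assumes "pure_point m" "A \<in> bounded_borel"
  shows "integrable (count_space UNIV) (\<lambda>x. indicator A x *\<^sub>R mass m {x})"
proof -
  have "(\<lambda>x. mass m {x}) summable_on A" using assms has_sum_imp_summable unfolding pure_point_def
      by blast
  then have "(\<lambda>x. norm (mass m {x})) summable_on A"
    by (simp only: summable_on_iff_abs_summable_on_complex)
  then have "integrable (count_space A) (\<lambda>x. mass m {x})"
    using abs_summable_equivalent[of "\<lambda>x. mass m {x}" A] by (simp add: abs_summable_on_def)
  then show ?thesis
    using abs_summable_on_altdef[of "\<lambda>x. mass m {x}" A]
        by (simp add: abs_summable_on_def set_integrable_def)
qed

lemma pure_point_integrable_test:
  assumes "pure_point m" "f \<in> test_functions"
  shows "integrable (count_space UNIV) (\<lambda>x. mass m {x} * f x)"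
proof -
  obtain R where R: "R > 0" "\<And>x. norm x \<ge> R \<Longrightarrow> f x = 0" using test_functions_vanish[OF assms(2)]
      by blast
  obtain C where C: "\<And>x. norm (f x) \<le> C" using test_functions_bounded[OF assms(2)] by blast
  have "integrable (count_space UNIV) (\<lambda>x. C *\<^sub>R (indicator (cball 0 R) x *\<^sub>R mass m {x}))"
    by (intro integrable_scaleR_right pure_point_locally_summable assms) (auto simp:
        bounded_borel_def)
  then show ?thesis
  proof (rule Bochner_Integration.integrable_bound)
    have "norm (mass m {x} * f x) \<le> norm (C *\<^sub>R (indicator (cball 0 R) x *\<^sub>R mass m {x}))" for x
    proof (cases "norm x \<le> R")
      case True
      then show ?thesis using C[of x] norm_ge_zero[of "f x"]
        by (auto simp: norm_mult mult.commute intro!: mult_right_mono)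
    next
      case False
      then show ?thesis using R by simp
    qed
    then show "AE x in count_space UNIV. norm (mass m {x} * f x) \<le>
        norm (C *\<^sub>R (indicator (cball 0 R) x *\<^sub>R mass m {x}))"
      by simp
  qed simp
qed

text \<open>Testing the variation on a plateau dominates the mass of a ball, and finitely many
  seminorms of the plateau grow polynomially. The exponent \<open>K\<close> is the sum of their
  orders, a convenient bound for each of them.\<close>

lemma temperate_polynomial_growth:
  fixes m :: "'a::euclidean_space complex_measure"
  assumes m: "pure_point m" and temp: "temperate_positive_measure (total_variation m)"
  obtains D K where "0 \<le> D" "\<And>n. (\<integral>\<^sup>+x. ennreal (norm (mass m {x})) *
      indicator (cball 0 (real (Suc n))) x \<partial>count_space UNIV)
    \<le> ennreal (D * real (Suc n) ^ K)"
proof -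
  obtain T where T: "temperate_distribution T"
      "\<And>f. f \<in> test_functions \<Longrightarrow> T f = (LINT x|total_variation m. f x)"
    using temp unfolding temperate_positive_measure_def by blast
  obtain J C where J: "finite J" "\<forall>(k, bs)\<in>J. set bs \<subseteq> (Basis :: 'a set)" "0 < C"
    and bd: "\<And>f. f \<in> schwartz \<Longrightarrow> norm (T f) \<le> C * (\<Sum>(k, bs)\<in>J. schwartz_seminorm k bs f)"
    using temperate_distribution_bound[OF T(1)] by blast
  define K where "K = (\<Sum>(k, bs)\<in>J. k)"
  define D where "D = C * (\<Sum>(k, bs)\<in>J. schwartz_seminorm k bs (plateau 0 :: 'a \<Rightarrow> complex))"
  let ?a = "\<lambda>x. norm (mass m {x})"
  have s0: "(plateau n :: 'a \<Rightarrow> complex) \<in> schwartz" for n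
      by (rule test_functions_schwartz[OF plateau_test])
  have "0 \<le> schwartz_seminorm k bs (plateau 0 :: 'a \<Rightarrow> complex)" if "(k, bs) \<in> J" for k bs
    using J(2) that by (intro schwartz_seminorm_nonneg s0) auto
  then have D0: "0 \<le> D"
    unfolding D_def using J(3) by (auto intro!: mult_nonneg_nonneg sum_nonneg)
  have "(\<integral>\<^sup>+x. ennreal (?a x) * indicator (cball 0 (real (Suc n))) x \<partial>count_space UNIV)
    \<le> ennreal (D * real (Suc n) ^ K)" for n
  proof -
    let ?N = "real (Suc n)" and ?f = "plateau n :: 'a \<Rightarrow> complex"
    have int: "integrable (count_space UNIV) (\<lambda>x. ?a x * cutoff 0 1 2 (x /\<^sub>R ?N))"
    proof -
      have "integrable (count_space UNIV) (\<lambda>x. norm (mass m {x} * ?f x))"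
        by (intro integrable_norm pure_point_integrable_test m plateau_test)
      then show ?thesis by (simp add: plateau_def norm_mult abs_of_nonneg cutoff_nonneg)
    qed
    have "T ?f = (LINT x|count_space UNIV. ?a x *\<^sub>R ?f x)"
      unfolding T(2)[OF plateau_test] total_variation_pure_point[OF m]
      by (rule integral_point_masses)
        (auto intro!: borel_measurable_continuous_onI test_functions_continuous plateau_test)
    also have "\<dots> = (LINT x|count_space UNIV. complex_of_real (?a x * cutoff 0 1 2 (x /\<^sub>R ?N)))"
      by (simp add: plateau_def scaleR_conv_of_real)
    also have "\<dots> = complex_of_real (LINT x|count_space UNIV. ?a x * cutoff 0 1 2 (x /\<^sub>R ?N))"
      by (rule integral_complex_of_real)
    finally have Tf: "T ?f = of_real (LINT x|count_space UNIV. ?a x * cutoff 0 1 2 (x /\<^sub>R ?N))" .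
    have "(\<integral>\<^sup>+x. ennreal (?a x) * indicator (cball 0 ?N) x \<partial>count_space UNIV) \<le>
      (\<integral>\<^sup>+x. ennreal (?a x * cutoff 0 1 2 (x /\<^sub>R ?N)) \<partial>count_space UNIV)"
    proof (rule nn_integral_mono)
      fix x :: 'a
      show "ennreal (?a x) * indicator (cball 0 ?N) x \<le> ennreal (?a x * cutoff 0 1 2 (x /\<^sub>R ?N))"
      proof (cases "norm x \<le> ?N")
        case True
        then show ?thesis by (subst cutoff_eq_1) (auto simp: field_simps)
      qed simp
    qed
    also have "\<dots> = ennreal (LINT x|count_space UNIV. ?a x * cutoff 0 1 2 (x /\<^sub>R ?N))"
      by (intro nn_integral_eq_integral int) (simp add: cutoff_nonneg)
    also have "\<dots> \<le> ennreal (norm (T ?f))" unfolding Tf by (intro ennreal_leI) simp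
    also have "\<dots> \<le> ennreal (D * ?N ^ K)"
    proof (rule ennreal_leI)
      have "norm (T ?f) \<le> C * (\<Sum>(k, bs)\<in>J. schwartz_seminorm k bs ?f)" by (rule bd[OF s0])
      also have "\<dots> \<le> C * (\<Sum>(k, bs)\<in>J. ?N ^ K * schwartz_seminorm k bs (plateau 0 :: 'a \<Rightarrow> complex))"
      proof (intro mult_left_mono sum_mono)
        fix j assume j: "j \<in> J"
        obtain k bs where kb: "j = (k, bs)" by (cases j)
        have bs: "set bs \<subseteq> Basis" using J(2) j kb by auto
        have "k \<le> K" unfolding K_def using member_le_sum[OF j, of "\<lambda>(k, bs). k"] J(1) kb by auto
        then have "?N ^ k \<le> ?N ^ K" by (intro power_increasing) auto
        then have "?N ^ k * schwartz_seminorm k bs (plateau 0 :: 'a \<Rightarrow> complex) \<le>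
            ?N ^ K * schwartz_seminorm k bs (plateau 0)"
          by (intro mult_right_mono schwartz_seminorm_nonneg s0 bs)
        then show "(case j of (k, bs) \<Rightarrow> schwartz_seminorm k bs ?f) \<le>
          (case j of (k, bs) \<Rightarrow> ?N ^ K * schwartz_seminorm k bs (plateau 0 :: 'a \<Rightarrow> complex))"
          using plateau_seminorm[OF bs, of k n] unfolding kb by simp
      qed (use J in auto)
      also have "\<dots> = D * ?N ^ K"
        by (simp add: D_def sum_distrib_left case_prod_unfold mult_ac)
      finally show "norm (T ?f) \<le> D * ?N ^ K" .
    qed
    finally show ?thesis .
  qed
  then show ?thesis using that D0 by blast
qed

text \<open>Each \<open>x\<close> is charged to the ball of radius n + 1 with n the integer part of
  \<open>norm x\<close>. There \<bar>f x\<bar> is at most E/(n + 1)^(K + 2), while the ball has mass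
  at most D (n + 1)^K. The surplus 2 in the exponent leaves the convergent series of 1/(n +
  1)^2.\<close>

lemma polynomial_growth_integrable:
  fixes a f :: "'a::euclidean_space \<Rightarrow> complex"
  assumes D: "0 \<le> D" and growth: "\<And>n. (\<integral>\<^sup>+x. ennreal (norm (a x)) * indicator (cball 0 (real (Suc
      n))) x \<partial>count_space UNIV)
      \<le> ennreal (D * real (Suc n) ^ K)"
    and decay: "\<And>x. (1 + norm x) ^ (K + 2) * norm (f x) \<le> E"
  shows "integrable (count_space UNIV) (\<lambda>x. a x * f x)"
proof (rule integrableI_bounded)
  have "norm (f 0) \<le> E" using decay[of 0] by simp
  then have E: "0 \<le> E" by (rule order_trans[OF norm_ge_zero])
  let ?g = "\<lambda>n x. ennreal (E / real (Suc n) ^ (K + 2)) * (ennreal (norm (a x)) *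
      indicator (cball 0 (real (Suc n))) x)"
  have "(\<integral>\<^sup>+x. ennreal (norm (a x * f x)) \<partial>count_space UNIV) \<le>
      (\<integral>\<^sup>+x. (\<Sum>n. ?g n x) \<partial>count_space UNIV)"
  proof (rule nn_integral_mono)
    fix x :: 'a
    define n where "n = nat \<lfloor>norm x\<rfloor>"
    have "real n = of_int \<lfloor>norm x\<rfloor>" unfolding n_def by simp
    then have n: "real n \<le> norm x" "norm x \<le> real (Suc n)" by linarith+
    have "real (Suc n) ^ (K + 2) * norm (f x) \<le> E"
      by (rule order_trans[OF mult_right_mono[OF power_mono] decay[of x]]) (use n in auto)
    then have "norm (f x) \<le> E / real (Suc n) ^ (K + 2)"
      by (simp only: pos_le_divide_eq zero_less_power of_nat_0_less_iff zero_less_Suc mult.commute)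
    then have "ennreal (norm (a x * f x)) \<le> ennreal (E / real (Suc n) ^ (K + 2) * norm (a x))"
      unfolding norm_mult mult.commute[of "norm (a x)"] by (intro ennreal_leI mult_right_mono) auto
    also have "\<dots> = ?g n x"
    proof -
      have "indicator (cball 0 (real (Suc n))) x = (1::ennreal)" using n by simp
      then show ?thesis by (simp only: mult_1_right) (rule ennreal_mult, use E in auto)
    qed
    also have "\<dots> \<le> (\<Sum>n. ?g n x)"
      using sum_le_suminf[of "\<lambda>n. ?g n x" "{n}"] by (simp del: of_nat_Suc)
    finally show "ennreal (norm (a x * f x)) \<le> (\<Sum>n. ?g n x)" .
  qed
  also have "\<dots> = (\<Sum>n. \<integral>\<^sup>+x. ?g n x \<partial>count_space UNIV)" by (rule nn_integral_suminf) simp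
  also have "\<dots> \<le> (\<Sum>n. ennreal (E * D * inverse (real (Suc n) ^ 2)))"
  proof (intro suminf_le)
    fix n
    have "(\<integral>\<^sup>+x. ?g n x \<partial>count_space UNIV) \<le> ennreal (E / real (Suc n) ^ (K + 2)) * ennreal (D *
        real (Suc n) ^ K)"
      by (subst nn_integral_cmult, simp) (rule mult_left_mono[OF growth], simp)
    also have "\<dots> = ennreal (E / real (Suc n) ^ (K + 2) * (D * real (Suc n) ^ K))"
      using E D by (intro ennreal_mult[symmetric]) auto
    also have "E / real (Suc n) ^ (K + 2) * (D * real (Suc n) ^ K) =
        E * D * inverse (real (Suc n) ^ 2)"
    proof -
      have "real (Suc n) \<noteq> 0" by simp
      then show ?thesis by (simp add: power_add divide_inverse power2_eq_square del: of_nat_Suc)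
    qed
    finally show "(\<integral>\<^sup>+x. ?g n x \<partial>count_space UNIV) \<le> ennreal (E * D * inverse (real (Suc n) ^ 2))" .
  qed auto
  also have "\<dots> < \<infinity>"
  proof -
    have "summable (\<lambda>n. inverse (real (Suc n) ^ 2))"
      using inverse_power_summable[of 2, where 'a = real] by (subst summable_Suc_iff) simp
    then have "summable (\<lambda>n. E * D * inverse (real (Suc n) ^ 2))" by (rule summable_mult)
    then show ?thesis using E D by (subst suminf_ennreal2) auto
  qed
  finally show "(\<integral>\<^sup>+x. ennreal (norm (a x * f x)) \<partial>count_space UNIV) < \<infinity>" .
qed simp

section \<open>From test functions to Schwartz functions by truncation\<close>

lemma schwartz_decay:
  assumes "f \<in> schwartz"
  obtains E where "\<And>x. (1 + norm x) ^ k * norm (f x) \<le> E"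
proof -
  have b: "norm x ^ k * norm (f x) \<le> schwartz_seminorm k [] f" for x k
    using schwartz_seminorm_upper[OF assms, of "[]" x k] by simp
  have "(1 + norm x) ^ k * norm (f x) \<le> 2 ^ k * (schwartz_seminorm 0 [] f +
      schwartz_seminorm k [] f)" for x
  proof -
    have "(1 + norm x) ^ k \<le> (2 * max 1 (norm x)) ^ k" by (intro power_mono) auto
    also have "\<dots> \<le> 2 ^ k * (1 + norm x ^ k)" by (auto simp: power_mult_distrib max_def)
    finally have "(1 + norm x) ^ k * norm (f x) \<le> 2 ^ k * (1 + norm x ^ k) * norm (f x)"
      by (rule mult_right_mono) simp
    also have "\<dots> = 2 ^ k * (norm x ^ 0 * norm (f x) + norm x ^ k * norm (f x))"
        by (simp add: algebra_simps)
    also have "\<dots> \<le> 2 ^ k * (schwartz_seminorm 0 [] f + schwartz_seminorm k [] f)"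
      by (intro mult_left_mono add_mono b) auto
    finally show ?thesis .
  qed
  then show ?thesis by (rule that)
qed

text \<open>The existential unites the empty list, which returns \<open>c\<close>, with the others,
  which return 0.\<close>

lemma partial_derivs_const: "set bs \<subseteq> Basis \<Longrightarrow> \<exists>d. partial_derivs bs (\<lambda>x::'a::euclidean_space. c) =
    (\<lambda>x. d)"
proof -
  assume "set bs \<subseteq> Basis"
  moreover have "partial_deriv b g \<in> {(\<lambda>x. d) | d. True}" if g': "g \<in> {(\<lambda>x. d) | d. True}"
      for g :: "'a \<Rightarrow> complex" and b
  proof -
    obtain d where g: "g = (\<lambda>x. d)" using g' by blast
    have "partial_deriv b g = (\<lambda>x. 0)" unfolding g by (rule ext, rule partial_deriv_eq) auto
    then show ?thesis by blast
  qed
  ultimately have "partial_derivs bs (\<lambda>x::'a. c) \<in> {(\<lambda>x. d) | d. True}"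
    by (intro partial_derivs_closed) auto
  then show ?thesis by blast
qed

text \<open>The difference is \<open>f\<close> times the dilation of \<open>u\<close>, the function
  \<open>plateau 0\<close> minus 1. In the Leibniz rule every derivative of that dilation vanishes
  for |x| < N = n + 1; elsewhere 1 is at most |x|/N, so one more power of |x|, paid by the seminorm
  of order \<open>Suc k\<close>, gains the factor 1/N.\<close>

lemma plateau_mult_seminorm:
  fixes f :: "'a::euclidean_space \<Rightarrow> complex"
  assumes f: "f \<in> schwartz" and bs: "set bs \<subseteq> Basis"
  shows "\<exists>Q. \<forall>n. schwartz_seminorm k bs (\<lambda>x. plateau n x * f x - f x) \<le> Q / real (Suc n)"
proof -
  define u where "u x = plateau 0 x + (- 1)" for x :: 'a
  have su: "smooth_fun u"
    unfolding u_def[abs_def] by (intro smooth_fun_add smooth_fun_const test_functionsD plateau_test)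
  have "\<exists>M. \<forall>x. norm (partial_derivs A u x) \<le> M" if A: "set A \<subseteq> Basis" for A
  proof -
    obtain d where d: "partial_derivs A (\<lambda>x::'a. - 1 :: complex) = (\<lambda>x. d)"
        using partial_derivs_const[OF A] by blast
    obtain C where "\<And>x. norm (partial_derivs A (plateau 0) x) \<le> C"
      using test_functions_bounded[OF test_functions_partial_derivs[OF plateau_test A]] by blast
    then have "norm (partial_derivs A u x) \<le> C + norm d" for x
      unfolding u_def[abs_def] partial_derivs_add[OF test_functionsD(1)[OF plateau_test]
          smooth_fun_const A] d
      by (intro norm_triangle_mono) auto
    then show ?thesis by blast
  qed
  then obtain M where M: "\<And>A x. set A \<subseteq> Basis \<Longrightarrow> norm (partial_derivs A u x) \<le> M A" by metis
  have M0: "0 \<le> M A" if "set A \<subseteq> Basis" for A using M[OF that, of 0] norm_ge_zero order_trans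
      by blast
  have u0: "partial_derivs A u x = 0" if "norm x < 1" for A x
  proof (rule test_support_partial_derivs)
    have "u y = 0" if "norm y < 1" for y using plateau_eq_1[of y 0] that by (simp add: u_def)
    then have "ball 0 1 \<inter> {x. u x \<noteq> 0} = {}" by auto
    then have "ball 0 1 \<inter> closure {x. u x \<noteq> 0} = {}" using open_Int_closure_eq_empty[OF open_ball]
        by blast
    then show "x \<notin> closure {x. u x \<noteq> 0}" using that by auto
  qed
  let ?sp = "splits bs"
  define Q where "Q = (\<Sum>(A, B)\<leftarrow>?sp. M A * schwartz_seminorm (Suc k) B f)"
  have "schwartz_seminorm k bs (\<lambda>x. plateau n x * f x - f x) \<le> Q / real (Suc n)" for n
  proof (rule schwartz_seminorm_least)
    fix x :: 'a
    let ?N = "real (Suc n)"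
    let ?v = "\<lambda>x. u (inverse ?N *\<^sub>R x)"
    have eq: "(\<lambda>x. plateau n x * f x - f x) = (\<lambda>x. ?v x * f x)"
      by (simp add: u_def plateau_def fun_eq_iff algebra_simps)
    have sv: "smooth_fun ?v" by (rule smooth_fun_scale[OF su])
    have bound: "norm x ^ k * (norm (partial_derivs A ?v x) * norm (partial_derivs B f x)) \<le>
        M A * schwartz_seminorm (Suc k) B f / ?N" if "(A, B) \<in> set ?sp" for A B
    proof -
      have A: "set A \<subseteq> Basis" and B: "set B \<subseteq> Basis" using splits_subset[OF that] bs by auto
      have pos: "0 \<le> schwartz_seminorm (Suc k) B f" by (rule schwartz_seminorm_nonneg[OF f B])
      show ?thesis
      proof (cases "norm x < ?N")
        case True
        then have "norm (inverse ?N *\<^sub>R x) < 1" by (simp add: field_simps)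
        then have "partial_derivs A ?v x = 0" unfolding partial_derivs_scale[OF su A] using u0
            by simp
        then show ?thesis using M0[OF A] pos by simp
      next
        case False
        have "norm (complex_of_real (inverse ?N ^ length A)) \<le> 1"
          unfolding norm_of_real by (simp add: power_le_one inverse_le_1_iff del: of_nat_Suc)
        then have "norm (partial_derivs A ?v x) \<le> 1 * M A"
          unfolding partial_derivs_scale[OF su A] norm_mult by (intro mult_mono M A) auto
        then have "norm x ^ k * (norm (partial_derivs A ?v x) * norm (partial_derivs B f x)) \<le>
          norm x ^ k * (M A * norm (partial_derivs B f x))"
          by (intro mult_left_mono mult_right_mono) auto
        also have "\<dots> = M A * (norm x ^ k * norm (partial_derivs B f x))" by (simp add: mult_ac)
        also have "\<dots> \<le> M A * (schwartz_seminorm (Suc k) B f / ?N)"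
        proof (intro mult_left_mono M0 A)
          have "?N * (norm x ^ k * norm (partial_derivs B f x)) \<le>
              norm x * (norm x ^ k * norm (partial_derivs B f x))"
            using False by (intro mult_right_mono) auto
          also have "\<dots> \<le> schwartz_seminorm (Suc k) B f"
            using schwartz_seminorm_upper[OF f B, of x "Suc k"] by (simp add: mult_ac)
          finally show "norm x ^ k * norm (partial_derivs B f x) \<le>
              schwartz_seminorm (Suc k) B f / ?N"
            by (simp add: field_simps)
        qed
        finally show ?thesis by simp
      qed
    qed
    have "norm x ^ k * norm (partial_derivs bs (\<lambda>x. plateau n x * f x - f x) x) \<le>
      norm x ^ k * (\<Sum>(A, B)\<leftarrow>?sp. norm (partial_derivs A ?v x) * norm (partial_derivs B f x))"
    proof (rule mult_left_mono)
      have "norm (\<Sum>y\<leftarrow>ys. h y) \<le> (\<Sum>y\<leftarrow>ys. norm (h y))" for h :: "'a list \<times> 'a list \<Rightarrow> complex" and ys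
        by (induction ys) (auto intro: norm_triangle_le)
      from this[of "\<lambda>(A, B). partial_derivs A ?v x * partial_derivs B f x" ?sp]
      show "norm (partial_derivs bs (\<lambda>x. plateau n x * f x - f x) x) \<le>
        (\<Sum>(A, B)\<leftarrow>?sp. norm (partial_derivs A ?v x) * norm (partial_derivs B f x))"
        unfolding eq partial_derivs_mult[OF sv schwartz_smooth[OF f] bs]
            by (simp add: case_prod_unfold norm_mult)
    qed simp
    also have "\<dots> = (\<Sum>(A, B)\<leftarrow>?sp. norm x ^ k * (norm (partial_derivs A ?v x) *
        norm (partial_derivs B f x)))"
      by (simp add: sum_list_const_mult case_prod_unfold)
    also have "\<dots> \<le> (\<Sum>(A, B)\<leftarrow>?sp. M A * schwartz_seminorm (Suc k) B f / ?N)"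
      by (intro sum_list_mono) (use bound in auto)
    also have "\<dots> = Q / ?N"
      unfolding Q_def divide_inverse by (simp add: sum_list_mult_const[symmetric] case_prod_unfold)
    finally show "norm x ^ k * norm (partial_derivs bs (\<lambda>x. plateau n x * f x - f x) x) \<le> Q / ?N" .
  qed
  then show ?thesis by blast
qed

lemma temperate_distribution_plateau:
  fixes T :: "('a::euclidean_space \<Rightarrow> complex) \<Rightarrow> complex"
  assumes T: "temperate_distribution T" and f: "f \<in> schwartz"
  shows "(\<lambda>n. T (\<lambda>x. plateau n x * f x)) \<longlonglongrightarrow> T f"
proof -
  obtain J C where J: "finite J" "\<forall>(k, bs)\<in>J. set bs \<subseteq> (Basis :: 'a set)" "0 < C"
    and bd: "\<And>f. f \<in> schwartz \<Longrightarrow> norm (T f) \<le> C * (\<Sum>(k, bs)\<in>J. schwartz_seminorm k bs f)"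
    using temperate_distribution_bound[OF T] by blast
  have "\<exists>Q. \<forall>n. schwartz_seminorm k bs (\<lambda>x. plateau n x * f x - f x) \<le> Q / real (Suc n)"
    if "(k, bs) \<in> J" for k bs
    using plateau_mult_seminorm[OF f] J(2) that by auto
  then obtain Q where Q: "\<And>k bs n. (k, bs) \<in> J \<Longrightarrow>
      schwartz_seminorm k bs (\<lambda>x. plateau n x * f x - f x) \<le> Q k bs / real (Suc n)"
    by metis
  have s: "(\<lambda>x. plateau n x * f x) \<in> schwartz" for n
    by (intro test_functions_schwartz test_functions_mult plateau_test schwartz_smooth f)
  have mf: "(\<lambda>x. - 1 * f x) \<in> schwartz" by (rule schwartz_cmult[OF f])
  have lin: "T (\<lambda>x. plateau n x * f x - f x) = T (\<lambda>x. plateau n x * f x) - T f" for n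
  proof -
    have "T (\<lambda>x. g x + h x) = T g + T h" if "g \<in> schwartz" "h \<in> schwartz" for g h
      using T that unfolding temperate_distribution_def by blast
    from this[OF s mf]
    have "T (\<lambda>x. plateau n x * f x + - 1 * f x) = T (\<lambda>x. plateau n x * f x) + T (\<lambda>x. - 1 * f x)" .
    moreover have "T (\<lambda>x. - 1 * f x) = - 1 * T f"
      using T f unfolding temperate_distribution_def by blast
    ultimately show ?thesis by simp
  qed
  define c where "c = C * (\<Sum>(k, bs)\<in>J. Q k bs)"
  have est: "norm (T (\<lambda>x. plateau n x * f x) - T f) \<le> c * inverse (real (Suc n))" for n
  proof -
    have "norm (T (\<lambda>x. plateau n x * f x) - T f) \<le>
        C * (\<Sum>(k, bs)\<in>J. schwartz_seminorm k bs (\<lambda>x. plateau n x * f x - f x))"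
      unfolding lin[symmetric] by (intro bd schwartz_diff s f)
    also have "\<dots> \<le> C * (\<Sum>(k, bs)\<in>J. Q k bs / real (Suc n))"
      using J(3) Q by (intro mult_left_mono sum_mono) auto
    also have "\<dots> = c * inverse (real (Suc n))"
      by (simp add: c_def divide_inverse sum_distrib_right case_prod_unfold)
    finally show ?thesis .
  qed
  have lim: "(\<lambda>n. c * inverse (real (Suc n))) \<longlonglongrightarrow> 0"
    using tendsto_mult_left[OF LIMSEQ_inverse_real_of_nat, of c] by (simp only: mult_zero_right)
  have "(\<lambda>n. T (\<lambda>x. plateau n x * f x) - T f) \<longlonglongrightarrow> 0"
    by (rule Lim_null_comparison[OF _ lim]) (simp only: est eventually_True)
  then show ?thesis by (simp add: LIM_zero_iff)
qed

text \<open>Along the truncations by plateaus \<open>S\<close> converges by continuity. The sums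
  converge dominatedly, each term being eventually constant, under the summable function furnished
  by polynomial growth against rapid decay.\<close>

lemma extends_measure_schwartz:
  fixes m :: "'a::euclidean_space complex_measure"
  assumes S: "extends_measure S m" and m: "pure_point m"
    and temp: "temperate_positive_measure (total_variation m)" and f: "f \<in> schwartz"
  shows "integrable (count_space UNIV) (\<lambda>x. mass m {x} * f x)"
    and "S f = (LINT x|count_space UNIV. mass m {x} * f x)"
proof -
  obtain D K where D: "0 \<le> D" "\<And>n. (\<integral>\<^sup>+x. ennreal (norm (mass m {x})) *
      indicator (cball 0 (real (Suc n))) x \<partial>count_space UNIV)
    \<le> ennreal (D * real (Suc n) ^ K)"
    using temperate_polynomial_growth[OF m temp] by blast
  obtain E where E: "\<And>x. (1 + norm x) ^ (K + 2) * norm (f x) \<le> E" using schwartz_decay[OF f]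
      by blast
  show int: "integrable (count_space UNIV) (\<lambda>x. mass m {x} * f x)"
    by (rule polynomial_growth_integrable[OF D E])
  have t: "(\<lambda>x. plateau n x * f x) \<in> test_functions" for n
    by (intro test_functions_mult plateau_test schwartz_smooth f)
  have "S (\<lambda>x. plateau n x * f x) = (LINT x|count_space UNIV. mass m {x} * (plateau n x * f x))"
      for n
  proof -
    have "S (\<lambda>x. plateau n x * f x) = complex_measure_integral m (\<lambda>x. plateau n x * f x)"
      using S t unfolding extends_measure_def by blast
    also have "\<dots> = (LINT x|count_space UNIV. mass m {x} * (plateau n x * f x))"
      by (intro complex_measure_integral_pure_point m pure_point_integrable_test t
          borel_measurable_continuous_onI test_functions_continuous)
    finally show ?thesis .
  qed
  moreover have "(\<lambda>n. LINT x|count_space UNIV. mass m {x} * (plateau n x * f x)) \<longlonglongrightarrow>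
      (LINT x|count_space UNIV. mass m {x} * f x)"
  proof (rule integral_dominated_convergence)
    show "integrable (count_space UNIV) (\<lambda>x. norm (mass m {x} * f x))"
        by (rule integrable_norm[OF int])
    have "norm (mass m {x} * (plateau n x * f x)) \<le> norm (mass m {x} * f x)" for n x
      using norm_plateau_le_1[of n x] by (simp add: norm_mult mult_left_mono mult_left_le_one_le)
    then show "AE x in count_space UNIV. norm (mass m {x} * (plateau n x * f x)) \<le>
        norm (mass m {x} * f x)" for n
      by simp
    have "(\<lambda>n. mass m {x} * (plateau n x * f x)) \<longlonglongrightarrow> mass m {x} * f x" for x
    proof (rule tendsto_eventually)
      show "\<forall>\<^sub>F n in sequentially. mass m {x} * (plateau n x * f x) = mass m {x} * f x"
        unfolding eventually_sequentially
      proof (intro exI allI impI)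
        fix n assume "nat \<lceil>norm x\<rceil> \<le> n"
        then have "norm x \<le> real (Suc n)" by linarith
        then show "mass m {x} * (plateau n x * f x) = mass m {x} * f x" by (simp add: plateau_eq_1)
      qed
    qed
    then show "AE x in count_space UNIV. (\<lambda>n. mass m {x} * (plateau n x * f x)) \<longlonglongrightarrow> mass m {x} * f x"
      by simp
  qed simp_all
  moreover have "(\<lambda>n. S (\<lambda>x. plateau n x * f x)) \<longlonglongrightarrow> S f"
    using S f temperate_distribution_plateau unfolding extends_measure_def by blast
  ultimately show "S f = (LINT x|count_space UNIV. mass m {x} * f x)"
    using LIMSEQ_unique by (simp only:) blast
qed


subsection \<open>Almost periodicity and the proof of uniqueness\<close>

lemma integral_count_space_finite:
  fixes f :: "'a \<Rightarrow> complex"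
  assumes "finite F" "\<And>x. x \<notin> F \<Longrightarrow> f x = 0"
  shows "(LINT x|count_space UNIV. f x) = sum f F"
proof -
  have "{a \<in> UNIV. f a \<noteq> 0} \<subseteq> F" using assms(2) by blast
  then have "finite {a \<in> UNIV. f a \<noteq> 0}" using assms(1) finite_subset by blast
  then have "(LINT x|count_space UNIV. f x) = (\<Sum>a | a \<in> UNIV \<and> f a \<noteq> 0. f a)"
    by (rule lebesgue_integral_count_space_finite_support)
  also have "\<dots> = sum f F"
    using assms by (intro sum.mono_neutral_left) auto
  finally show ?thesis .
qed

lemma sparse_pure_point: "sparse_fourier_quasicrystal m \<Longrightarrow> pure_point m"
  by (rule locally_finite_pure_point) (auto simp: sparse_fourier_quasicrystal_def)

text \<open>The point of the form: \<open>c\<close> does not depend on \<open>t\<close>, which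
  enters through the wave alone. So an estimate for the waves controls all translates.\<close>

lemma sparse_translates:
  assumes m: "sparse_fourier_quasicrystal m" and f: "\<And>t. (\<lambda>x. f (x - t)) \<in> test_functions"
  shows "\<exists>c. integrable (count_space UNIV) c \<and>
    (\<forall>t. (LINT x|count_space UNIV. mass m {x} * f (x - t)) =
        (LINT y|count_space UNIV. c y * wave t y))"
proof -
  obtain T s where T: "extends_measure T m" "extends_measure (fourier_distribution T) s"
    "atomic_measure s" "temperate_positive_measure (total_variation s)"
    using m unfolding sparse_fourier_quasicrystal_def by blast
  note ps = atomic_measure_pure_point[OF T(3)]
  let ?c = "\<lambda>y. mass s {y} * inverse_fourier f y"
  have f0: "f \<in> test_functions" using f[of 0] by simp
  have "integrable (count_space UNIV) ?c"
    by (rule extends_measure_schwartz(1)[OF T(2) ps T(4) inverse_fourier_schwartz[OF f0]])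
  moreover have "(LINT x|count_space UNIV. mass m {x} * f (x - t)) =
      (LINT y|count_space UNIV. ?c y * wave t y)" for t
  proof -
    let ?ft = "\<lambda>x. f (x - t)"
    have "(LINT x|count_space UNIV. mass m {x} * ?ft x) = complex_measure_integral m ?ft"
      by (intro complex_measure_integral_pure_point[symmetric] sparse_pure_point m
          pure_point_integrable_test f borel_measurable_continuous_onI test_functions_continuous)
    also have "\<dots> = T ?ft" using T(1) f unfolding extends_measure_def by metis
    \<comment> \<open>The definition of the transform of a distribution read backwards, since
      \<open>?ft\<close> is the transform of its inverse transform.\<close>
    also have "\<dots> = fourier_distribution T (inverse_fourier ?ft)"
      unfolding fourier_distribution_def by (simp only: fourier_inversion[OF f])
    also have "\<dots> = (LINT y|count_space UNIV. mass s {y} * inverse_fourier ?ft y)"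
      by (rule extends_measure_schwartz(2)[OF T(2) ps T(4) inverse_fourier_schwartz[OF f]])
    also have "\<dots> = (LINT y|count_space UNIV. ?c y * wave t y)"
      by (subst inverse_fourier_translate)
        (auto intro!: borel_measurable_continuous_onI test_functions_continuous f0 simp: mult_ac)
    finally show ?thesis .
  qed
  ultimately show ?thesis by blast
qed

section \<open>Almost periods of absolutely convergent exponential sums\<close>

lemma norm_cis_minus_1_le: "norm (cis s - 1) \<le> \<bar>s\<bar>"
  using iexp_approx1[of s 0] by (simp add: cis_conv_exp)

text \<open>Simultaneous Dirichlet approximation of the numbers \<open>v \<bullet> y\<close> by
  fractions with a common denominator \<open>q\<close>. The wave at \<open>q v\<close> sees only the
  distance to the nearest approximating integer, less than 1/N. Since \<open>q\<close> is at least 1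
  and \<open>v\<close> is already longer than \<open>R\<close>, so is \<open>q v\<close>.\<close>

lemma common_almost_period:
  fixes F :: "'a::euclidean_space set"
  assumes "finite F" "0 < d"
  obtains t where "R < norm t" "\<And>y. y \<in> F \<Longrightarrow> norm (wave t y - 1) < d"
proof -
  obtain b :: 'a where b: "b \<in> Basis" using nonempty_Basis by blast
  define v where "v = (max R 0 + 1) *\<^sub>R b"
  obtain n y where y: "F = y ` {i::nat. i < n}" using finite_imp_nat_seg_image_inj_on[OF assms(1)]
      by blast
  obtain N :: nat where N: "2 * pi / d < real N" using reals_Archimedean2 by blast
  have "0 < 2 * pi / d" using assms(2) by simp
  then have N0: "N > 0" using N by (intro gr0I) auto
  obtain q p where q: "0 < q" and p: "\<And>i. i < n \<Longrightarrow> \<bar>of_int q * (v \<bullet> y i) - of_int (p i)\<bar> < 1 / N"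
    using Dirichlet_approx_simult[OF N0, of n "\<lambda>i. v \<bullet> y i"] by blast
  show ?thesis
  proof (rule that)
    have "1 \<le> real_of_int q" using q by simp
    then have "1 * (max R 0 + 1) \<le> real_of_int q * (max R 0 + 1)" by (intro mult_right_mono) auto
    then show "R < norm (of_int q *\<^sub>R v)" using q b by (simp add: v_def abs_mult abs_of_pos)
    fix z assume "z \<in> F"
    then obtain i where i: "i < n" "z = y i" using y by blast
    let ?s = "of_int q * (v \<bullet> y i) - of_int (p i)"
    have "wave (of_int q *\<^sub>R v) z = cis (2 * pi * ?s + 2 * pi * of_int (p i))"
      unfolding wave_def i by (simp add: algebra_simps)
    also have "\<dots> = cis (2 * pi * ?s)" by (simp only: cis_mult[symmetric] cis_multiple_2pi
        Ints_of_int mult_1_right)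
    finally have "norm (wave (of_int q *\<^sub>R v) z - 1) \<le> \<bar>2 * pi * ?s\<bar>" using norm_cis_minus_1_le
        by simp
    also have "\<dots> = 2 * pi * \<bar>?s\<bar>" by (simp add: abs_mult)
    also have "\<dots> < 2 * pi * (1 / N)" using p[OF i(1)] by (intro mult_strict_left_mono) auto
    also have "\<dots> < d" using N N0 assms(2) by (simp add: field_simps)
    finally show "norm (wave (of_int q *\<^sub>R v) z - 1) < d" .
  qed
qed

text \<open>A finite \<open>F\<close> carries all but e/8 of the weight. Off \<open>F\<close> the
  trivial bound 2 costs at most e/4, and on \<open>F\<close> the bound \<open>d\<close> costs at
  most e/4.\<close>

lemma almost_period_integral:
  fixes w :: "'a::euclidean_space \<Rightarrow> real"
  assumes w: "integrable (count_space UNIV) w" "\<And>y. 0 \<le> w y" and e: "0 < e"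
  obtains t where "R < norm t" "(LINT y|count_space UNIV. w y * norm (wave t y - 1)) < e"
proof -
  let ?I = "LINT y|count_space UNIV. w y"
  have sm: "w summable_on UNIV"
    using abs_summable_equivalent[of w UNIV] w by (simp add: abs_summable_on_def)
  have "?I = infsum w UNIV"
    using infsetsum_infsum[of w UNIV] w(1) by (simp add: abs_summable_on_def infsetsum_def)
  then have "(w has_sum ?I) UNIV" using sm by (simp only: has_sum_infsum)
  then obtain F where F: "finite F" "dist (sum w F) ?I \<le> e / 8"
    using has_sum_finite_approximation[where \<epsilon> = "e / 8"] e
        by (metis divide_pos_pos zero_less_numeral)
  define d where "d = e / (4 * (sum w F + 1))"
  have s0: "0 \<le> sum w F" using w(2) by (rule sum_nonneg)
  then have d: "0 < d" "d * sum w F \<le> e / 4" using e by (auto simp: d_def field_simps)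
  obtain t where t: "R < norm t" "\<And>y. y \<in> F \<Longrightarrow> norm (wave t y - 1) < d"
    using common_almost_period[OF F(1) d(1)] by metis
  have iF: "integrable (count_space UNIV) (\<lambda>y. indicator F y *\<^sub>R w y)"
    using integrable_mult_indicator[of F "count_space UNIV" w] w(1) by simp
  have LF: "(LINT y|count_space UNIV. indicator F y *\<^sub>R w y) = sum w F"
    using infsetsum_altdef[of w F] F(1) by (simp add: set_lebesgue_integral_def)
  \<comment> \<open>The majorant equals \<open>d * w y\<close> on \<open>F\<close> and
    \<open>2 * w y\<close> off \<open>F\<close>, written as one combination of integrable
    functions.\<close>
  have "(LINT y|count_space UNIV. w y * norm (wave t y - 1)) \<le>
      (LINT y|count_space UNIV. 2 * w y + (d - 2) * (indicator F y *\<^sub>R w y))"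
  proof (rule integral_mono)
    show "integrable (count_space UNIV) (\<lambda>y. 2 * w y + (d - 2) * (indicator F y *\<^sub>R w y))"
      by (intro Bochner_Integration.integrable_add integrable_mult_right w(1) iF)
    have n2: "norm (wave t y - 1) \<le> 2" for y
      using norm_triangle_ineq4[of "wave t y" 1] by simp
    show "integrable (count_space UNIV) (\<lambda>y. w y * norm (wave t y - 1))"
    proof (rule Bochner_Integration.integrable_bound[OF integrable_mult_right[OF w(1), of 2]])
      have "norm (w y * norm (wave t y - 1)) \<le> norm (2 * w y)" for y
        using mult_left_mono[OF n2, of "w y" y] w(2)[of y] by (simp add: abs_mult mult.commute)
      then show "AE y in count_space UNIV. norm (w y * norm (wave t y - 1)) \<le> norm (2 * w y)"
          by simp
    qed simp
    fix y
    show "w y * norm (wave t y - 1) \<le> 2 * w y + (d - 2) * (indicator F y *\<^sub>R w y)"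
    proof (cases "y \<in> F")
      case True
      then show ?thesis using mult_left_mono[OF less_imp_le[OF t(2)[OF True]] w(2)[of y]]
          by (simp add: algebra_simps)
    next
      case False
      then show ?thesis using mult_left_mono[OF n2 w(2)[of y], of y] by simp
    qed
  qed
  also have "\<dots> = 2 * (?I - sum w F) + d * sum w F"
    by (simp only: Bochner_Integration.integral_add integrable_mult_right w(1) iF
        integral_mult_right_zero LF)
      (simp add: algebra_simps)
  also have "\<dots> \<le> 2 * (e / 8) + e / 4"
  proof -
    have "?I - sum w F \<le> e / 8" using F(2) unfolding dist_real_def by linarith
    then show ?thesis by (intro add_mono mult_left_mono d(2)) simp_all
  qed
  also have "\<dots> < e" using e by simp
  finally show ?thesis using t(1) that by blast
qed

text \<open>By \<open>gap\<close> the cutoff takes only the values 1 and 0 on the support, so no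
  mass enters with an intermediate factor. Summing over indices instead of points is what makes the
  two measures comparable.\<close>

lemma cutoff_sum:
  assumes l: "bij_betw l UNIV (supp m)" and fin: "finite {n. norm (l n - q) \<le> a}"
    and gap: "\<And>n. a < norm (l n - q) \<Longrightarrow> b \<le> norm (l n - q)" and ab: "0 \<le> b" "a < b"
  shows "(LINT x|count_space UNIV. mass m {x} * of_real (cutoff q a b x)) =
    (\<Sum>n | norm (l n - q) \<le> a. mass m {l n})"
proof -
  let ?I = "{n. norm (l n - q) \<le> a}"
  have inj: "inj_on l ?I" using l by (auto simp: bij_betw_def intro: inj_on_subset)
  have "(LINT x|count_space UNIV. mass m {x} * of_real (cutoff q a b x)) =
      (\<Sum>x\<in>l ` ?I. mass m {x} * of_real (cutoff q a b x))"
  proof (rule integral_count_space_finite)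
    fix x assume x: "x \<notin> l ` ?I"
    show "mass m {x} * of_real (cutoff q a b x) = 0"
    proof (cases "x \<in> supp m")
      case True
      then obtain n where n: "x = l n" using l unfolding bij_betw_def by blast
      then have "b \<le> norm (x - q)" using x gap[of n] by force
      then show ?thesis using cutoff_eq_0[OF ab(1), of x q a] by simp
    next
      case False
      then show ?thesis using mass_eq_0_off_supp[of "{x}" m] by simp
    qed
  qed (use fin in simp)
  also have "\<dots> = (\<Sum>n\<in>?I. mass m {l n} * of_real (cutoff q a b (l n)))"
    using inj by (simp add: sum.reindex)
  also have "\<dots> = (\<Sum>n\<in>?I. mass m {l n})"
    using ab(2) by (intro sum.cong refl) (simp add: cutoff_eq_1)
  finally show ?thesis .
qed

text \<open>Pigeonhole: the open shells are disjoint by monotonicity of \<open>r\<close>, so one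
  point in each would give \<open>M\<close> distinct points of \<open>X\<close>. Points on the
  bounding spheres are allowed, where a cutoff is still 1 or already 0.\<close>

lemma empty_shell:
  fixes X :: "'a::real_normed_vector set"
  assumes X: "finite X" "card X < M" and r: "mono r"
  obtains i where "i < M" "\<And>x. x \<in> X \<Longrightarrow> \<not> (r i < norm (x - q) \<and> norm (x - q) < r (Suc i))"
proof (rule ccontr)
  assume "\<not> thesis"
  then have "\<forall>i<M. \<exists>x\<in>X. r i < norm (x - q) \<and> norm (x - q) < r (Suc i)" using that by blast
  then obtain x where x: "\<And>i. i < M \<Longrightarrow> x i \<in> X \<and> r i < norm (x i - q) \<and> norm (x i - q) < r (Suc i)"
    by metis
  have "x i \<noteq> x j" if "i < j" "j < M" for i j
  proof -
    have "r (Suc i) \<le> r j" using that by (intro monoD[OF r]) simp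
    then show ?thesis using x[of i] x[of j] that by fastforce
  qed
  then have "inj_on x {..<M}" by (metis (no_types, lifting) inj_onI lessThan_iff linorder_neqE_nat)
  then have "card {..<M} \<le> card X" using x X(1) by (intro card_inj_on_le) auto
  then show False using X(2) by simp
qed

theorem theorem1:
  fixes \<mu> \<nu> :: "'a::euclidean_space complex_measure"
    and l g :: "nat \<Rightarrow> 'a"
  assumes "sparse_fourier_quasicrystal \<mu>"
    and "sparse_fourier_quasicrystal \<nu>"
    and "bij_betw l UNIV (supp \<mu>)"
    and "bij_betw g UNIV (supp \<nu>)"
    and "(\<lambda>n. l n - g n) \<longlonglongrightarrow> 0"
    and "(\<lambda>n. mass \<mu> {l n} - mass \<nu> {g n}) \<longlonglongrightarrow> 0"
  shows "\<mu> = \<nu>"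
proof (rule pure_point_eqI[OF sparse_pure_point[OF assms(1)] sparse_pure_point[OF assms(2)]])
  fix p :: 'a
  obtain N1 where N1: "\<And>x. finite (supp \<mu> \<inter> ball x 1)" "\<And>x. card (supp \<mu> \<inter> ball x 1) \<le> N1"
    using assms(1) unfolding sparse_fourier_quasicrystal_def by blast
  obtain N2 where N2: "\<And>x. finite (supp \<nu> \<inter> ball x 1)" "\<And>x. card (supp \<nu> \<inter> ball x 1) \<le> N2"
    using assms(2) unfolding sparse_fourier_quasicrystal_def by blast
  define M where "M = N1 + N2 + 1"
  let ?S = "supp \<mu> \<union> supp \<nu>"
  have finS: "finite (?S \<inter> ball x 1)" for x using N1(1) N2(1) by (simp add: Int_Un_distrib2)
  obtain d0 where d0: "0 < d0" "\<And>x. x \<in> ?S \<inter> ball p 1 \<Longrightarrow> x \<noteq> p \<Longrightarrow> d0 \<le> dist p x"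
    using finite_set_avoid[OF finS[of p], of p] by blast
  \<comment> \<open>Equal widths, with innermost radius \<open>r 0 = d\<close> and outermost radius
    \<open>r M = min d0 1\<close>. The bound \<open>d0\<close> keeps other points of the supports
    away from \<open>p\<close>; the bound 1 is there because both \<open>d0\<close> and the
    cardinality bounds refer to unit balls.\<close>
  define d where "d = min d0 1 / real (M + 1)"
  define r where "r i = d * real (i + 1)" for i
  have d: "0 < d" using d0(1) by (simp add: d_def)
  have rM: "r M \<le> d0" "r M \<le> 1" by (simp_all add: r_def d_def)
  have rmono: "mono r" using d by (auto simp: r_def mono_def)
  have r: "0 < r i" "r i < r (Suc i)" "r (Suc i) = r i + d" for i
    using d by (simp_all add: r_def algebra_simps add_pos_nonneg)
  have rle: "r (Suc i) \<le> r M" if "i < M" for i using that by (intro monoD[OF rmono]) simp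
  let ?f = "\<lambda>i x. complex_of_real (cutoff p (r i) (r (Suc i)) x)"
  have ft: "(\<lambda>x. ?f i (x - t)) \<in> test_functions" for i t
    unfolding cutoff_translate using r[of i] by (intro cutoff_test) auto
  obtain c1 where c1: "\<And>i. integrable (count_space UNIV) (c1 i)"
    "\<And>i t. (LINT x|count_space UNIV. mass \<mu> {x} * ?f i (x - t)) =
        (LINT y|count_space UNIV. c1 i y * wave t y)"
    using sparse_translates[OF assms(1) ft] by metis
  obtain c2 where c2: "\<And>i. integrable (count_space UNIV) (c2 i)"
    "\<And>i t. (LINT x|count_space UNIV. mass \<nu> {x} * ?f i (x - t)) =
        (LINT y|count_space UNIV. c2 i y * wave t y)"
    using sparse_translates[OF assms(2) ft] by metis
  \<comment> \<open>All \<open>M\<close> cutoffs and both measures enter, because the index of the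
    free shell depends on the \<open>t\<close> still to be found.\<close>
  define w where "w y = (\<Sum>i<M. norm (c1 i y) + norm (c2 i y))" for y
  have w: "integrable (count_space UNIV) w" "\<And>y. 0 \<le> w y"
    unfolding w_def using c1(1) c2(1)
    by (auto intro!: Bochner_Integration.integrable_sum Bochner_Integration.integrable_add
        integrable_norm sum_nonneg)
  \<comment> \<open>At most \<open>p\<close> itself contributes; for \<open>p\<close> outside the
    support of \<open>m\<close> both sides are 0, so no case distinction on \<open>p\<close> arises
    later.\<close>
  have at0: "(LINT x|count_space UNIV. mass m {x} * ?f i (x - 0)) = mass m {p}"
    if "i < M" "supp m \<subseteq> ?S" for i m
  proof -
    have "(LINT x|count_space UNIV. mass m {x} * ?f i (x - 0)) =
        (\<Sum>x\<in>{p}. mass m {x} * ?f i (x - 0))"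
    proof (rule integral_count_space_finite)
      fix x assume x: "x \<notin> {p}"
      show "mass m {x} * ?f i (x - 0) = 0"
      proof (cases "x \<in> supp m")
        case True
        have "r (Suc i) \<le> norm (x - p)"
        proof (cases "x \<in> ball p 1")
          case True
          then have "d0 \<le> dist p x" using d0(2)[of x] x \<open>x \<in> supp m\<close> that(2) by blast
          then show ?thesis using rle[OF that(1)] rM(1) by (simp add: dist_norm norm_minus_commute)
        next
          case False
          then show ?thesis using rle[OF that(1)] rM(2) by (simp add: dist_norm norm_minus_commute)
        qed
        then show ?thesis using r[of "Suc i"] by (simp add: cutoff_eq_0)
      next
        case False
        then show ?thesis using mass_eq_0_off_supp[of "{x}" m] by simp
      qed
    qed simp
    also have "\<dots> = mass m {p}" using r[of i] by (simp add: cutoff_eq_1)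
    finally show ?thesis .
  qed
  \<comment> \<open>\<open>N1 * e\<close> comes from the termwise comparison after translation, over
    at most \<open>N1\<close> indices, and one \<open>e\<close> from each of the two
    translations.\<close>
  have close: "norm (mass \<mu> {p} - mass \<nu> {p}) \<le> (real N1 + 2) * e" if e: "0 < e" for e
  proof -
    \<comment> \<open>The threshold is exactly the width of a shell, so a pair cannot straddle a
      free one.\<close>
    obtain n1 where n1: "\<And>n. n1 \<le> n \<Longrightarrow> norm (l n - g n) < d"
      using LIMSEQ_D[OF assms(5) d] by auto
    obtain n2 where n2: "\<And>n. n2 \<le> n \<Longrightarrow> norm (mass \<mu> {l n} - mass \<nu> {g n}) < e"
      using LIMSEQ_D[OF assms(6) e] by auto
    define n0 where "n0 = max n1 n2"
    \<comment> \<open>The limits say nothing about the indices below \<open>n0\<close>. A bound for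
      all their points lets \<open>t\<close> be taken so large that none of them is within distance
      1 of \<open>q\<close>.\<close>
    define Q where "Q = (\<Sum>n<n0. norm (l n) + norm (g n))"
    have Q: "norm (l n) \<le> Q" "norm (g n) \<le> Q" if "n < n0" for n
    proof -
      have "norm (l n) + norm (g n) \<le> Q"
        unfolding Q_def using that by (intro member_le_sum) auto
      then show "norm (l n) \<le> Q" "norm (g n) \<le> Q"
        using norm_ge_zero[of "l n"] norm_ge_zero[of "g n"] by linarith+
    qed
    obtain t where t: "Q + norm p + 1 < norm t"
        "(LINT y|count_space UNIV. w y * norm (wave t y - 1)) < e"
      using almost_period_integral[OF w e] by blast
    define q where "q = p + t"
    have far: "1 < norm (z - q)" if "norm z \<le> Q" for z
    proof -
      have "norm t \<le> norm (z - q) + norm (z - p)" using norm_triangle_ineq4[of "z - p" "z - q"]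
          by (simp add: q_def)
      moreover have "norm (z - p) \<le> norm z + norm p" by (rule norm_triangle_ineq4)
      ultimately show ?thesis using that t(1) by linarith
    qed
    have "card (?S \<inter> ball q 1) < M"
    proof -
      have "card (?S \<inter> ball q 1) \<le> card (supp \<mu> \<inter> ball q 1) + card (supp \<nu> \<inter> ball q 1)"
        unfolding Int_Un_distrib2 by (rule card_Un_le)
      then show ?thesis using N1(2)[of q] N2(2)[of q] by (simp add: M_def)
    qed
    then obtain i where i: "i < M"
      and shell: "\<And>x. x \<in> ?S \<inter> ball q 1 \<Longrightarrow> \<not> (r i < norm (x - q) \<and> norm (x - q) < r (Suc i))"
      using empty_shell[OF finS _ rmono] by metis
    have gap: "r (Suc i) \<le> norm (x - q)" if "x \<in> ?S" "r i < norm (x - q)" for x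
    proof (rule ccontr)
      assume *: "\<not> r (Suc i) \<le> norm (x - q)"
      then have "x \<in> ball q 1" using rle[OF i] rM(2) by (simp add: dist_norm norm_minus_commute)
      then show False using shell[of x] that * by simp
    qed
    have lS: "l n \<in> ?S" "g n \<in> ?S" for n using assms(3,4) by (auto simp: bij_betw_def)
    have ri1: "r i < 1" using r(2)[of i] rle[OF i] rM(2) by linarith
    \<comment> \<open>For early indices both points are farther than 1 from \<open>q\<close>. For
      later ones, a point within \<open>r i\<close> and a partner beyond the free shell would be at
      least \<open>d\<close> apart.\<close>
    have same: "norm (l n - q) \<le> r i \<longleftrightarrow> norm (g n - q) \<le> r i" for n
    proof (cases "n < n0")
      case True
      then show ?thesis using far[OF Q(1)[OF True]] far[OF Q(2)[OF True]] ri1 by linarith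
    next
      case False
      then have lg: "norm (l n - g n) < d" using n1 by (simp add: n0_def)
      have "norm (g n - q) \<le> norm (l n - q) + norm (l n - g n)"
        using norm_triangle_ineq4[of "l n - q" "l n - g n"] by simp
      moreover have "norm (l n - q) \<le> norm (g n - q) + norm (l n - g n)"
        using norm_triangle_ineq[of "g n - q" "l n - g n"] by simp
      ultimately show ?thesis
        using lg gap[OF lS(1), of n] gap[OF lS(2), of n] r(3)[of i] by linarith
    qed
    let ?I = "{n. norm (l n - q) \<le> r i}"
    have inj: "inj_on l ?I" using assms(3) by (auto simp: bij_betw_def intro: inj_on_subset)
    have sub: "l ` ?I \<subseteq> supp \<mu> \<inter> ball q 1"
      using assms(3) ri1 by (auto simp: bij_betw_def dist_norm norm_minus_commute)
    have finI: "finite ?I" using finite_imageD[OF finite_subset[OF sub N1(1)] inj] .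
    have cardI: "card ?I \<le> N1"
      using card_mono[OF N1(1) sub] N1(2)[of q] card_image[OF inj] by simp
    have gI: "{n. norm (g n - q) \<le> r i} = ?I" using same by simp
    let ?A = "\<lambda>m t. LINT x|count_space UNIV. mass m {x} * ?f i (x - t)"
    have A1: "?A \<mu> t = (\<Sum>n\<in>?I. mass \<mu> {l n})"
      unfolding cutoff_translate q_def[symmetric]
      by (rule cutoff_sum[OF assms(3) finI gap[OF lS(1)]]) (use r[of i] in auto)
    have A2: "?A \<nu> t = (\<Sum>n\<in>?I. mass \<nu> {g n})"
      unfolding cutoff_translate q_def[symmetric] gI[symmetric]
      by (rule cutoff_sum[OF assms(4) _ gap[OF lS(2)]]) (use r[of i] finI gI in auto)
    have "norm (?A \<mu> t - ?A \<nu> t) \<le> (\<Sum>n\<in>?I. norm (mass \<mu> {l n} - mass \<nu> {g n}))"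
      unfolding A1 A2 sum_subtractf[symmetric] by (rule norm_sum)
    also have "\<dots> \<le> (\<Sum>n\<in>?I. e)"
    proof (rule sum_mono)
      fix n assume "n \<in> ?I"
      then have "\<not> n < n0" using far[OF Q(1)[of n]] ri1 by force
      then have "n2 \<le> n" by (simp add: n0_def)
      then show "norm (mass \<mu> {l n} - mass \<nu> {g n}) \<le> e" using n2[of n] by simp
    qed
    also have "\<dots> \<le> real N1 * e" using cardI e by (simp add: mult_right_mono)
    finally have B0: "norm (?A \<mu> t - ?A \<nu> t) \<le> real N1 * e" .
    \<comment> \<open>Subtracting the two series termwise leaves \<bar>c y\<bar> times the distance
      of the wave from 1; \<open>w\<close> dominates every coefficient family, so the single choice
      of \<open>t\<close> applies.\<close>
    have diff: "norm (?A m t - ?A m 0) \<le> e"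
      if c: "integrable (count_space UNIV) c"
          "\<And>t. ?A m t = (LINT y|count_space UNIV. c y * wave t y)"
        and le: "\<And>y. norm (c y) \<le> w y" for m c
    proof -
      have ci: "integrable (count_space UNIV) (\<lambda>y. c y * wave t y)" for t
        by (rule Bochner_Integration.integrable_bound[OF integrable_norm[OF c(1)]]) (auto simp:
            norm_mult)
      have "?A m t - ?A m 0 = (LINT y|count_space UNIV. c y * wave t y - c y * wave 0 y)"
        unfolding c(2) by (rule Bochner_Integration.integral_diff[symmetric, OF ci ci])
      also have "norm \<dots> \<le> (LINT y|count_space UNIV. w y * norm (wave t y - 1))"
      proof (rule Bochner_Integration.integral_norm_bound_integral)
        show "integrable (count_space UNIV) (\<lambda>y. c y * wave t y - c y * wave 0 y)"
          by (intro Bochner_Integration.integrable_diff ci)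
        show "integrable (count_space UNIV) (\<lambda>y. w y * norm (wave t y - 1))"
        proof (rule Bochner_Integration.integrable_bound[OF integrable_mult_right[OF w(1), of 2]])
          have "norm (w y * norm (wave t y - 1)) \<le> norm (2 * w y)" for y
            using norm_triangle_ineq4[of "wave t y" 1] mult_left_mono[of "norm (wave t y - 1)" 2
                "w y"] w(2)[of y]
            by (simp add: abs_mult mult.commute)
          then show "AE y in count_space UNIV. norm (w y * norm (wave t y - 1)) \<le> norm (2 * w y)"
              by simp
        qed simp
        fix y
        have "norm (c y * wave t y - c y * wave 0 y) = norm (c y) * norm (wave t y - 1)"
          by (simp add: norm_mult[symmetric] right_diff_distrib)
        also have "\<dots> \<le> w y * norm (wave t y - 1)" by (intro mult_right_mono le) simp
        finally show "norm (c y * wave t y - c y * wave 0 y) \<le> w y * norm (wave t y - 1)" .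
      qed
      finally show ?thesis using t(2) by simp
    qed
    have "norm (c1 i y) + norm (c2 i y) \<le> w y" for y
      unfolding w_def using i by (intro member_le_sum) auto
    then have le: "norm (c1 i y) \<le> w y" "norm (c2 i y) \<le> w y" for y
      by (meson add_increasing add_increasing2 norm_ge_zero order_refl order_trans)+
    have B1: "norm (?A \<mu> t - mass \<mu> {p}) \<le> e" "norm (?A \<nu> t - mass \<nu> {p}) \<le> e"
      using diff[OF c1(1) c1(2) le(1)] diff[OF c2(1) c2(2) le(2)] at0[OF i, of \<mu>] at0[OF i, of \<nu>]
          by simp_all
    have "mass \<mu> {p} - mass \<nu> {p} = (?A \<mu> t - ?A \<nu> t) - (?A \<mu> t - mass \<mu> {p}) + (?A \<nu> t -
        mass \<nu> {p})" by simp
    also have "norm \<dots> \<le> real N1 * e + e + e"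
      by (rule order_trans[OF norm_triangle_ineq
            add_mono[OF order_trans[OF norm_triangle_ineq4 add_mono[OF B0 B1(1)]] B1(2)]])
    finally show ?thesis by (simp add: algebra_simps)
  qed
  show "mass \<mu> {p} = mass \<nu> {p}"
  proof (rule ccontr)
    let ?z = "norm (mass \<mu> {p} - mass \<nu> {p})"
    assume "mass \<mu> {p} \<noteq> mass \<nu> {p}"
    then have z: "0 < ?z" by simp
    \<comment> \<open>This \<open>e\<close> makes the bound half of \<open>?z\<close>, which
      contradicts \<open>0 < ?z\<close>.\<close>
    then have "?z \<le> (real N1 + 2) * (?z / (2 * (real N1 + 2)))" by (intro close) simp
    also have "\<dots> = ?z / 2" by (simp add: field_simps)
    finally show False using z by simp
  qed
qed

end
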